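(* There is an algorithm that computes an optimal solution of MinMD$+$OCTC$_{line}$ in $O(n^4 m)$ time, where $n$ is the number of targets and $m$ is the number of base stations.
   Context: MinMD$+$OCTC$_{line}$: targets $\mathcal{T}=\{t_1,\dots,t_n\}$ lie on a line $L$, taken as the $x$-axis, so $t_i=(x(t_i),0)$. Base stations $\mathcal{B}=\{b_1,\dots,b_m\}$ are points of the plane, and $b_k$ has an opening cost $c_k\ge 0$. A fixed radius $r\ge 0$ is given. A solution consists of a set of opened base stations and a finite multiset of mobile sensors; each sensor $s$ is emitted by some opened base station $b_k$ and is placed at a destination point on $L$; its moving distance is the Euclidean distance from $b_k$ to the destination of $s$. A sensor covers a target if the target is at Euclidean distance at most $r$ from the sensor's destination. An opened base station may emit arbitrarily many sensors. A solution is feasible if every target is covered by some sensor; its cost is the sum of the opening costs of opened base stations plus the sum of the moving distances of all sensors. The goal is to find a feasible solution of minimum cost. Running time is measured in the real-RAM model (arithmetic and square roots on reals in unit time). *)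

theory Defs
  imports Complex_Main
begin

text \<open>An instance: n targets with x-coordinates tx 0..tx (n-1) on the x-axis;
  m base stations, station k at (bx k, by k) with opening cost c k; radius r.
  A solution: a set Op of opened stations (indices < m) and a finite multiset of
  sensors, represented as a list of pairs (k, d): the sensor is emitted by station k
  and placed at the point (d, 0) of the line.\<close>

definition move_dist :: "(nat \<Rightarrow> real) \<Rightarrow> (nat \<Rightarrow> real) \<Rightarrow> nat \<times> real \<Rightarrow> real" where
  "move_dist bx by s = sqrt ((bx (fst s) - snd s)^2 + (by (fst s))^2)"

definition is_solution :: "nat \<Rightarrow> nat set \<Rightarrow> (nat \<times> real) list \<Rightarrow> bool" where
  "is_solution m Op S \<longleftrightarrow> Op \<subseteq> {..<m} \<and> (\<forall>s\<in>set S. fst s \<in> Op)"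

definition feasible :: "nat \<Rightarrow> (nat \<Rightarrow> real) \<Rightarrow> real \<Rightarrow> (nat \<times> real) list \<Rightarrow> bool" where
  "feasible n tx r S \<longleftrightarrow> (\<forall>i<n. \<exists>s\<in>set S. \<bar>tx i - snd s\<bar> \<le> r)"

definition sol_cost :: "(nat \<Rightarrow> real) \<Rightarrow> (nat \<Rightarrow> real) \<Rightarrow> (nat \<Rightarrow> real)
    \<Rightarrow> nat set \<Rightarrow> (nat \<times> real) list \<Rightarrow> real" where
  "sol_cost bx by c Op S = (\<Sum>k\<in>Op. c k) + (\<Sum>s\<leftarrow>S. move_dist bx by s)"

definition optimal_solution where
  "optimal_solution n m tx bx by c r Op S \<longleftrightarrow>
     is_solution m Op S \<and> feasible n tx r S \<and>
     (\<forall>Op' S'. is_solution m Op' S' \<longrightarrow> feasible n tx r S' \<longrightarrow>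
        sol_cost bx by c Op S \<le> sol_cost bx by c Op' S')"

datatype instr =
    Const nat int
  | Add nat nat nat
  | Sub nat nat nat
  | Mul nat nat nat
  | Divi nat nat nat
  | Sqrt nat nat
  | Load nat nat
  | Store nat nat
  | Jle nat nat nat
  | Halt

datatype mstate = Run nat "nat \<Rightarrow> real" | Done "nat \<Rightarrow> real" | Fail

definition addr :: "real \<Rightarrow> nat" where "addr x = nat \<lfloor>x\<rfloor>"

fun exec_instr :: "instr \<Rightarrow> nat \<Rightarrow> (nat \<Rightarrow> real) \<Rightarrow> mstate" where
  "exec_instr (Const i v) pc mem = Run (Suc pc) (mem(i := real_of_int v))"
| "exec_instr (Add i j k) pc mem = Run (Suc pc) (mem(i := mem j + mem k))"
| "exec_instr (Sub i j k) pc mem = Run (Suc pc) (mem(i := mem j - mem k))"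
| "exec_instr (Mul i j k) pc mem = Run (Suc pc) (mem(i := mem j * mem k))"
| "exec_instr (Divi i j k) pc mem =
     (if mem k = 0 then Fail else Run (Suc pc) (mem(i := mem j / mem k)))"
| "exec_instr (Sqrt i j) pc mem =
     (if mem j < 0 then Fail else Run (Suc pc) (mem(i := sqrt (mem j))))"
| "exec_instr (Load i j) pc mem =
     (if mem j \<in> \<nat> then Run (Suc pc) (mem(i := mem (addr (mem j)))) else Fail)"
| "exec_instr (Store i j) pc mem =
     (if mem i \<in> \<nat> then Run (Suc pc) (mem(addr (mem i) := mem j)) else Fail)"
| "exec_instr (Jle i j l) pc mem = (if mem i \<le> mem j then Run l mem else Run (Suc pc) mem)"
| "exec_instr Halt pc mem = Done mem"

fun step :: "instr list \<Rightarrow> mstate \<Rightarrow> mstate" where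
  "step P (Run pc mem) = (if pc < length P then exec_instr (P ! pc) pc mem else Fail)"
| "step P (Done mem) = Done mem"
| "step P Fail = Fail"

definition halts_within :: "instr list \<Rightarrow> (nat \<Rightarrow> real) \<Rightarrow> nat \<Rightarrow> (nat \<Rightarrow> real) \<Rightarrow> bool" where
  "halts_within P mem t out \<longleftrightarrow> (step P ^^ t) (Run 0 mem) = Done out"

definition input_mem :: "nat \<Rightarrow> nat \<Rightarrow> real \<Rightarrow> (nat \<Rightarrow> real) \<Rightarrow> (nat \<Rightarrow> real)
    \<Rightarrow> (nat \<Rightarrow> real) \<Rightarrow> (nat \<Rightarrow> real) \<Rightarrow> nat \<Rightarrow> real" where
  "input_mem n m r tx bx by c a =
     (if a = 0 then real n else if a = 1 then real m else if a = 2 then r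
      else if a < 3 + n then tx (a - 3)
      else if a < 3 + n + 3 * m then
        (let j = a - 3 - n in
          if j mod 3 = 0 then bx (j div 3) else if j mod 3 = 1 then by (j div 3) else c (j div 3))
      else 0)"

text \<open>Output: cell 0 = K (number of sensors, a natural number); cells 1..m hold 0/1
  opening flags of the stations 0..m-1; for i < K, cell m+1+2i holds the index of the
  emitting station (a natural number < m) and cell m+2+2i the x-coordinate of the
  destination of sensor i.\<close>
definition output_wf :: "nat \<Rightarrow> (nat \<Rightarrow> real) \<Rightarrow> bool" where
  "output_wf m out \<longleftrightarrow> out 0 \<in> \<nat> \<and> (\<forall>j<m. out (1 + j) = 0 \<or> out (1 + j) = 1) \<and>
     (\<forall>i<addr (out 0). out (m + 1 + 2 * i) \<in> \<nat> \<and> addr (out (m + 1 + 2 * i)) < m)"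

definition out_open :: "nat \<Rightarrow> (nat \<Rightarrow> real) \<Rightarrow> nat set" where
  "out_open m out = {j. j < m \<and> out (1 + j) = 1}"

definition out_sensors :: "nat \<Rightarrow> (nat \<Rightarrow> real) \<Rightarrow> (nat \<times> real) list" where
  "out_sensors m out =
     map (\<lambda>i. (addr (out (m + 1 + 2 * i)), out (m + 2 + 2 * i))) [0..<addr (out 0)]"

end

theory Submission
  imports Defs "HOL-Library.Nat_Bijection" "HOL-Library.Multiset"
begin

text \<open>
  For a fixed set of opened stations every sensor may be assumed to be emitted by the nearest one.  The Voronoi cells of the
  stations meet the line in intervals, so along the line the sensors of one station are consecutive.  After sorting the targets it
  therefore suffices to minimise over sequences of blocks of consecutive targets, each covered by one sensor, where one pays
  the opening cost on every change of station: a sequence that returns to a station pays twice, which only overestimates the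
  cost of a solution.  A sensor of station \<open>k\<close> for the targets \<open>i, \<dots>, j\<close> is best placed at the point of
  \<open>[x j - r, x i + r]\<close> closest to the abscissa of \<open>k\<close>.  The resulting dynamic program over pairs (number of covered
  targets, open station) takes \<open>O(n\<^sup>2 m)\<close> steps.  The machine program is obtained by compiling a small imperative language
  whose time-bounded Hoare logic carries the proof.\<close>

section \<open>A structured language on the real RAM\<close>

text \<open>Optimality has two halves that meet in the table. Its entries bound the cost of every
  solution from below, for which the inequalities of the recurrence suffice; the equalities,
  recorded as pointers, serve to trace back one solution whose true cost does not exceed the best
  final entry. There a station is paid once however often it was charged, so overcharging is
  harmless. The price of a change depends only on the new station, so comparing with the minimum of
  a row replaces a minimum over pairs of stations, which would be quadratic in \<open>m\<close>. As
  \<open>0 <= r\<close>, a single target can always be covered, so every minimum has a finite first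
  candidate and no value for infinity is needed.

  The machine shapes the rest. Input and output both start at cell 0 and have a length known only at
  run time, while register addresses are fixed in the program and the arrays are unbounded. Hence
  the memory has registers below, arrays above a computed base \<open>Z\<close> and raw cells
  between, and extra code around the compiled program vacates and refills the registers.\<close>

text \<open>\<open>Rg v\<close> is the fixed cell \<open>v\<close>, \<open>Raw a\<close> the cell \<open>a\<close> with \<open>regs \<le> a < Z\<close>, and
  \<open>Ar a i k\<close> the entry \<open>(i, k)\<close> of an unbounded two-dimensional array, stored above the address \<open>Z\<close>
  that register 0 holds.  The pairing function makes the arrays disjoint without any bound on their size.\<close>
datatype loc = Rg nat | Ar nat nat nat | Raw nat
type_synonym st = "loc \<Rightarrow> real"

datatype expr = Var nat | Num int | EAdd expr expr | ESub expr expr | EMul expr expr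
  | EDiv expr expr | ESqrt expr | EArr nat expr expr | ERaw expr

text \<open>Registers below \<open>tmpreg\<close> are the variables of a program; those from \<open>tmpreg\<close> to
  \<open>regs - 1\<close> are the evaluation stack of the compiled expressions.\<close>
definition tmpreg :: nat where "tmpreg = 20"
definition regs :: nat where "regs = 40"

lemma tmpreg_pos [simp]: "0 < tmpreg" and tmpreg_regs: "tmpreg + 4 \<le> regs"
  by (simp_all add: tmpreg_def regs_def)

fun ev :: "expr \<Rightarrow> st \<Rightarrow> real" where
  "ev (Var v) s = s (Rg v)"
| "ev (Num z) s = real_of_int z"
| "ev (EAdd a b) s = ev a s + ev b s"
| "ev (ESub a b) s = ev a s - ev b s"
| "ev (EMul a b) s = ev a s * ev b s"
| "ev (EDiv a b) s = ev a s / ev b s"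
| "ev (ESqrt a) s = sqrt (ev a s)"
| "ev (EArr a i k) s = s (Ar a (addr (ev i s)) (addr (ev k s)))"
| "ev (ERaw a) s = s (Raw (addr (ev a s)))"

text \<open>The machine fails on a zero divisor, a negative radicand or a non-natural address,
  whereas \<open>ev\<close> is total. The bounds for \<open>ERaw\<close> keep raw accesses off the
  registers below \<open>regs\<close> and off the arrays from \<open>Z\<close> on.\<close>

fun defined :: "expr \<Rightarrow> st \<Rightarrow> bool" where
  "defined (Var v) s \<longleftrightarrow> True"
| "defined (Num z) s \<longleftrightarrow> True"
| "defined (EAdd a b) s \<longleftrightarrow> defined a s \<and> defined b s"
| "defined (ESub a b) s \<longleftrightarrow> defined a s \<and> defined b s"
| "defined (EMul a b) s \<longleftrightarrow> defined a s \<and> defined b s"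
| "defined (EDiv a b) s \<longleftrightarrow> defined a s \<and> defined b s \<and> ev b s \<noteq> 0"
| "defined (ESqrt a) s \<longleftrightarrow> defined a s \<and> ev a s \<ge> 0"
| "defined (EArr a i k) s \<longleftrightarrow> defined i s \<and> defined k s \<and> ev i s \<in> \<nat> \<and> ev k s \<in> \<nat>"
| "defined (ERaw a) s \<longleftrightarrow> defined a s \<and> ev a s \<in> \<nat> \<and> regs \<le> addr (ev a s) \<and> addr (ev a s) < addr (s (Rg 0))"

text \<open>A variable takes two cells because there is no move instruction: it is copied by adding
  a zero held in the next cell. An array access takes at least three because pairing needs a scratch
  cell above both indices.\<close>

fun stack_size :: "expr \<Rightarrow> nat" where
  "stack_size (Var v) = 2"
| "stack_size (Num z) = 1"
| "stack_size (EAdd a b) = max (stack_size a) (Suc (stack_size b))"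
| "stack_size (ESub a b) = max (stack_size a) (Suc (stack_size b))"
| "stack_size (EMul a b) = max (stack_size a) (Suc (stack_size b))"
| "stack_size (EDiv a b) = max (stack_size a) (Suc (stack_size b))"
| "stack_size (ESqrt a) = stack_size a"
| "stack_size (EArr a i k) = max 3 (max (stack_size i) (Suc (stack_size k)))"
| "stack_size (ERaw a) = stack_size a"

lemma stack_size_pos: "0 < stack_size e"
  by (induction e) auto

fun wfe :: "expr \<Rightarrow> bool" where
  "wfe (Var v) \<longleftrightarrow> v < tmpreg"
| "wfe (Num z) \<longleftrightarrow> True"
| "wfe (EAdd a b) \<longleftrightarrow> wfe a \<and> wfe b"
| "wfe (ESub a b) \<longleftrightarrow> wfe a \<and> wfe b"
| "wfe (EMul a b) \<longleftrightarrow> wfe a \<and> wfe b"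
| "wfe (EDiv a b) \<longleftrightarrow> wfe a \<and> wfe b"
| "wfe (ESqrt a) \<longleftrightarrow> wfe a"
| "wfe (EArr a i k) \<longleftrightarrow> wfe i \<and> wfe k"
| "wfe (ERaw a) \<longleftrightarrow> wfe a"

text \<open>Leaves \<open>prod_encode (x, y)\<close> in \<open>x\<close>, using \<open>t\<close> as scratch.\<close>
definition pairc :: "nat \<Rightarrow> nat \<Rightarrow> nat \<Rightarrow> instr list" where
  "pairc x y t = [Add y x y, Const t 1, Add t y t, Mul y y t, Const t 2, Divi y y t, Add x x y]"

definition addrc :: "nat \<Rightarrow> nat \<Rightarrow> instr list" where
  "addrc d a = pairc d (Suc d) (Suc (Suc d)) @ [Const (Suc d) (int a)]
     @ pairc (Suc d) d (Suc (Suc d)) @ [Add d (Suc d) 0]"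

fun cexp :: "nat \<Rightarrow> expr \<Rightarrow> instr list" where
  "cexp d (Var v) = [Const (Suc d) 0, Add d v (Suc d)]"
| "cexp d (Num z) = [Const d z]"
| "cexp d (EAdd a b) = cexp d a @ cexp (Suc d) b @ [Add d d (Suc d)]"
| "cexp d (ESub a b) = cexp d a @ cexp (Suc d) b @ [Sub d d (Suc d)]"
| "cexp d (EMul a b) = cexp d a @ cexp (Suc d) b @ [Mul d d (Suc d)]"
| "cexp d (EDiv a b) = cexp d a @ cexp (Suc d) b @ [Divi d d (Suc d)]"
| "cexp d (ESqrt a) = cexp d a @ [Sqrt d d]"
| "cexp d (EArr a i k) = cexp d i @ cexp (Suc d) k @ addrc d a @ [Load d d]"
| "cexp d (ERaw a) = cexp d a @ [Load d d]"

section \<open>Array addresses and straight-line machine code\<close>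

definition cell :: "nat \<Rightarrow> nat \<Rightarrow> nat \<Rightarrow> nat \<Rightarrow> nat" where
  "cell Z a i k = Z + prod_encode (a, prod_encode (i, k))"

lemma cell_inj [simp]: "cell Z a i k = cell Z a' i' k' \<longleftrightarrow> a = a' \<and> i = i' \<and> k = k'"
  by (simp add: cell_def)

lemma cell_ge: "Z \<le> cell Z a i k"
  by (simp add: cell_def)

lemma addr_of_nat [simp]: "addr (real i) = i"
  by (simp add: addr_def)

text \<open>The program counter 0 is a dummy: other instructions merely increment it, and
  \<open>nojump\<close> excludes jumps wherever a result is transferred to
  \<open>step\<close>.\<close>

fun run_straight :: "instr list \<Rightarrow> (nat \<Rightarrow> real) \<Rightarrow> (nat \<Rightarrow> real) option" where
  "run_straight [] m = Some m"
| "run_straight (i # ins) m = (case exec_instr i 0 m of Run _ m' \<Rightarrow> run_straight ins m' | _ \<Rightarrow> None)"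

lemma run_straight_append: "run_straight (xs @ ys) m = (case run_straight xs m of Some m' \<Rightarrow> run_straight ys m' | None \<Rightarrow> None)"
  by (induction xs arbitrary: m) (auto split: mstate.splits)

lemma run_straight_appendI: "run_straight xs m = Some m' \<Longrightarrow> run_straight ys m' = Some m'' \<Longrightarrow> run_straight (xs @ ys) m = Some m''"
  by (simp add: run_straight_append)

fun nojump :: "instr \<Rightarrow> bool" where
  "nojump (Jle _ _ _) = False" | "nojump Halt = False" | "nojump _ = True"

definition code_at :: "instr list \<Rightarrow> nat \<Rightarrow> instr list \<Rightarrow> bool" where
  "code_at P pc ins \<longleftrightarrow> (\<exists>A B. P = A @ ins @ B \<and> length A = pc)"

lemma code_at_append: "code_at P pc (xs @ ys) \<longleftrightarrow> code_at P pc xs \<and> code_at P (pc + length xs) ys"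
proof
  assume "code_at P pc (xs @ ys)"
  then obtain A B where "P = A @ (xs @ ys) @ B" "length A = pc" by (auto simp: code_at_def)
  then have "P = A @ xs @ (ys @ B)" "P = (A @ xs) @ ys @ B" "length (A @ xs) = pc + length xs" by auto
  then show "code_at P pc xs \<and> code_at P (pc + length xs) ys"
    unfolding code_at_def using \<open>length A = pc\<close> by blast
next
  assume "code_at P pc xs \<and> code_at P (pc + length xs) ys"
  then obtain A B A' B' where *: "P = A @ xs @ B" "length A = pc"
    "P = A' @ ys @ B'" "length A' = pc + length xs" unfolding code_at_def by metis
  then have "A' = A @ xs" by (metis append_assoc append_eq_append_conv length_append)
  then show "code_at P pc (xs @ ys)" using * unfolding code_at_def by auto
qed

lemma code_at_nth: "code_at P pc (i # ins) \<Longrightarrow> pc < length P \<and> P ! pc = i"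
  by (auto simp: code_at_def)

lemma code_at_Cons: "code_at P pc (i # ins) \<longleftrightarrow> code_at P pc [i] \<and> code_at P (Suc pc) ins"
  using code_at_append[of P pc "[i]" "ins"] by simp

lemma nojump_exec: "nojump i \<Longrightarrow> exec_instr i 0 m = Run q m' \<Longrightarrow> exec_instr i pc m = Run (Suc pc) m'"
  by (cases i) (auto split: if_splits)

lemma run_straight_steps:
  "list_all nojump ins \<Longrightarrow> run_straight ins m = Some m' \<Longrightarrow> code_at P pc ins \<Longrightarrow>
   (step P ^^ length ins) (Run pc m) = Run (pc + length ins) m'"
proof (induction "ins" arbitrary: m pc)
  case (Cons i ins)
  then obtain q m1 where 1: "exec_instr i 0 m = Run q m1" "run_straight ins m1 = Some m'"
    by (auto split: mstate.splits)
  have "step P (Run pc m) = Run (Suc pc) m1"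
    using nojump_exec[OF _ 1(1)] code_at_nth[OF Cons.prems(3)] Cons.prems(1) by simp
  then show ?case using Cons 1 by (simp add: funpow_swap1[symmetric] code_at_Cons[of P pc i "ins"] del: step.simps)
     (simp add: funpow_swap1 del: step.simps)
qed simp

lemma nojump_pairc [simp]: "list_all nojump (pairc x y t)" by (simp add: pairc_def)
lemma nojump_addrc [simp]: "list_all nojump (addrc d a)" by (simp add: addrc_def)
lemma nojump_cexp [simp]: "list_all nojump (cexp d e)" by (induction e arbitrary: d) auto

lemma real_triangle: "real (triangle n) = real n * (real n + 1) / 2"
  by (induction n) (auto simp: field_simps)

lemma run_straight_pairc:
  assumes "m x = real i" "m y = real k" "x \<noteq> y" "x \<noteq> t" "y \<noteq> t"
  obtains m' where "run_straight (pairc x y t) m = Some m'" "m' x = real (prod_encode (i, k))"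
    "\<And>a. a \<notin> {x, y, t} \<Longrightarrow> m' a = m a"
proof -
  obtain m' where m': "run_straight (pairc x y t) m = Some m'"
    and x: "m' x = real i + (real i + real k) * (real i + real k + 1) / 2"
    and f: "\<And>a. a \<notin> {x, y, t} \<Longrightarrow> m' a = m a"
    using assms by (simp add: pairc_def)
  have "m' x = real (prod_encode (i, k))"
    by (simp add: x prod_encode_def real_triangle)
  with m' f show ?thesis using that by blast
qed

lemma run_straight_addrc:
  assumes "m d = real i" "m (Suc d) = real k" "m 0 = real Z" "0 < d"
  obtains m' where "run_straight (addrc d a) m = Some m'" "m' d = real (cell Z a i k)"
    "\<And>b. b \<notin> {d, Suc d, Suc (Suc d)} \<Longrightarrow> m' b = m b"
proof -
  from run_straight_pairc[of m d i "Suc d" k "Suc (Suc d)"] assms obtain m1 where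
    m1: "run_straight (pairc d (Suc d) (Suc (Suc d))) m = Some m1" "m1 d = real (prod_encode (i, k))"
    "\<And>b. b \<notin> {d, Suc d, Suc (Suc d)} \<Longrightarrow> m1 b = m b" by auto
  from run_straight_pairc[of "m1(Suc d := real a)" "Suc d" a d "prod_encode (i, k)" "Suc (Suc d)"] m1
  obtain m2 where
    m2: "run_straight (pairc (Suc d) d (Suc (Suc d))) (m1(Suc d := real a)) = Some m2"
    "m2 (Suc d) = real (prod_encode (a, prod_encode (i, k)))"
    "\<And>b. b \<notin> {Suc d, d, Suc (Suc d)} \<Longrightarrow> m2 b = (m1(Suc d := real a)) b" by auto
  have "m2 0 = real Z" using m1(3)[of 0] m2(3)[of 0] assms by simp
  then have "run_straight (addrc d a) m = Some (m2(d := real (cell Z a i k)))"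
    using m1 m2 by (simp add: addrc_def run_straight_append cell_def add.commute)
  then show ?thesis using that[of "m2(d := real (cell Z a i k))"] m1(3) m2(3) by simp
qed

text \<open>Cells from \<open>tmpreg\<close> to \<open>regs - 1\<close> are left unconstrained, so
  evaluation may overwrite them. \<open>Z\<close> can stay fixed during a whole run because
  \<open>wfc\<close> forbids assignments to register 0.\<close>

definition rel :: "nat \<Rightarrow> st \<Rightarrow> (nat \<Rightarrow> real) \<Rightarrow> bool" where
  "rel Z s m \<longleftrightarrow> s (Rg 0) = real Z \<and> (\<forall>v<tmpreg. m v = s (Rg v)) \<and>
     (\<forall>a i k. m (cell Z a i k) = s (Ar a i k)) \<and> (\<forall>a. regs \<le> a \<longrightarrow> a < Z \<longrightarrow> m a = s (Raw a))"

lemma rel_cong: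
  assumes "rel Z s m" "regs \<le> Z" "\<And>a. a < tmpreg \<or> regs \<le> a \<Longrightarrow> m' a = m a"
  shows "rel Z s m'"
proof -
  have "m' (cell Z a i k) = m (cell Z a i k)" for a i k
    using assms(2) cell_ge[of Z a i k] by (intro assms(3)) linarith
  then show ?thesis using assms by (auto simp: rel_def)
qed

text \<open>Correctness of both operands is a premise, so that the lemma serves the induction steps
  of \<open>cexp_correct\<close> and, with the finished result, \<open>cexp_pair\<close>.\<close>

lemma cexp_bin:
  assumes "rel Z s m" "tmpreg \<le> d" "d + max na (Suc nb) \<le> regs"
    and a: "\<And>m d. rel Z s m \<Longrightarrow> tmpreg \<le> d \<Longrightarrow> d + na \<le> regs \<Longrightarrow>
      \<exists>m'. run_straight (cexp d a) m = Some m' \<and> m' d = ev a s \<and> (\<forall>x. x < d \<or> regs \<le> x \<longrightarrow> m' x = m x)"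
    and b: "\<And>m d. rel Z s m \<Longrightarrow> tmpreg \<le> d \<Longrightarrow> d + nb \<le> regs \<Longrightarrow>
      \<exists>m'. run_straight (cexp d b) m = Some m' \<and> m' d = ev b s \<and> (\<forall>x. x < d \<or> regs \<le> x \<longrightarrow> m' x = m x)"
    and Z: "regs \<le> Z"
  obtains m2 where "run_straight (cexp d a @ cexp (Suc d) b) m = Some m2" "m2 d = ev a s" "m2 (Suc d) = ev b s"
      "\<forall>x. x < d \<or> regs \<le> x \<longrightarrow> m2 x = m x" "rel Z s m2"
proof -
  have n: "d + na \<le> regs" "Suc d + nb \<le> regs" using assms(3) by linarith+
  obtain m1 where 1: "run_straight (cexp d a) m = Some m1" "m1 d = ev a s" "\<forall>x. x < d \<or> regs \<le> x \<longrightarrow> m1 x = m x"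
    using a[OF assms(1,2) n(1)] by auto
  have r1: "rel Z s m1" by (rule rel_cong[OF assms(1) Z]) (use 1 assms(2) in auto)
  obtain m2 where 2: "run_straight (cexp (Suc d) b) m1 = Some m2" "m2 (Suc d) = ev b s"
      "\<forall>x. x < Suc d \<or> regs \<le> x \<longrightarrow> m2 x = m1 x"
    using b[OF r1 _ n(2)] assms(2) by auto
  have r2: "rel Z s m2" by (rule rel_cong[OF r1 Z]) (use 2 assms(2) in auto)
  show ?thesis using that[of m2] 1 2 r2 by (auto simp: run_straight_append)
qed

text \<open>The frame includes all cells below \<open>d\<close>: this is what preserves a left
  operand in \<open>d\<close> while the right one is evaluated from \<open>Suc d\<close> on.\<close>

lemma cexp_correct:
  assumes "regs \<le> Z"
  shows "rel Z s m \<Longrightarrow> tmpreg \<le> d \<Longrightarrow> d + stack_size e \<le> regs \<Longrightarrow> wfe e \<Longrightarrow> defined e s \<Longrightarrow>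
   \<exists>m'. run_straight (cexp d e) m = Some m' \<and> m' d = ev e s \<and> (\<forall>a. a < d \<or> regs \<le> a \<longrightarrow> m' a = m a)"
proof (induction e arbitrary: m d)
  case (Var v)
  then show ?case by (auto simp: rel_def)
next
  case (Num z)
  then show ?case by auto
next
  case (EAdd a b)
  obtain m2 where "run_straight (cexp d a @ cexp (Suc d) b) m = Some m2" "m2 d = ev a s" "m2 (Suc d) = ev b s"
      "\<forall>x. x < d \<or> regs \<le> x \<longrightarrow> m2 x = m x" "rel Z s m2"
    by (rule cexp_bin[OF EAdd.prems(1,2) EAdd.prems(3)[unfolded stack_size.simps] EAdd.IH assms])
       (use EAdd.prems in auto)
  moreover have "d < regs" using EAdd.prems(3) by simp
  ultimately show ?case using EAdd.prems by (auto simp: run_straight_append split: option.splits)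
next
  case (ESub a b)
  obtain m2 where "run_straight (cexp d a @ cexp (Suc d) b) m = Some m2" "m2 d = ev a s" "m2 (Suc d) = ev b s"
      "\<forall>x. x < d \<or> regs \<le> x \<longrightarrow> m2 x = m x" "rel Z s m2"
    by (rule cexp_bin[OF ESub.prems(1,2) ESub.prems(3)[unfolded stack_size.simps] ESub.IH assms])
       (use ESub.prems in auto)
  moreover have "d < regs" using ESub.prems(3) by simp
  ultimately show ?case using ESub.prems by (auto simp: run_straight_append split: option.splits)
next
  case (EMul a b)
  obtain m2 where "run_straight (cexp d a @ cexp (Suc d) b) m = Some m2" "m2 d = ev a s" "m2 (Suc d) = ev b s"
      "\<forall>x. x < d \<or> regs \<le> x \<longrightarrow> m2 x = m x" "rel Z s m2"
    by (rule cexp_bin[OF EMul.prems(1,2) EMul.prems(3)[unfolded stack_size.simps] EMul.IH assms])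
       (use EMul.prems in auto)
  moreover have "d < regs" using EMul.prems(3) by simp
  ultimately show ?case using EMul.prems by (auto simp: run_straight_append split: option.splits)
next
  case (EDiv a b)
  obtain m2 where "run_straight (cexp d a @ cexp (Suc d) b) m = Some m2" "m2 d = ev a s" "m2 (Suc d) = ev b s"
      "\<forall>x. x < d \<or> regs \<le> x \<longrightarrow> m2 x = m x" "rel Z s m2"
    by (rule cexp_bin[OF EDiv.prems(1,2) EDiv.prems(3)[unfolded stack_size.simps] EDiv.IH assms])
       (use EDiv.prems in auto)
  moreover have "d < regs" using EDiv.prems(3) by simp
  ultimately show ?case using EDiv.prems by (auto simp: run_straight_append split: option.splits)
next
  case (ESqrt a)
  then obtain m1 where "run_straight (cexp d a) m = Some m1" "m1 d = ev a s" "\<forall>x. x < d \<or> regs \<le> x \<longrightarrow> m1 x = m x"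
    by (metis defined.simps(7) stack_size.simps(7) wfe.simps(7))
  then show ?case using ESqrt.prems stack_size_pos[of a] by (simp add: run_straight_append)
next
  case (EArr a i k)
  obtain m2 where m2: "run_straight (cexp d i @ cexp (Suc d) k) m = Some m2" "m2 d = ev i s" "m2 (Suc d) = ev k s"
      "\<forall>x. x < d \<or> regs \<le> x \<longrightarrow> m2 x = m x" "rel Z s m2"
    by (rule cexp_bin[OF EArr.prems(1,2) _ EArr.IH assms])
       (use EArr.prems in auto)
  from EArr.prems(5) obtain i' k' where ik: "ev i s = real i'" "ev k s = real k'" by (auto elim!: Nats_cases)
  have "m2 0 = real Z" using m2(5) tmpreg_pos by (simp add: rel_def)
  then obtain m3 where m3: "run_straight (addrc d a) m2 = Some m3" "m3 d = real (cell Z a i' k')"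
    "\<And>b. b \<notin> {d, Suc d, Suc (Suc d)} \<Longrightarrow> m3 b = m2 b"
    using run_straight_addrc[of m2 d i' k' Z a] m2 ik less_le_trans[OF tmpreg_pos EArr.prems(2)] by auto
  have c: "cell Z a i' k' \<notin> {d, Suc d, Suc (Suc d)}"
    using cell_ge[of Z a i' k'] assms EArr.prems(2,3) by auto
  then have "m3 (cell Z a i' k') = s (Ar a i' k')"
    using m3(3) m2(5) by (simp add: rel_def)
  then have "run_straight ((cexp d i @ cexp (Suc d) k) @ addrc d a @ [Load d d]) m = Some (m3(d := s (Ar a i' k')))"
    by (intro run_straight_appendI[OF m2(1)] run_straight_appendI[OF m3(1)]) (simp add: m3(2))
  then have "run_straight (cexp d (EArr a i k)) m = Some (m3(d := s (Ar a i' k')))" by simp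
  moreover have "d + 3 \<le> regs" using EArr.prems(3) unfolding stack_size.simps by linarith
  with m2(4) m3(3) have "(m3(d := s (Ar a i' k'))) x = m x" if "x < d \<or> regs \<le> x" for x
    using that by auto
  moreover have "(m3(d := s (Ar a i' k'))) d = ev (EArr a i k) s" using ik by simp
  ultimately show ?case by blast
next
  case (ERaw a)
  then obtain m1 where m1: "run_straight (cexp d a) m = Some m1" "m1 d = ev a s" "\<forall>x. x < d \<or> regs \<le> x \<longrightarrow> m1 x = m x"
    by (metis defined.simps(9) stack_size.simps(9) wfe.simps(9))
  have "rel Z s m1"
    by (rule rel_cong[OF ERaw.prems(1) assms]) (use m1(3) ERaw.prems(2) in auto)
  then have "m1 (addr (ev a s)) = s (Raw (addr (ev a s)))"
    using ERaw.prems(5) by (simp add: rel_def)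
  then have "run_straight (cexp d (ERaw a)) m = Some (m1(d := ev (ERaw a) s))"
    using m1(1,2) ERaw.prems(5) by (simp add: run_straight_append)
  moreover have "d < regs" using ERaw.prems(3) stack_size_pos[of a] by simp
  then have "(m1(d := ev (ERaw a) s)) x = m x" if "x < d \<or> regs \<le> x" for x
    using that m1(3) by auto
  moreover have "(m1(d := ev (ERaw a) s)) d = ev (ERaw a) s" by (rule fun_upd_same)
  ultimately show ?case by blast
qed

lemma cexp_pair:
  assumes "rel Z s m" "regs \<le> Z" "tmpreg \<le> d" "d + stack_size a \<le> regs" "Suc d + stack_size b \<le> regs"
    "wfe a" "wfe b" "defined a s" "defined b s"
  obtains m2 where "run_straight (cexp d a @ cexp (Suc d) b) m = Some m2" "m2 d = ev a s" "m2 (Suc d) = ev b s"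
      "\<forall>x. x < d \<or> regs \<le> x \<longrightarrow> m2 x = m x" "rel Z s m2"
proof -
  have n: "d + max (stack_size a) (Suc (stack_size b)) \<le> regs" using assms(4,5) by simp
  note A = cexp_correct[OF assms(2) _ _ _ assms(6,8)] and B = cexp_correct[OF assms(2) _ _ _ assms(7,9)]
  show ?thesis by (rule cexp_bin[OF assms(1,3) n A B assms(2)])
    (assumption | (rule that; assumption))+
qed

section \<open>Commands with a time-annotated semantics, and their compilation\<close>

datatype com = Skip | Asg nat expr | Sto nat expr expr expr | RawSto expr expr
  | Seq com com (infixr ";;" 60) | IfLess expr expr com com | WhileLess expr expr com

inductive bigstep :: "com \<Rightarrow> st \<Rightarrow> nat \<Rightarrow> st \<Rightarrow> bool" where
  bigstep_Skip: "bigstep Skip s 0 s"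
| bigstep_Asg: "defined e s \<Longrightarrow> bigstep (Asg v e) s 1 (s(Rg v := ev e s))"
| bigstep_Sto: "defined i s \<Longrightarrow> defined k s \<Longrightarrow> defined e s \<Longrightarrow> ev i s \<in> \<nat> \<Longrightarrow> ev k s \<in> \<nat> \<Longrightarrow>
    bigstep (Sto a i k e) s 1 (s(Ar a (addr (ev i s)) (addr (ev k s)) := ev e s))"
| bigstep_RawSto: "defined i s \<Longrightarrow> defined e s \<Longrightarrow> ev i s \<in> \<nat> \<Longrightarrow> regs \<le> addr (ev i s) \<Longrightarrow>
    addr (ev i s) < addr (s (Rg 0)) \<Longrightarrow> bigstep (RawSto i e) s 1 (s(Raw (addr (ev i s)) := ev e s))"
| bigstep_Seq: "bigstep c s t s' \<Longrightarrow> bigstep c' s' t' s'' \<Longrightarrow> bigstep (c ;; c') s (t + t') s''"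
| bigstep_IfT: "defined e s \<Longrightarrow> defined e' s \<Longrightarrow> ev e s < ev e' s \<Longrightarrow> bigstep c s t s' \<Longrightarrow> bigstep (IfLess e e' c c') s (Suc t) s'"
| bigstep_IfF: "defined e s \<Longrightarrow> defined e' s \<Longrightarrow> \<not> ev e s < ev e' s \<Longrightarrow> bigstep c' s t s' \<Longrightarrow> bigstep (IfLess e e' c c') s (Suc t) s'"
| bigstep_WhileF: "defined e s \<Longrightarrow> defined e' s \<Longrightarrow> \<not> ev e s < ev e' s \<Longrightarrow> bigstep (WhileLess e e' c) s 1 s"
| bigstep_WhileT: "defined e s \<Longrightarrow> defined e' s \<Longrightarrow> ev e s < ev e' s \<Longrightarrow> bigstep c s t s' \<Longrightarrow> bigstep (WhileLess e e' c) s' t' s'' \<Longrightarrow>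
    bigstep (WhileLess e e' c) s (Suc (t + t')) s''"

fun clen :: "com \<Rightarrow> nat" where
  "clen Skip = 0"
| "clen (Asg v e) = length (cexp tmpreg e) + 2"
| "clen (Sto a i k e) = length (cexp tmpreg e) + length (cexp (Suc tmpreg) i)
     + length (cexp (Suc (Suc tmpreg)) k) + length (addrc (Suc tmpreg) a) + 1"
| "clen (RawSto i e) = length (cexp tmpreg i) + length (cexp (Suc tmpreg) e) + 1"
| "clen (c ;; c') = clen c + clen c'"
| "clen (IfLess e e' c c') = length (cexp tmpreg e) + length (cexp (Suc tmpreg) e') + clen c + clen c' + 2"
| "clen (WhileLess e e' c) = length (cexp tmpreg e) + length (cexp (Suc tmpreg) e') + clen c + 2"

text \<open>The position \<open>pc\<close> is needed because jump targets are absolute. Tests are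
  compiled negated (jump away if \<open>e' <= e\<close>), and \<open>Jle 0 0 l\<close> is an
  unconditional jump.\<close>

fun ccom :: "nat \<Rightarrow> com \<Rightarrow> instr list" where
  "ccom pc Skip = []"
| "ccom pc (Asg v e) = cexp tmpreg e @ [Const (Suc tmpreg) 0, Add v tmpreg (Suc tmpreg)]"
| "ccom pc (Sto a i k e) = cexp tmpreg e @ cexp (Suc tmpreg) i @ cexp (Suc (Suc tmpreg)) k
     @ addrc (Suc tmpreg) a @ [Store (Suc tmpreg) tmpreg]"
| "ccom pc (RawSto i e) = cexp tmpreg i @ cexp (Suc tmpreg) e @ [Store tmpreg (Suc tmpreg)]"
| "ccom pc (c ;; c') = ccom pc c @ ccom (pc + clen c) c'"
| "ccom pc (IfLess e e' c c') = (let pc' = Suc (pc + length (cexp tmpreg e) + length (cexp (Suc tmpreg) e')) in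
     cexp tmpreg e @ cexp (Suc tmpreg) e' @ [Jle (Suc tmpreg) tmpreg (Suc (pc' + clen c))] @ ccom pc' c
     @ [Jle 0 0 (pc + clen (IfLess e e' c c'))] @ ccom (Suc (pc' + clen c)) c')"
| "ccom pc (WhileLess e e' c) = (let pc' = Suc (pc + length (cexp tmpreg e) + length (cexp (Suc tmpreg) e')) in
     cexp tmpreg e @ cexp (Suc tmpreg) e' @ [Jle (Suc tmpreg) tmpreg (Suc (pc' + clen c))] @ ccom pc' c
     @ [Jle 0 0 pc])"

fun wfc :: "com \<Rightarrow> bool" where
  "wfc Skip \<longleftrightarrow> True"
| "wfc (Asg v e) \<longleftrightarrow> wfe e \<and> 0 < v \<and> v < tmpreg \<and> tmpreg + stack_size e \<le> regs"
| "wfc (Sto a i k e) \<longleftrightarrow> wfe i \<and> wfe k \<and> wfe e \<and> tmpreg + stack_size e \<le> regs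
     \<and> Suc tmpreg + stack_size i \<le> regs \<and> Suc (Suc tmpreg) + stack_size k \<le> regs"
| "wfc (RawSto i e) \<longleftrightarrow> wfe i \<and> wfe e \<and> tmpreg + stack_size i \<le> regs \<and> Suc tmpreg + stack_size e \<le> regs"
| "wfc (c ;; c') \<longleftrightarrow> wfc c \<and> wfc c'"
| "wfc (IfLess e e' c c') \<longleftrightarrow> wfe e \<and> wfe e' \<and> tmpreg + stack_size e \<le> regs \<and> Suc tmpreg + stack_size e' \<le> regs
     \<and> wfc c \<and> wfc c'"
| "wfc (WhileLess e e' c) \<longleftrightarrow> wfe e \<and> wfe e' \<and> tmpreg + stack_size e \<le> regs \<and> Suc tmpreg + stack_size e' \<le> regs \<and> wfc c"

lemma length_ccom [simp]: "length (ccom pc c) = clen c"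
  by (induction c arbitrary: pc) (auto simp: Let_def)

definition steps_to :: "instr list \<Rightarrow> nat \<Rightarrow> (nat \<Rightarrow> real) \<Rightarrow> nat \<Rightarrow> nat \<Rightarrow> (nat \<Rightarrow> real) \<Rightarrow> bool" where
  "steps_to P pc m t pc' m' \<longleftrightarrow> (step P ^^ t) (Run pc m) = Run pc' m'"

lemma steps_to_trans: "steps_to P pc m t pc' m' \<Longrightarrow> steps_to P pc' m' t' pc'' m'' \<Longrightarrow> steps_to P pc m (t + t') pc'' m''"
  by (simp add: steps_to_def add.commute[of t] funpow_add)

lemma steps_to_exs: "list_all nojump ins \<Longrightarrow> run_straight ins m = Some m' \<Longrightarrow> code_at P pc ins \<Longrightarrow>
   steps_to P pc m (length ins) (pc + length ins) m'"
  by (simp add: steps_to_def run_straight_steps)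

lemma steps_to_jle: "code_at P pc [Jle i j l] \<Longrightarrow> steps_to P pc m 1 (if m i \<le> m j then l else Suc pc) m"
  using code_at_nth[of P pc "Jle i j l" "[]"] by (auto simp: steps_to_def)

lemma steps_to_test:
  assumes "rel Z s m" "regs \<le> Z" "wfe e" "wfe e'" "tmpreg + stack_size e \<le> regs" "Suc tmpreg + stack_size e' \<le> regs"
    "defined e s" "defined e' s"
    and at: "code_at P pc (cexp tmpreg e @ cexp (Suc tmpreg) e' @ [Jle (Suc tmpreg) tmpreg l])"
  obtains m' where "steps_to P pc m (length (cexp tmpreg e) + length (cexp (Suc tmpreg) e') + 1)
     (if ev e s < ev e' s then pc + length (cexp tmpreg e) + length (cexp (Suc tmpreg) e') + 1 else l) m'"
     "rel Z s m'"
proof -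
  obtain m2 where m2: "run_straight (cexp tmpreg e @ cexp (Suc tmpreg) e') m = Some m2" "m2 tmpreg = ev e s"
      "m2 (Suc tmpreg) = ev e' s" "\<forall>x. x < tmpreg \<or> regs \<le> x \<longrightarrow> m2 x = m x" "rel Z s m2"
    by (rule cexp_pair[of Z s m tmpreg e e']) (use assms in auto)
  have 1: "steps_to P pc m (length (cexp tmpreg e @ cexp (Suc tmpreg) e'))
      (pc + length (cexp tmpreg e @ cexp (Suc tmpreg) e')) m2"
    by (rule steps_to_exs[OF _ m2(1)]) (use at in \<open>auto simp: code_at_append\<close>)
  have 2: "steps_to P (pc + length (cexp tmpreg e @ cexp (Suc tmpreg) e')) m2 1
      (if m2 (Suc tmpreg) \<le> m2 tmpreg then l else Suc (pc + length (cexp tmpreg e @ cexp (Suc tmpreg) e'))) m2"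
    by (rule steps_to_jle) (use at in \<open>auto simp: code_at_append add.assoc\<close>)
  show ?thesis using that[OF _ m2(5)] steps_to_trans[OF 1 2] m2(2,3)
    by (auto simp: not_less add.assoc split: if_splits)
qed

text \<open>Each time unit of \<open>bigstep\<close> pays for one pass through straight-line code, which is at most \<open>K\<close> instructions long.\<close>
lemma ccom_correct:
  "bigstep c s t s' \<Longrightarrow> rel Z s m \<Longrightarrow> regs \<le> Z \<Longrightarrow> wfc c \<Longrightarrow> code_at P pc (ccom pc c) \<Longrightarrow> clen c \<le> K \<Longrightarrow>
   \<exists>u m'. steps_to P pc m u (pc + clen c) m' \<and> rel Z s' m' \<and> u \<le> K * t"
proof (induction arbitrary: m pc rule: bigstep.induct)
  case (bigstep_Skip s)
  then show ?case by (auto simp: steps_to_def intro!: exI[of _ 0])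
next
  case (bigstep_Asg e s v)
  obtain m1 where m1: "run_straight (cexp tmpreg e) m = Some m1" "m1 tmpreg = ev e s"
    "\<forall>a. a < tmpreg \<or> regs \<le> a \<longrightarrow> m1 a = m a"
    using cexp_correct[OF _ bigstep_Asg.prems(1) order_refl, of e] bigstep_Asg by auto
  let ?m = "m1(Suc tmpreg := 0, v := ev e s)"
  have "rel Z s m1" using rel_cong[OF bigstep_Asg.prems(1,2)] m1(3) by blast
  moreover have "cell Z a i k \<noteq> Suc tmpreg" "cell Z a i k \<noteq> v" for a i k
    using bigstep_Asg.prems cell_ge[of Z a i k] tmpreg_regs by auto
  ultimately have r: "rel Z (s(Rg v := ev e s)) ?m"
    using bigstep_Asg.prems tmpreg_regs by (auto simp: rel_def)
  have "run_straight (ccom pc (Asg v e)) m = Some ?m" using m1 bigstep_Asg.prems by (simp add: run_straight_append)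
  then have "steps_to P pc m (length (ccom pc (Asg v e))) (pc + length (ccom pc (Asg v e))) ?m"
    by (rule steps_to_exs[rotated]) (use bigstep_Asg in auto)
  then show ?case using r bigstep_Asg.prems by (intro exI[of _ "clen (Asg v e)"] exI[of _ ?m]) (auto simp del: fun_upd_apply)
next
  case (bigstep_Sto i s k e a)
  obtain m1 where m1: "run_straight (cexp tmpreg e) m = Some m1" "m1 tmpreg = ev e s"
    "\<forall>a. a < tmpreg \<or> regs \<le> a \<longrightarrow> m1 a = m a"
    using cexp_correct[OF _ bigstep_Sto.prems(1) order_refl, of e] bigstep_Sto by auto
  have r1: "rel Z s m1" using rel_cong[OF bigstep_Sto.prems(1,2)] m1(3) by blast
  obtain m2 where m2: "run_straight (cexp (Suc tmpreg) i @ cexp (Suc (Suc tmpreg)) k) m1 = Some m2" "m2 (Suc tmpreg) = ev i s"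
      "m2 (Suc (Suc tmpreg)) = ev k s" "\<forall>x. x < Suc tmpreg \<or> regs \<le> x \<longrightarrow> m2 x = m1 x" "rel Z s m2"
    by (rule cexp_pair[of Z s m1 "Suc tmpreg" i k]) (use bigstep_Sto r1 in auto)
  from bigstep_Sto(4,5) obtain i' k' where ik: "ev i s = real i'" "ev k s = real k'" by (auto elim!: Nats_cases)
  obtain m3 where m3: "run_straight (addrc (Suc tmpreg) a) m2 = Some m3" "m3 (Suc tmpreg) = real (cell Z a i' k')"
    "\<And>b. b \<notin> {Suc tmpreg, Suc (Suc tmpreg), Suc (Suc (Suc tmpreg))} \<Longrightarrow> m3 b = m2 b"
    using run_straight_addrc[of m2 "Suc tmpreg" i' k' Z a] m2 ik by (auto simp: rel_def)
  have r3: "rel Z s m3" by (rule rel_cong[OF m2(5) bigstep_Sto.prems(2)]) (use tmpreg_regs in \<open>auto intro!: m3(3)\<close>)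
  let ?m = "m3(cell Z a i' k' := ev e s)"
  have m3t: "m3 tmpreg = ev e s" using m3(3)[of tmpreg] m2(4) m1(2) by simp
  have ge: "cell Z a i k \<ge> Z" for a i k by (rule cell_ge)
  have r: "rel Z (s(Ar a i' k' := ev e s)) ?m"
    using r3 bigstep_Sto.prems ge[of a i' k'] by (auto simp: rel_def)
  have "run_straight (cexp tmpreg e @ (cexp (Suc tmpreg) i @ cexp (Suc (Suc tmpreg)) k) @ addrc (Suc tmpreg) a
      @ [Store (Suc tmpreg) tmpreg]) m = Some ?m"
    by (intro run_straight_appendI[OF m1(1)] run_straight_appendI[OF m2(1)] run_straight_appendI[OF m3(1)]) (simp add: m3(2) m3t)
  then have "run_straight (ccom pc (Sto a i k e)) m = Some ?m" by simp
  then have "steps_to P pc m (length (ccom pc (Sto a i k e))) (pc + length (ccom pc (Sto a i k e))) ?m"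
    by (rule steps_to_exs[rotated]) (use bigstep_Sto in auto)
  then show ?case using r ik bigstep_Sto.prems by (intro exI[of _ "clen (Sto a i k e)"] exI[of _ ?m]) (auto simp: add.assoc simp del: fun_upd_apply)
next
  case (bigstep_RawSto i s e)
  obtain m2 where m2: "run_straight (cexp tmpreg i @ cexp (Suc tmpreg) e) m = Some m2" "m2 tmpreg = ev i s"
      "m2 (Suc tmpreg) = ev e s" "\<forall>x. x < tmpreg \<or> regs \<le> x \<longrightarrow> m2 x = m x" "rel Z s m2"
    by (rule cexp_pair[of Z s m tmpreg i e]) (use bigstep_RawSto in auto)
  let ?x = "addr (ev i s)"
  let ?m = "m2(?x := ev e s)"
  have x: "regs \<le> ?x" "?x < Z" using m2(5) bigstep_RawSto.hyps by (simp_all add: rel_def)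
  have ne: "cell Z a j k \<noteq> ?x" "v < tmpreg \<Longrightarrow> v \<noteq> ?x" for a j k v
    using x cell_ge[of Z a j k] tmpreg_regs by auto
  have r: "rel Z (s(Raw ?x := ev e s)) ?m"
    using m2(5) ne by (auto simp: rel_def)
  have "run_straight ((cexp tmpreg i @ cexp (Suc tmpreg) e) @ [Store tmpreg (Suc tmpreg)]) m = Some ?m"
    by (intro run_straight_appendI[OF m2(1)]) (use m2 bigstep_RawSto.hyps in simp)
  then have "run_straight (ccom pc (RawSto i e)) m = Some ?m" by simp
  then have "steps_to P pc m (length (ccom pc (RawSto i e))) (pc + length (ccom pc (RawSto i e))) ?m"
    by (rule steps_to_exs[rotated]) (use bigstep_RawSto in auto)
  then show ?case using r bigstep_RawSto.prems by (intro exI[of _ "clen (RawSto i e)"] exI[of _ ?m]) (auto simp del: fun_upd_apply)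
next
  case (bigstep_Seq c s t s' c' t' s'')
  obtain u m1 where 1: "steps_to P pc m u (pc + clen c) m1" "rel Z s' m1" "u \<le> K * t"
    using bigstep_Seq.IH(1)[OF bigstep_Seq.prems(1,2), of pc] bigstep_Seq.prems by (auto simp: code_at_append)
  obtain u' m2 where 2: "steps_to P (pc + clen c) m1 u' (pc + clen c + clen c') m2" "rel Z s'' m2" "u' \<le> K * t'"
    using bigstep_Seq.IH(2)[OF 1(2) bigstep_Seq.prems(2), of "pc + clen c"] bigstep_Seq.prems by (auto simp: code_at_append)
  show ?case
  proof (intro exI conjI)
    show "steps_to P pc m (u + u') (pc + clen (c ;; c')) m2" using steps_to_trans[OF 1(1) 2(1)] by (simp add: add.assoc)
    show "rel Z s'' m2" by (rule 2(2))
    show "u + u' \<le> K * (t + t')" using 1(3) 2(3) by (simp add: distrib_left)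
  qed
next
  case (bigstep_IfT e s e' c t s' c')
  define l where "l = length (cexp tmpreg e) + length (cexp (Suc tmpreg) e')"
  have at: "code_at P pc (cexp tmpreg e @ cexp (Suc tmpreg) e' @ [Jle (Suc tmpreg) tmpreg (Suc (Suc (pc + l) + clen c))])"
    "code_at P (Suc (pc + l)) (ccom (Suc (pc + l)) c)"
    "code_at P (Suc (pc + l) + clen c) [Jle 0 0 (pc + clen (IfLess e e' c c'))]"
    using bigstep_IfT.prems(4) unfolding ccom.simps Let_def code_at_append l_def
    by (simp_all add: add.assoc del: clen.simps)
  obtain m1 where 1: "steps_to P pc m (Suc l) (Suc (pc + l)) m1" "rel Z s m1"
    by (rule steps_to_test[OF bigstep_IfT.prems(1,2) _ _ _ _ _ _ at(1)])
      (use bigstep_IfT in \<open>auto simp: l_def add.assoc\<close>)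
  obtain u m2 where 2: "steps_to P (Suc (pc + l)) m1 u (Suc (pc + l) + clen c) m2" "rel Z s' m2" "u \<le> K * t"
    using bigstep_IfT.IH[OF 1(2) bigstep_IfT.prems(2) _ at(2)] bigstep_IfT.prems by auto
  have 3: "steps_to P (Suc (pc + l) + clen c) m2 1 (pc + clen (IfLess e e' c c')) m2"
    using steps_to_jle[OF at(3), of m2] by simp
  show ?case
  proof (intro exI conjI)
    show "steps_to P pc m (Suc l + u + 1) (pc + clen (IfLess e e' c c')) m2" using steps_to_trans[OF steps_to_trans[OF 1(1) 2(1)] 3] by (simp add: l_def add.assoc)
    show "rel Z s' m2" by (rule 2(2))
    \<comment> \<open>Test and closing jump take \<open>l + 2\<close> steps, at most
      \<open>clen\<close> of the conditional, hence at most the \<open>K\<close> granted for the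
      tick of the test.\<close>
    show "Suc l + u + 1 \<le> K * Suc t" using 2(3) bigstep_IfT.prems(5) by (simp add: l_def)
  qed
next
  case (bigstep_IfF e s e' c' t s' c)
  define l where "l = length (cexp tmpreg e) + length (cexp (Suc tmpreg) e')"
  have at: "code_at P pc (cexp tmpreg e @ cexp (Suc tmpreg) e' @ [Jle (Suc tmpreg) tmpreg (Suc (Suc (pc + l) + clen c))])"
    "code_at P (Suc (Suc (pc + l) + clen c)) (ccom (Suc (Suc (pc + l) + clen c)) c')"
    using bigstep_IfF.prems(4) unfolding ccom.simps Let_def code_at_append l_def
    by (simp_all add: add.assoc del: clen.simps)
  obtain m1 where 1: "steps_to P pc m (Suc l) (Suc (Suc (pc + l) + clen c)) m1" "rel Z s m1"
    by (rule steps_to_test[OF bigstep_IfF.prems(1,2) _ _ _ _ _ _ at(1)])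
      (use bigstep_IfF in \<open>auto simp: l_def add.assoc\<close>)
  obtain u m2 where 2: "steps_to P (Suc (Suc (pc + l) + clen c)) m1 u (Suc (Suc (pc + l) + clen c) + clen c') m2"
     "rel Z s' m2" "u \<le> K * t"
    using bigstep_IfF.IH[OF 1(2) bigstep_IfF.prems(2) _ at(2)] bigstep_IfF.prems by auto
  show ?case
  proof (intro exI conjI)
    show "steps_to P pc m (Suc l + u) (pc + clen (IfLess e e' c c')) m2" using steps_to_trans[OF 1(1) 2(1)] by (simp add: l_def add.assoc)
    show "rel Z s' m2" by (rule 2(2))
    show "Suc l + u \<le> K * Suc t" using 2(3) bigstep_IfF.prems(5) by (simp add: l_def)
  qed
next
  case (bigstep_WhileF e s e' c)
  define l where "l = length (cexp tmpreg e) + length (cexp (Suc tmpreg) e')"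
  have at: "code_at P pc (cexp tmpreg e @ cexp (Suc tmpreg) e' @ [Jle (Suc tmpreg) tmpreg (Suc (Suc (pc + l) + clen c))])"
    using bigstep_WhileF.prems(4) unfolding ccom.simps Let_def code_at_append l_def
    by (simp_all add: add.assoc del: clen.simps)
  obtain m1 where 1: "steps_to P pc m (Suc l) (Suc (Suc (pc + l) + clen c)) m1" "rel Z s m1"
    by (rule steps_to_test[OF bigstep_WhileF.prems(1,2) _ _ _ _ _ _ at(1)])
      (use bigstep_WhileF in \<open>auto simp: l_def add.assoc\<close>)
  show ?case
  proof (intro exI conjI)
    show "steps_to P pc m (Suc l) (pc + clen (WhileLess e e' c)) m1" using 1(1) by (simp add: l_def add.assoc)
    show "rel Z s m1" by (rule 1(2))
    show "Suc l \<le> K * 1" using bigstep_WhileF.prems(5) by (simp add: l_def)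
  qed
next
  case (bigstep_WhileT e s e' c t s' t' s'')
  define l where "l = length (cexp tmpreg e) + length (cexp (Suc tmpreg) e')"
  have at: "code_at P pc (cexp tmpreg e @ cexp (Suc tmpreg) e' @ [Jle (Suc tmpreg) tmpreg (Suc (Suc (pc + l) + clen c))])"
    "code_at P (Suc (pc + l)) (ccom (Suc (pc + l)) c)"
    "code_at P (Suc (pc + l) + clen c) [Jle 0 0 pc]"
    using bigstep_WhileT.prems(4) unfolding ccom.simps Let_def code_at_append l_def
    by (simp_all add: add.assoc del: clen.simps)
  obtain m1 where 1: "steps_to P pc m (Suc l) (Suc (pc + l)) m1" "rel Z s m1"
    by (rule steps_to_test[OF bigstep_WhileT.prems(1,2) _ _ _ _ _ _ at(1)])
      (use bigstep_WhileT in \<open>auto simp: l_def add.assoc\<close>)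
  obtain u m2 where 2: "steps_to P (Suc (pc + l)) m1 u (Suc (pc + l) + clen c) m2" "rel Z s' m2" "u \<le> K * t"
    using bigstep_WhileT.IH(1)[OF 1(2) bigstep_WhileT.prems(2) _ at(2)] bigstep_WhileT.prems by auto
  have 3: "steps_to P (Suc (pc + l) + clen c) m2 1 pc m2"
    using steps_to_jle[OF at(3), of m2] by simp
  obtain u' m3 where 4: "steps_to P pc m2 u' (pc + clen (WhileLess e e' c)) m3" "rel Z s'' m3" "u' \<le> K * t'"
    using bigstep_WhileT.IH(2)[OF 2(2) bigstep_WhileT.prems(2-)] by auto
  show ?case
  proof (intro exI conjI)
    show "steps_to P pc m (Suc l + u + 1 + u') (pc + clen (WhileLess e e' c)) m3" using steps_to_trans[OF steps_to_trans[OF steps_to_trans[OF 1(1) 2(1)] 3] 4(1)] by (simp add: l_def add.assoc)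
    show "rel Z s'' m3" by (rule 4(2))
    show "Suc l + u + 1 + u' \<le> K * Suc (t + t')" using 2(3) 4(3) bigstep_WhileT.prems(5) by (simp add: l_def distrib_left)
  qed
qed

section \<open>Time-bounded total correctness\<close>

text \<open>Arrays and raw memory count as modified as a whole, so that frames can be decided
  without knowing any index.\<close>

fun modifies :: "com \<Rightarrow> loc \<Rightarrow> bool" where
  "modifies Skip l \<longleftrightarrow> False"
| "modifies (Asg v e) l \<longleftrightarrow> l = Rg v"
| "modifies (Sto a i k e) l \<longleftrightarrow> (case l of Ar a' _ _ \<Rightarrow> a' = a | _ \<Rightarrow> False)"
| "modifies (RawSto i e) l \<longleftrightarrow> (case l of Raw _ \<Rightarrow> True | _ \<Rightarrow> False)"
| "modifies (c ;; c') l \<longleftrightarrow> modifies c l \<or> modifies c' l"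
| "modifies (IfLess e e' c c') l \<longleftrightarrow> modifies c l \<or> modifies c' l"
| "modifies (WhileLess e e' c) l \<longleftrightarrow> modifies c l"

definition frame :: "com \<Rightarrow> st \<Rightarrow> st \<Rightarrow> bool" where
  "frame c s s' \<longleftrightarrow> (\<forall>l. \<not> modifies c l \<longrightarrow> s' l = s l)"

lemma frameD: "frame c s s' \<Longrightarrow> \<not> modifies c l \<Longrightarrow> s' l = s l"
  by (simp add: frame_def)

lemma bigstep_frame: "bigstep c s t s' \<Longrightarrow> frame c s s'"
  unfolding frame_def by (induction rule: bigstep.induct) auto

text \<open>The initial state is a parameter instead of a precondition, so that postconditions can
  refer to it without auxiliary variables.\<close>

definition hoare :: "com \<Rightarrow> st \<Rightarrow> nat \<Rightarrow> (st \<Rightarrow> bool) \<Rightarrow> bool" where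
  "hoare c s T Q \<longleftrightarrow> (\<exists>t s'. bigstep c s t s' \<and> t \<le> T \<and> Q s')"

lemma hoare_conseq: "hoare c s T Q \<Longrightarrow> T \<le> T' \<Longrightarrow> (\<And>s'. Q s' \<Longrightarrow> frame c s s' \<Longrightarrow> Q' s') \<Longrightarrow> hoare c s T' Q'"
  unfolding hoare_def using bigstep_frame by (meson le_trans)

lemma hoare_Seq:
  assumes "hoare c s T1 Q" "\<And>s'. Q s' \<Longrightarrow> frame c s s' \<Longrightarrow> hoare c' s' T2 R" "T1 + T2 \<le> T"
  shows "hoare (c ;; c') s T R"
proof -
  obtain t s' where 1: "bigstep c s t s'" "t \<le> T1" "Q s'" using assms(1) by (auto simp: hoare_def)
  obtain t' s'' where "bigstep c' s' t' s''" "t' \<le> T2" "R s''"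
    using assms(2)[OF 1(3) bigstep_frame[OF 1(1)]] by (auto simp: hoare_def)
  then show ?thesis using bigstep_Seq[OF 1(1)] 1(2) assms(3) unfolding hoare_def
    by (intro exI[of _ "t + t'"] exI[of _ s'']) auto
qed

lemma hoare_IfLess:
  assumes "defined e s" "defined e' s" "ev e s < ev e' s \<Longrightarrow> hoare c s T Q" "\<not> ev e s < ev e' s \<Longrightarrow> hoare c' s T Q"
  shows "hoare (IfLess e e' c c') s (Suc T) Q"
proof (cases "ev e s < ev e' s")
  case True
  then show ?thesis using assms bigstep_IfT unfolding hoare_def by (meson Suc_le_mono)
next
  case False
  then show ?thesis using assms bigstep_IfF unfolding hoare_def by (meson Suc_le_mono)
qed

text \<open>Meant for loop-free code; \<open>False\<close> on loops sends them to
  \<open>hoare_For\<close>.\<close>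

fun wp :: "com \<Rightarrow> (st \<Rightarrow> bool) \<Rightarrow> st \<Rightarrow> bool" where
  "wp Skip Q s \<longleftrightarrow> Q s"
| "wp (Asg v e) Q s \<longleftrightarrow> defined e s \<and> Q (s(Rg v := ev e s))"
| "wp (Sto a i k e) Q s \<longleftrightarrow> defined i s \<and> defined k s \<and> defined e s \<and> ev i s \<in> \<nat> \<and> ev k s \<in> \<nat> \<and>
     Q (s(Ar a (addr (ev i s)) (addr (ev k s)) := ev e s))"
| "wp (RawSto i e) Q s \<longleftrightarrow> defined i s \<and> defined e s \<and> ev i s \<in> \<nat> \<and> regs \<le> addr (ev i s) \<and>
    addr (ev i s) < addr (s (Rg 0)) \<and> Q (s(Raw (addr (ev i s)) := ev e s))"
| "wp (c ;; c') Q s \<longleftrightarrow> wp c (wp c' Q) s"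
| "wp (IfLess e e' c c') Q s \<longleftrightarrow> defined e s \<and> defined e' s \<and> (if ev e s < ev e' s then wp c Q s else wp c' Q s)"
| "wp (WhileLess _ _ _) Q s \<longleftrightarrow> False"

fun ticks :: "com \<Rightarrow> nat" where
  "ticks (c ;; c') = ticks c + ticks c'"
| "ticks (IfLess e e' c c') = Suc (max (ticks c) (ticks c'))"
| "ticks Skip = 0"
| "ticks _ = 1"

lemma hoare_wpl: "wp c Q s \<Longrightarrow> ticks c \<le> T \<Longrightarrow> hoare c s T Q"
proof (induction c arbitrary: Q s T)
  case Skip
  then show ?case unfolding hoare_def using bigstep_Skip by fastforce
next
  case (Asg v e)
  then show ?case unfolding hoare_def using bigstep_Asg by fastforce
next
  case (Sto a i k e)
  then show ?case unfolding hoare_def using bigstep_Sto[of i s k e a]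
    by (intro exI[of _ 1] exI[of _ "s(Ar a (addr (ev i s)) (addr (ev k s)) := ev e s)"]) auto
next
  case (RawSto i e)
  then show ?case unfolding hoare_def using bigstep_RawSto[of i s e]
    by (intro exI[of _ 1] exI[of _ "s(Raw (addr (ev i s)) := ev e s)"]) auto
next
  case (Seq c c')
  show ?case
    by (rule hoare_Seq[of c s "ticks c" "wp c' Q" c' "ticks c'"]) (use Seq in auto)
next
  case (IfLess e e' c c')
  show ?case
  proof (cases "ev e s < ev e' s")
    case True
    then have "hoare c s (ticks c) Q" using IfLess by auto
    then obtain t s' where "bigstep c s t s'" "t \<le> ticks c" "Q s'" by (auto simp: hoare_def)
    then show ?thesis using bigstep_IfT[of e s e' c t s' c'] IfLess.prems True unfolding hoare_def
      by (intro exI[of _ "Suc t"] exI[of _ s']) auto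
  next
    case False
    then have "hoare c' s (ticks c') Q" using IfLess by auto
    then obtain t s' where "bigstep c' s t s'" "t \<le> ticks c'" "Q s'" by (auto simp: hoare_def)
    then show ?thesis using bigstep_IfF[of e s e' c' t s' c] IfLess.prems False unfolding hoare_def
      by (intro exI[of _ "Suc t"] exI[of _ s']) auto
  qed
qed auto

section \<open>Counted loops\<close>

definition For :: "nat \<Rightarrow> expr \<Rightarrow> com \<Rightarrow> com" where
  "For v e c = Asg v (Num 0) ;; WhileLess (Var v) e (c ;; Asg v (EAdd (Var v) (Num 1)))"

lemma modifies_For [simp]: "modifies (For v e c) l \<longleftrightarrow> l = Rg v \<or> modifies c l"
  by (auto simp: For_def)

lemma wfc_For [simp]: "wfc (For v e c) \<longleftrightarrow> 0 < v \<and> v < tmpreg \<and> wfe e \<and> Suc tmpreg + stack_size e \<le> regs \<and> wfc c"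
  using tmpreg_regs by (auto simp: For_def)

text \<open>Each round adds a test and an increment to \<open>T\<close>; the final 2 pays for the
  initialisation and the failing test. The bound is re-evaluated in every round, hence the premise
  that it is \<open>N\<close> in every state that differs from \<open>s\<close> only in modified
  locations.\<close>

lemma hoare_For:
  assumes nv: "\<not> modifies c (Rg v)"
    and bound: "\<And>s'. frame (For v e c) s s' \<Longrightarrow> defined e s' \<and> ev e s' = real N"
    and init: "I 0 (s(Rg v := 0))"
    and step: "\<And>i s'. i < N \<Longrightarrow> s' (Rg v) = real i \<Longrightarrow> frame (For v e c) s s' \<Longrightarrow> I i s' \<Longrightarrow>
      hoare c s' T (\<lambda>s''. I (Suc i) (s''(Rg v := real (Suc i))))"
  shows "hoare (For v e c) s (N * (T + 2) + 2) (I N)"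
proof -
  let ?W = "WhileLess (Var v) e (c ;; Asg v (EAdd (Var v) (Num 1)))"
  have loop: "i \<le> N \<Longrightarrow> s' (Rg v) = real i \<Longrightarrow> frame (For v e c) s s' \<Longrightarrow> I i s' \<Longrightarrow>
      hoare ?W s' ((N - i) * (T + 2) + 1) (I N)" for i s'
  proof (induction "N - i" arbitrary: i s')
    case 0
    then have "bigstep ?W s' 1 s'" using bound[OF "0.prems"(3)] by (intro bigstep_WhileF) auto
    then show ?case using 0 by (auto simp: hoare_def intro!: exI[of _ 1] exI[of _ s'])
  next
    case (Suc d)
    then have iN: "i < N" by simp
    obtain t s1 where 1: "bigstep c s' t s1" "t \<le> T" "I (Suc i) (s1(Rg v := real (Suc i)))"
      using step[OF iN Suc.prems(2,3,4)] by (auto simp: hoare_def)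
    have v: "s1 (Rg v) = real i" using bigstep_frame[OF 1(1)] nv Suc.prems(2) by (simp add: frame_def)
    let ?s2 = "s1(Rg v := real (Suc i))"
    have 2: "bigstep (Asg v (EAdd (Var v) (Num 1))) s1 1 ?s2"
      using bigstep_Asg[of "EAdd (Var v) (Num 1)" s1 v] v by (simp add: add.commute)
    have fr: "frame (For v e c) s ?s2"
      using bigstep_frame[OF 1(1)] Suc.prems(3) by (auto simp: frame_def)
    have "hoare ?W ?s2 ((N - Suc i) * (T + 2) + 1) (I N)"
      by (rule Suc.hyps(1)) (use Suc.hyps(2) iN fr 1(3) in auto)
    then obtain t' s3 where 3: "bigstep ?W ?s2 t' s3" "t' \<le> (N - Suc i) * (T + 2) + 1" "I N s3"
      by (auto simp: hoare_def)
    have "bigstep ?W s' (Suc ((t + 1) + t')) s3"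
      by (rule bigstep_WhileT[OF _ _ _ bigstep_Seq[OF 1(1) 2] 3(1)])
        (use bound[OF Suc.prems(3)] Suc.prems(2) iN in auto)
    moreover have "(N - i) * (T + 2) = (N - Suc i) * (T + 2) + (T + 2)"
      using iN by (simp flip: Suc_diff_Suc)
    then have "Suc ((t + 1) + t') \<le> (N - i) * (T + 2) + 1" using 1(2) 3(2) by linarith
    ultimately show ?case using 3(3) unfolding hoare_def by blast
  qed
  have init_fr: "frame (For v e c) s (s(Rg v := 0))" by (simp add: frame_def)
  have "hoare (Asg v (Num 0)) s 1 (\<lambda>s'. s' = s(Rg v := 0))" by (rule hoare_wpl) auto
  then show ?thesis unfolding For_def
    by (rule hoare_Seq) (use loop[of 0 "s(Rg v := 0)"] init init_fr in \<open>auto\<close>)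
qed

lemma addr_simps [simp]:
  "addr 0 = 0" "addr 1 = 1" "addr (numeral k) = numeral k"
  "x \<in> \<nat> \<Longrightarrow> y \<in> \<nat> \<Longrightarrow> addr (x + y) = addr x + addr y"
  "x \<in> \<nat> \<Longrightarrow> y \<in> \<nat> \<Longrightarrow> addr (x * y) = addr x * addr y"
proof -
  show "addr 0 = 0" "addr 1 = 1" "addr (numeral k) = numeral k" by (simp_all add: addr_def)
  assume "x \<in> \<nat>" "y \<in> \<nat>"
  then obtain i j where ij: "x = real i" "y = real j" by (auto elim!: Nats_cases)
  show "addr (x + y) = addr x + addr y" using addr_of_nat[of "i + j"] ij by simp
  show "addr (x * y) = addr x * addr y" using addr_of_nat[of "i * j"] ij by simp
qed

lemma Nats_simps [simp]:
  "(numeral k :: real) \<in> \<nat>" "x \<in> \<nat> \<Longrightarrow> y \<in> \<nat> \<Longrightarrow> (x :: real) + y \<in> \<nat>" "x \<in> \<nat> \<Longrightarrow> y \<in> \<nat> \<Longrightarrow> (x :: real) * y \<in> \<nat>"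
proof -
  show "(numeral k :: real) \<in> \<nat>" by (metis of_nat_in_Nats of_nat_numeral)
qed simp_all

section \<open>Consecutive sensors and the lower bound\<close>

text \<open>Two successive tests as in \<open>calc\<close>, so that formula and program agree even
  for \<open>hi < lo\<close>, where the value means nothing.\<close>

definition clamp :: "real \<Rightarrow> real \<Rightarrow> real \<Rightarrow> real" where
  "clamp lo hi b = (let d = if b < lo then lo else b in if hi < d then hi else d)"

lemma clamp_in: "lo \<le> hi \<Longrightarrow> lo \<le> clamp lo hi b \<and> clamp lo hi b \<le> hi"
  by (auto simp: clamp_def Let_def)

text \<open>Only the horizontal offset depends on the destination, and clamping projects the
  abscissa of the station onto the interval.\<close>

lemma move_dist_clamp:
  assumes "lo \<le> d" "d \<le> hi"
  shows "move_dist bx by (k, clamp lo hi (bx k)) \<le> move_dist bx by (k, d)"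
proof -
  have "\<bar>bx k - clamp lo hi (bx k)\<bar> \<le> \<bar>bx k - d\<bar>" using assms by (auto simp: clamp_def Let_def)
  then show ?thesis by (simp add: move_dist_def abs_le_square_iff)
qed

lemma move_dist_nonneg: "0 \<le> move_dist bx by s"
  by (simp add: move_dist_def)

lemma move_dist_le_iff: "move_dist bx by (k, d) \<le> move_dist bx by (k', d) \<longleftrightarrow>
   (bx k - d)^2 + (by k)^2 \<le> (bx k' - d)^2 + (by k')^2"
  by (simp add: move_dist_def)

text \<open>Ties must be broken uniformly along the line: stations that mirror each other in the
  line are equidistant from all its points, and an arbitrary choice could interleave their
  sensors.\<close>

definition nearest :: "(nat \<Rightarrow> real) \<Rightarrow> (nat \<Rightarrow> real) \<Rightarrow> nat set \<Rightarrow> real \<Rightarrow> nat" where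
  "nearest bx by Op d = (LEAST k. k \<in> Op \<and> (\<forall>k'\<in>Op. move_dist bx by (k, d) \<le> move_dist bx by (k', d)))"

lemma nearest:
  assumes "finite Op" "Op \<noteq> {}"
  shows "nearest bx by Op d \<in> Op"
    "k' \<in> Op \<Longrightarrow> move_dist bx by (nearest bx by Op d, d) \<le> move_dist bx by (k', d)"
proof -
  let ?Q = "\<lambda>k. k \<in> Op \<and> (\<forall>k'\<in>Op. move_dist bx by (k, d) \<le> move_dist bx by (k', d))"
  have "\<exists>k. ?Q k"
    using ex_is_arg_min_if_finite[OF assms, of "\<lambda>k. move_dist bx by (k, d)"]
    by (auto simp: is_arg_min_linorder)
  then have "?Q (nearest bx by Op d)" unfolding nearest_def by (rule LeastI_ex)
  then show "nearest bx by Op d \<in> Op"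
    "k' \<in> Op \<Longrightarrow> move_dist bx by (nearest bx by Op d, d) \<le> move_dist bx by (k', d)" by auto
qed

lemma nearest_le:
  assumes "k \<in> Op" "\<And>k'. k' \<in> Op \<Longrightarrow> move_dist bx by (k, d) \<le> move_dist bx by (k', d)"
  shows "nearest bx by Op d \<le> k"
  unfolding nearest_def by (rule Least_le) (use assms in auto)

text \<open>The difference of two squared distances is affine in the destination, hence Voronoi cells
  on the line are ordered by the abscissae of their stations.\<close>
lemma nearest_mono:
  assumes "finite Op" "Op \<noteq> {}" "d < d'"
  shows "bx (nearest bx by Op d) \<le> bx (nearest bx by Op d')"
proof (rule ccontr)
  let ?k = "nearest bx by Op d" and ?k' = "nearest bx by Op d'"
  assume "\<not> ?thesis"
  then have "0 < (bx ?k - bx ?k') * (d' - d)" using assms(3) by (intro mult_pos_pos) auto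
  moreover have "(bx ?k - d)^2 + (by ?k)^2 \<le> (bx ?k' - d)^2 + (by ?k')^2"
    using nearest[OF assms(1,2)] move_dist_le_iff by blast
  moreover have "(bx ?k' - d')^2 + (by ?k')^2 \<le> (bx ?k - d')^2 + (by ?k)^2"
    using nearest[OF assms(1,2)] move_dist_le_iff by blast
  ultimately show False by (simp add: power2_eq_square algebra_simps)
qed

text \<open>With equal abscissae the distances differ only through \<open>by\<close>, so each
  optimality gives one inequality between the squares. The two stations are then equidistant from
  every point, and the least index decides.\<close>

lemma nearest_same_bx:
  assumes "finite Op" "Op \<noteq> {}" "bx (nearest bx by Op d) = bx (nearest bx by Op d')"
  shows "nearest bx by Op d = nearest bx by Op d'"
proof -
  let ?k = "nearest bx by Op d" and ?k' = "nearest bx by Op d'"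
  have 1: "(by ?k)^2 \<le> (by ?k')^2"
    using nearest(2)[OF assms(1,2) nearest(1)[OF assms(1,2)], of bx "by" d bx "by" d']
    by (simp add: move_dist_le_iff assms(3))
  have 2: "(by ?k')^2 \<le> (by ?k)^2"
    using nearest(2)[OF assms(1,2) nearest(1)[OF assms(1,2)], of bx "by" d' bx "by" d]
    by (simp add: move_dist_le_iff assms(3))
  have eq: "move_dist bx by (?k, e) = move_dist bx by (?k', e)" for e
    using 1 2 by (simp add: move_dist_def assms(3))
  have "?k \<le> ?k'"
    by (rule nearest_le) (use nearest[OF assms(1,2)] eq[of d, symmetric] in auto)
  moreover have "?k' \<le> ?k"
    by (rule nearest_le) (use nearest[OF assms(1,2)] eq[of d'] in auto)
  ultimately show ?thesis by simp
qed

text \<open>Monotonicity squeezes the middle abscissa between two equal ones. This is the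
  consecutiveness of the sensors of one station, in the form used by the induction over sorted
  destinations.\<close>

lemma nearest_between:
  assumes "finite Op" "Op \<noteq> {}" "d \<le> d'" "d' \<le> d''" "nearest bx by Op d = nearest bx by Op d''"
  shows "nearest bx by Op d' = nearest bx by Op d''"
proof (cases "d = d' \<or> d' = d''")
  case False
  then have "d < d'" "d' < d''" using assms(3,4) by auto
  from this[THEN nearest_mono[OF assms(1,2), where bx = bx and ?by = "by"]]
  have "bx (nearest bx by Op d') = bx (nearest bx by Op d'')" using assms(5) by simp
  then show ?thesis by (rule nearest_same_bx[OF assms(1,2)])
qed (use assms(5) in auto)

definition sensor_pos :: "(nat \<Rightarrow> real) \<Rightarrow> real \<Rightarrow> (nat \<Rightarrow> real) \<Rightarrow> nat \<Rightarrow> nat \<Rightarrow> nat \<Rightarrow> real" where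
  "sensor_pos x r bx k i j = clamp (x j - r) (x i + r) (bx k)"

lemma sorted_prefix:
  fixes x :: "nat \<Rightarrow> real"
  assumes "\<And>a b. a \<le> b \<Longrightarrow> b < n \<Longrightarrow> x a \<le> x b"
  shows "\<exists>j\<le>n. \<forall>i<n. x i \<le> t \<longleftrightarrow> i < j"
proof (cases "\<exists>i<n. t < x i")
  case True
  define j where "j = (LEAST i. i < n \<and> t < x i)"
  have j: "j < n \<and> t < x j" unfolding j_def by (rule LeastI_ex) (use True in auto)
  have "x i \<le> t" if "i < j" for i using not_less_Least[OF that[unfolded j_def]] that j by auto
  moreover have "t < x i" if "j \<le> i" "i < n" for i using assms[OF that] j by auto
  ultimately show ?thesis using j by (intro exI[of _ j]) (meson less_imp_le not_less)
next
  case False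
  then have "\<forall>i<n. x i \<le> t" by (meson not_less)
  then show ?thesis by blast
qed

text \<open>\<open>B\<close> is any table that satisfies the recurrence as inequalities, so the
  lower bound is independent of how the table is computed. \<open>B i k\<close> stands for covering
  the first \<open>i\<close> targets with \<open>k\<close> open at the end, its opening
  included.\<close>

context
  fixes n m :: nat and x bx "by" c :: "nat \<Rightarrow> real" and r :: real and B :: "nat \<Rightarrow> nat \<Rightarrow> real"
  assumes sorted: "\<And>a b. a \<le> b \<Longrightarrow> b < n \<Longrightarrow> x a \<le> x b"
    and c: "\<And>k. k < m \<Longrightarrow> 0 \<le> c k"
    and B0: "\<And>k. k < m \<Longrightarrow> B 0 k \<le> c k"
    and B1: "\<And>i j k. i \<le> j \<Longrightarrow> j < n \<Longrightarrow> k < m \<Longrightarrow> x j - r \<le> x i + r \<Longrightarrow>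
      B (Suc j) k \<le> B i k + move_dist bx by (k, sensor_pos x r bx k i j)"
    and B2: "\<And>j k k'. j \<le> n \<Longrightarrow> k < m \<Longrightarrow> k' < m \<Longrightarrow> B j k \<le> B j k' + c k"
begin

text \<open>The destination lies in the admissible interval of the block
  \<open>i, ..., j - 1\<close>, so moving it to the clamped point only shortens the way. An empty
  block leaves the entry as it is, and distances are nonnegative.\<close>

lemma dp_step:
  assumes "i \<le> j" "j \<le> n" "k < m" "\<And>a. i \<le> a \<Longrightarrow> a < j \<Longrightarrow> \<bar>x a - d\<bar> \<le> r"
  shows "B j k \<le> B i k + move_dist bx by (k, d)"
proof (cases "i = j")
  case True
  then show ?thesis using move_dist_nonneg[of bx "by"] by simp
next
  case False
  then obtain j' where j: "j = Suc j'" "i \<le> j'" using assms(1) by (cases j) auto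
  have "x j' - r \<le> d" "d \<le> x i + r" using assms(4)[of j'] assms(4)[of i] j by auto
  then have "B j k \<le> B i k + move_dist bx by (k, sensor_pos x r bx k i j')"
    using B1[of i j' k] j assms(2,3) by auto
  also have "\<dots> \<le> B i k + move_dist bx by (k, d)"
    using move_dist_clamp[of "x j' - r" d "x i + r" bx "by" k] \<open>x j' - r \<le> d\<close> \<open>d \<le> x i + r\<close>
    by (simp add: sensor_pos_def)
  finally show ?thesis .
qed

text \<open>Induction on the sorted destinations, removing the last. Coverage is required only of
  targets up to \<open>last ds + r\<close>, a hypothesis that survives the removal; \<open>j\<close>
  counts these targets. The right side charges each station once although \<open>B\<close> charges
  every change: by \<open>nearest_between\<close>, a station used before can only be that of the
  immediately preceding sensor.\<close>

lemma dp_sorted_sensors: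
  assumes Op: "finite Op" "Op \<noteq> {}" "Op \<subseteq> {..<m}"
  defines "\<nu> \<equiv> nearest bx by Op"
  shows "ds \<noteq> [] \<Longrightarrow> sorted ds \<Longrightarrow> (\<And>i. i < n \<Longrightarrow> x i \<le> last ds + r \<Longrightarrow> \<exists>d\<in>set ds. \<bar>x i - d\<bar> \<le> r) \<Longrightarrow>
    j \<le> n \<Longrightarrow> (\<And>i. i < n \<Longrightarrow> x i \<le> last ds + r \<longleftrightarrow> i < j) \<Longrightarrow>
    B j (\<nu> (last ds)) \<le> (\<Sum>k\<in>\<nu> ` set ds. c k) + (\<Sum>d\<leftarrow>ds. move_dist bx by (\<nu> d, d))"
proof (induction ds arbitrary: j rule: rev_induct)
  case Nil
  from Nil.prems(1) show ?case by blast
next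
  case (snoc d ds)
  have le0: "0 \<le> j" by simp
  have \<nu>m: "\<nu> e < m" for e using nearest(1)[OF Op(1,2)] Op(3) unfolding \<nu>_def by auto
  show ?case
  proof (cases "ds = []")
    case True
    have "B j (\<nu> d) \<le> B 0 (\<nu> d) + move_dist bx by (\<nu> d, d)"
    proof (rule dp_step[OF le0 snoc.prems(4) \<nu>m])
      fix a assume "a < j"
      then have "a < n" "x a \<le> d + r" using snoc.prems(4) snoc.prems(5)[of a] True by auto
      then show "\<bar>x a - d\<bar> \<le> r" using snoc.prems(3)[of a] True by simp
    qed
    then show ?thesis using B0[OF \<nu>m[of d]] True by simp
  next
    case False
    define e where "e = last ds"
    have e: "e \<in> set ds" "e \<le> d" using False snoc.prems(2) by (auto simp: e_def sorted_append)
    have le_e: "e' \<le> e" if "e' \<in> set ds" for e'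
    proof -
      have "sorted (butlast ds @ [e])" using False snoc.prems(2) by (simp add: e_def sorted_append)
      moreover have "set ds = set (butlast ds @ [e])" using False by (simp add: e_def)
      ultimately show ?thesis using that by (auto simp: sorted_append)
    qed
    obtain i where i: "i \<le> n" "\<And>a. a < n \<Longrightarrow> x a \<le> e + r \<longleftrightarrow> a < i"
      using sorted_prefix[of n x "e + r"] sorted by blast
    have cov: "\<exists>d\<in>set ds. \<bar>x a - d\<bar> \<le> r" if a: "a < n" "x a \<le> e + r" for a
    proof -
      obtain d' where "d' \<in> set (ds @ [d])" "\<bar>x a - d'\<bar> \<le> r"
        using snoc.prems(3)[OF a(1)] a(2) e(2) by auto
      show ?thesis
      proof (cases "d' \<in> set ds")
        \<comment> \<open>Here \<open>d'\<close> is \<open>d\<close>, and \<open>e <= d\<close>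
          gives \<open>e - r <= x a\<close>, so \<open>e\<close> covers the target as well.\<close>
        case False
        then have "\<bar>x a - e\<bar> \<le> r" using \<open>d' \<in> _\<close> \<open>\<bar>x a - d'\<bar> \<le> r\<close> a(2) e(2) by auto
        then show ?thesis using e(1) by blast
      qed (use \<open>\<bar>x a - d'\<bar> \<le> r\<close> in blast)
    qed
    have IH: "B i (\<nu> e) \<le> (\<Sum>k\<in>\<nu> ` set ds. c k) + (\<Sum>d\<leftarrow>ds. move_dist bx by (\<nu> d, d))"
      using snoc.IH[OF False _ _ i(1)] snoc.prems(2) cov i(2) by (simp add: e_def sorted_append)
    have ij: "i \<le> j"
    proof (rule ccontr)
      assume "\<not> i \<le> j"
      then have "j < i" "j < n" using i(1) by auto
      then show False using i(2)[of j] snoc.prems(5)[of j] e(2) by simp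
    qed
    have "B j (\<nu> d) \<le> B i (\<nu> d) + move_dist bx by (\<nu> d, d)"
    proof (rule dp_step[OF ij snoc.prems(4) \<nu>m])
      \<comment> \<open>These targets lie beyond \<open>e + r\<close>, out of reach of all earlier
        sensors, so the last one covers them.\<close>
      fix a assume a: "i \<le> a" "a < j"
      have an: "a < n" using a snoc.prems(4) by simp
      have lo: "e + r < x a" and hi: "x a \<le> d + r" using i(2)[OF an] snoc.prems(5)[OF an] a by auto
      obtain d' where "d' \<in> set (ds @ [d])" "\<bar>x a - d'\<bar> \<le> r"
        using snoc.prems(3)[OF an] hi by auto
      then show "\<bar>x a - d\<bar> \<le> r" using lo le_e[of d'] by (cases "d' \<in> set ds") auto
    qed
    moreover have "B i (\<nu> d) \<le> (\<Sum>k\<in>\<nu> ` set (ds @ [d]). c k) + (\<Sum>d\<leftarrow>ds. move_dist bx by (\<nu> d, d))"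
    proof (cases "\<nu> d \<in> \<nu> ` set ds")
      case True
      then obtain d' where d': "d' \<in> set ds" "\<nu> d' = \<nu> d" by auto
      have "\<nu> e = \<nu> d"
        unfolding \<nu>_def by (rule nearest_between[OF Op(1,2) le_e[OF d'(1)] e(2)]) (use d' in \<open>simp add: \<nu>_def\<close>)
      then show ?thesis using IH True by (simp add: insert_absorb)
    next
      case False
      then show ?thesis using IH B2[OF i(1) \<nu>m[of d] \<nu>m[of e]] by simp
    qed
    moreover have "(\<Sum>d\<leftarrow>ds @ [d]. move_dist bx by (\<nu> d, d)) =
        (\<Sum>d\<leftarrow>ds. move_dist bx by (\<nu> d, d)) + move_dist bx by (\<nu> d, d)" by simp
    ultimately show ?thesis unfolding last_snoc by linarith
  qed
qed

text \<open>Three changes never raise the cost: each sensor is taken over by the nearest open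
  station, the sensors are sorted by destination, and only stations that then emit are paid.\<close>

lemma dp_lower_bound:
  assumes sol: "is_solution m Op S" "feasible n x r S" and n: "0 < n"
  shows "\<exists>k<m. B n k \<le> sol_cost bx by c Op S"
proof -
  let ?\<nu> = "nearest bx by Op"
  have "S \<noteq> []" using sol(2) n by (auto simp: feasible_def)
  then have "fst (hd S) \<in> Op" using sol(1) by (simp add: is_solution_def)
  then have Op: "finite Op" "Op \<noteq> {}" "Op \<subseteq> {..<m}"
    using sol(1) by (auto simp: is_solution_def intro: finite_subset)
  define ds where "ds = sort (map snd S)"
  have set_ds: "set ds = snd ` set S" by (simp add: ds_def)
  have ne: "ds \<noteq> []" using \<open>S \<noteq> []\<close> set_ds by auto
  have last: "d \<le> last ds" if "d \<in> set ds" for d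
  proof -
    have "sorted (butlast ds @ [last ds])" using ne by (simp add: ds_def)
    moreover have "set ds = set (butlast ds @ [last ds])" using ne by simp
    ultimately show ?thesis using that by (auto simp: sorted_append)
  qed
  have cov: "\<exists>d\<in>set ds. \<bar>x i - d\<bar> \<le> r" if "i < n" for i
    using sol(2) that by (auto simp: feasible_def set_ds)
  have le: "x i \<le> last ds + r" if "i < n" for i using cov[OF that] last by fastforce
  have "B n (?\<nu> (last ds)) \<le> (\<Sum>k\<in>?\<nu> ` set ds. c k) + (\<Sum>d\<leftarrow>ds. move_dist bx by (?\<nu> d, d))"
    by (rule dp_sorted_sensors[OF Op ne]) (use cov le in \<open>auto simp: ds_def\<close>)
  also have "(\<Sum>k\<in>?\<nu> ` set ds. c k) \<le> (\<Sum>k\<in>Op. c k)"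
    by (rule sum_mono2) (use Op nearest(1)[OF Op(1,2)] c in auto)
  also have "(\<Sum>d\<leftarrow>ds. move_dist bx by (?\<nu> d, d)) = (\<Sum>d\<leftarrow>map snd S. move_dist bx by (?\<nu> d, d))"
    by (simp add: ds_def multiset.map_comp flip: sum_mset_sum_list)
  also have "\<dots> \<le> (\<Sum>s\<leftarrow>S. move_dist bx by s)"
  proof -
    have "move_dist bx by (?\<nu> (snd s), snd s) \<le> move_dist bx by s" if "s \<in> set S" for s
      using nearest(2)[OF Op(1,2), of "fst s" bx "by" "snd s"] sol(1) that by (auto simp: is_solution_def)
    then show ?thesis by (simp add: comp_def sum_list_mono)
  qed
  finally show ?thesis
    using nearest(1)[OF Op(1,2)] Op(3) by (auto simp: sol_cost_def intro!: exI[of _ "?\<nu> (last ds)"])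
qed

end

section \<open>Sorting the targets\<close>

text \<open>Registers 0 and 2 hold \<open>Z\<close> and the address at which the prologue saves the low input cells.\<close>
abbreviation (input) vM :: nat where "vM \<equiv> 1"
abbreviation (input) vN :: nat where "vN \<equiv> 3"
abbreviation (input) vR :: nat where "vR \<equiv> 4"
abbreviation (input) vJ :: nat where "vJ \<equiv> 5"
abbreviation (input) vK :: nat where "vK \<equiv> 6"
abbreviation (input) vI :: nat where "vI \<equiv> 7"
abbreviation (input) vBest :: nat where "vBest \<equiv> 8"
abbreviation (input) vArg :: nat where "vArg \<equiv> 9"
abbreviation (input) vLo :: nat where "vLo \<equiv> 10"
abbreviation (input) vHi :: nat where "vHi \<equiv> 11"
abbreviation (input) vPos :: nat where "vPos \<equiv> 12"
abbreviation (input) vVal :: nat where "vVal \<equiv> 13"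
abbreviation (input) vMin :: nat where "vMin \<equiv> 14"
abbreviation (input) vMinK :: nat where "vMinK \<equiv> 15"
abbreviation (input) vQ :: nat where "vQ \<equiv> 16"
abbreviation (input) vIt :: nat where "vIt \<equiv> 17"
abbreviation (input) vC :: nat where "vC \<equiv> 18"

abbreviation (input) aOut :: nat where "aOut \<equiv> 0"
abbreviation (input) aIn :: nat where "aIn \<equiv> 1"
abbreviation (input) aB :: nat where "aB \<equiv> 2"
abbreviation (input) aP :: nat where "aP \<equiv> 3"
abbreviation (input) aK :: nat where "aK \<equiv> 4"

text \<open>The array \<open>aIn\<close> is indexed by the original input addresses, so that loading
  copies each cell to its own index. The coordinates \<open>x\<close> are a parameter because
  sorting rearranges that segment.\<close>

definition stored :: "nat \<Rightarrow> nat \<Rightarrow> real \<Rightarrow> (nat \<Rightarrow> real) \<Rightarrow> (nat \<Rightarrow> real) \<Rightarrow> (nat \<Rightarrow> real) \<Rightarrow> (nat \<Rightarrow> real)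
    \<Rightarrow> st \<Rightarrow> bool" where
  "stored n m r x bx by c s \<longleftrightarrow> s (Rg vM) = real m \<and> s (Rg vN) = real n \<and> s (Rg vR) = r \<and>
     (\<forall>i<n. s (Ar aIn 0 (3 + i)) = x i) \<and>
     (\<forall>k<m. s (Ar aIn 0 (3 + n + 3 * k)) = bx k \<and> s (Ar aIn 0 (4 + n + 3 * k)) = by k \<and>
        s (Ar aIn 0 (5 + n + 3 * k)) = c k)"

lemma stored_frame:
  assumes "stored n m r x bx by c s" "frame p s s'"
    "\<not> modifies p (Rg vM)" "\<not> modifies p (Rg vN)" "\<not> modifies p (Rg vR)" "\<And>i k. \<not> modifies p (Ar aIn i k)"
  shows "stored n m r x bx by c s'"
  using assms by (simp add: stored_def frame_def)

lemma stored_upd_reg [simp]: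
  "v \<noteq> vM \<Longrightarrow> v \<noteq> vN \<Longrightarrow> v \<noteq> vR \<Longrightarrow>
    stored n m r x bx by c (s(Rg v := z)) \<longleftrightarrow> stored n m r x bx by c s"
  by (auto simp: stored_def)

lemma stored_upd_arr [simp]:
  "a \<noteq> aIn \<Longrightarrow> stored n m r x bx by c (s(Ar a i k := z)) \<longleftrightarrow> stored n m r x bx by c s"
  by (auto simp: stored_def)

definition xE :: "expr \<Rightarrow> expr" where
  "xE e = EArr aIn (Num 0) (EAdd (Num 3) e)"
definition stationE :: "int \<Rightarrow> expr \<Rightarrow> expr" where
  "stationE q e = EArr aIn (Num 0) (EAdd (EAdd (Num q) (Var vN)) (EMul (Num 3) e))"

lemma ev_xE:
  assumes "stored n m r x bx by c s" "defined e s" "ev e s = real i" "i < n"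
  shows "defined (xE e) s" "ev (xE e) s = x i"
  using assms by (simp_all add: xE_def stored_def)

text \<open>Exchange sort: after round \<open>i\<close>, entry \<open>i\<close> is minimal among the
  later ones; the guard \<open>vJ < vK\<close> is there because \<open>For\<close> starts at 0.
  Feasibility depends only on the set of coordinates, so correctness tracks the image rather than a
  permutation.\<close>

definition sort_prog :: com where
  "sort_prog = For vJ (Var vN) (For vK (Var vN)
     (IfLess (Var vJ) (Var vK)
       (IfLess (xE (Var vK)) (xE (Var vJ))
         (Asg vI (xE (Var vJ)) ;;
          Sto aIn (Num 0) (EAdd (Num 3) (Var vJ)) (xE (Var vK)) ;;
          Sto aIn (Num 0) (EAdd (Num 3) (Var vK)) (Var vI)) Skip) Skip))"

lemma image_fun_upd_swap:
  assumes "i \<in> A" "j \<in> A"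
  shows "(x(i := x j, j := x i)) ` A = x ` A"
proof
  show "(x(i := x j, j := x i)) ` A \<subseteq> x ` A" using assms by auto
  show "x ` A \<subseteq> (x(i := x j, j := x i)) ` A"
  proof
    fix z assume "z \<in> x ` A"
    then obtain a where a: "a \<in> A" "z = x a" by blast
    then have "z = (x(i := x j, j := x i)) (if a = i then j else if a = j then i else a)" by auto
    then show "z \<in> (x(i := x j, j := x i)) ` A" using assms a(1) by auto
  qed
qed

lemma stored_swap:
  assumes "stored n m r x bx by c s" "i < n" "j < n"
  shows "stored n m r (x(i := x j, j := x i)) bx by c
    (s(Ar aIn 0 (3 + i) := x j, Ar aIn 0 (3 + j) := x i))"
  using assms by (auto simp: stored_def)

lemma sort_inner:
  assumes s: "stored n m r x bx by c s" "s (Rg vJ) = real i" "s (Rg vK) = real j"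
    and ij: "i < n" "j < n"
    and x: "\<And>a b. a < i \<Longrightarrow> a < b \<Longrightarrow> b < n \<Longrightarrow> x a \<le> x b" "\<And>b. i < b \<Longrightarrow> b < j \<Longrightarrow> x i \<le> x b"
  shows "wp (IfLess (Var vJ) (Var vK)
       (IfLess (xE (Var vK)) (xE (Var vJ))
         (Asg vI (xE (Var vJ)) ;;
          Sto aIn (Num 0) (EAdd (Num 3) (Var vJ)) (xE (Var vK)) ;;
          Sto aIn (Num 0) (EAdd (Num 3) (Var vK)) (Var vI)) Skip) Skip)
     (\<lambda>s'. \<exists>x'. stored n m r x' bx by c s' \<and> x' ` {..<n} = x ` {..<n} \<and>
        (\<forall>a b. a < i \<longrightarrow> a < b \<longrightarrow> b < n \<longrightarrow> x' a \<le> x' b) \<and> (\<forall>b. i < b \<longrightarrow> b < Suc j \<longrightarrow> x' i \<le> x' b)) s"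
    (is "wp _ ?Q s")
proof -
  note e = ev_xE[OF s(1), of "Var vJ" i] ev_xE[OF s(1), of "Var vK" j]
  show ?thesis
  proof (cases "i < j \<and> x j < x i")
    case False
    then have "?Q s" using s x by (intro exI[of _ x]) (auto simp: less_Suc_eq)
    then show ?thesis using s ij e False by auto
  next
    case True
    let ?x = "x(i := x j, j := x i)"
    let ?s = "s(Rg vI := x i)"
    have s': "stored n m r x bx by c ?s" using s(1) by simp
    have "?Q (?s(Ar aIn 0 (3 + i) := x j, Ar aIn 0 (3 + j) := x i))"
    proof (intro exI[of _ ?x] conjI)
      show "stored n m r ?x bx by c (?s(Ar aIn 0 (3 + i) := x j, Ar aIn 0 (3 + j) := x i))"
        by (rule stored_swap[OF s' ij])
      show "?x ` {..<n} = x ` {..<n}" by (rule image_fun_upd_swap) (use ij in auto)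
      show "\<forall>a b. a < i \<longrightarrow> a < b \<longrightarrow> b < n \<longrightarrow> ?x a \<le> ?x b" using x(1) ij True by auto
      show "\<forall>b. i < b \<longrightarrow> b < Suc j \<longrightarrow> ?x i \<le> ?x b" using x(2) True by (force simp: less_Suc_eq)
    qed
    then show ?thesis using s ij e True ev_xE[OF s', of "Var vK" j] by simp
  qed
qed

lemma sort_correct:
  assumes "stored n m r x bx by c s"
  shows "hoare sort_prog s (n * (n * 7 + 4) + 2)
    (\<lambda>s'. \<exists>y. stored n m r y bx by c s' \<and> y ` {..<n} = x ` {..<n} \<and> (\<forall>a b. a \<le> b \<longrightarrow> b < n \<longrightarrow> y a \<le> y b))"
proof -
  let ?I = "\<lambda>i s'. \<exists>y. stored n m r y bx by c s' \<and> y ` {..<n} = x ` {..<n} \<and>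
     (\<forall>a b. a < i \<longrightarrow> a < b \<longrightarrow> b < n \<longrightarrow> y a \<le> y b)"
  have "hoare sort_prog s (n * ((n * (5 + 2) + 2) + 2) + 2) (?I n)"
    unfolding sort_prog_def
  proof (rule hoare_For[where I = ?I])
    fix i s' assume i: "i < n" "s' (Rg vJ) = real i" "?I i s'"
    let ?J = "\<lambda>j s'. \<exists>y. stored n m r y bx by c s' \<and> y ` {..<n} = x ` {..<n} \<and>
      (\<forall>a b. a < i \<longrightarrow> a < b \<longrightarrow> b < n \<longrightarrow> y a \<le> y b) \<and> (\<forall>b. i < b \<longrightarrow> b < j \<longrightarrow> y i \<le> y b)"
    let ?c = "IfLess (Var vJ) (Var vK)
       (IfLess (xE (Var vK)) (xE (Var vJ))
         (Asg vI (xE (Var vJ)) ;;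
          Sto aIn (Num 0) (EAdd (Num 3) (Var vJ)) (xE (Var vK)) ;;
          Sto aIn (Num 0) (EAdd (Num 3) (Var vK)) (Var vI)) Skip) Skip"
    have n': "s' (Rg vN) = real n" using i(3) by (auto simp: stored_def)
    have "hoare (For vK (Var vN) ?c) s' (n * (5 + 2) + 2) (?J n)"
    proof (rule hoare_For[where I = ?J])
      fix j s2 assume j: "j < n" "s2 (Rg vK) = real j" "?J j s2" and f: "frame (For vK (Var vN) ?c) s' s2"
      have "s2 (Rg vJ) = real i" using frameD[OF f] i(2) by simp
      moreover obtain y where y: "stored n m r y bx by c s2" "y ` {..<n} = x ` {..<n}"
        "\<And>a b. a < i \<Longrightarrow> a < b \<Longrightarrow> b < n \<Longrightarrow> y a \<le> y b" "\<And>b. i < b \<Longrightarrow> b < j \<Longrightarrow> y i \<le> y b"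
        using j(3) by blast
      ultimately have "wp ?c (?J (Suc j)) s2"
        using sort_inner[OF y(1) _ j(2) i(1) j(1) y(3,4)] unfolding y(2) by blast
      then have "hoare ?c s2 5 (?J (Suc j))" by (rule hoare_wpl) simp
      then show "hoare ?c s2 5 (\<lambda>s''. ?J (Suc j) (s''(Rg vK := real (Suc j))))"
        by (rule hoare_conseq) auto
    qed (use i n' in \<open>auto simp: frame_def\<close>)
    then show "hoare (For vK (Var vN) ?c) s' (n * (5 + 2) + 2) (\<lambda>s''. ?I (Suc i) (s''(Rg vJ := real (Suc i))))"
      by (rule hoare_conseq) (auto simp: less_Suc_eq)
  qed (use assms in \<open>auto simp: frame_def stored_def\<close>)
  then show ?thesis
  proof (rule hoare_conseq)
    fix s' assume "?I n s'"
    then obtain y where y: "stored n m r y bx by c s'" "y ` {..<n} = x ` {..<n}"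
      "\<And>a b. a < b \<Longrightarrow> b < n \<Longrightarrow> y a \<le> y b" by auto
    then have "y a \<le> y b" if "a \<le> b" "b < n" for a b using that by (cases "a = b") auto
    then show "\<exists>y. stored n m r y bx by c s' \<and> y ` {..<n} = x ` {..<n} \<and> (\<forall>a b. a \<le> b \<longrightarrow> b < n \<longrightarrow> y a \<le> y b)"
      using y by blast
  qed (simp add: algebra_simps)
qed

lemma modifies_sort_prog [simp]: "modifies sort_prog l \<longleftrightarrow> l \<in> {Rg vJ, Rg vK, Rg vI} \<or> (\<exists>i k. l = Ar aIn i k)"
  by (cases l) (auto simp: sort_prog_def)

section \<open>The table\<close>

text \<open>Sensor from station \<open>vK\<close> covering the sorted targets \<open>vI, \<dots>, vJ\<close>: its admissible positions form
  \<open>[vLo, vHi]\<close>, and \<open>vVal\<close> is junk when this interval is empty.\<close>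
definition calc :: com where
  "calc = Asg vLo (ESub (xE (Var vJ)) (Var vR)) ;;
    Asg vHi (EAdd (xE (Var vI)) (Var vR)) ;;
    Asg vPos (stationE 3 (Var vK)) ;;
    IfLess (Var vPos) (Var vLo) (Asg vPos (Var vLo)) Skip ;;
    IfLess (Var vHi) (Var vPos) (Asg vPos (Var vHi)) Skip ;;
    Asg vVal (EAdd (EArr aB (Var vI) (Var vK))
      (ESqrt (EAdd (EMul (ESub (stationE 3 (Var vK)) (Var vPos)) (ESub (stationE 3 (Var vK)) (Var vPos)))
        (EMul (stationE 4 (Var vK)) (stationE 4 (Var vK))))))"

definition edge :: "(nat \<Rightarrow> real) \<Rightarrow> real \<Rightarrow> (nat \<Rightarrow> real) \<Rightarrow> (nat \<Rightarrow> real) \<Rightarrow> (nat \<Rightarrow> nat \<Rightarrow> real)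
    \<Rightarrow> nat \<Rightarrow> nat \<Rightarrow> nat \<Rightarrow> real" where
  "edge x r bx by B k i j = B i k + move_dist bx by (k, sensor_pos x r bx k i j)"

definition reach :: "(nat \<Rightarrow> real) \<Rightarrow> real \<Rightarrow> nat \<Rightarrow> nat \<Rightarrow> bool" where
  "reach x r i j \<longleftrightarrow> x j - r \<le> x i + r"

lemma calc_correct:
  assumes "stored n m r x bx by c s" "s (Rg vJ) = real j" "s (Rg vK) = real k" "s (Rg vI) = real i"
    "j < n" "k < m" "i < n"
  shows "hoare calc s 8 (\<lambda>s'. s' (Rg vLo) = x j - r \<and> s' (Rg vHi) = x i + r \<and>
     s' (Rg vPos) = sensor_pos x r bx k i j \<and> s' (Rg vVal) = edge x r bx by (\<lambda>i k. s (Ar aB i k)) k i j)"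
  by (rule hoare_wpl)
    (use assms in \<open>auto simp: calc_def xE_def stationE_def stored_def edge_def sensor_pos_def clamp_def
      move_dist_def power2_eq_square\<close>)

lemma modifies_calc [simp]: "modifies calc l \<longleftrightarrow> l \<in> {Rg vLo, Rg vHi, Rg vPos, Rg vVal}"
  by (auto simp: calc_def)

text \<open>\<open>N\<close> counts the candidates already scanned. The candidate
  \<open>i = j\<close>, a block of one target, is present from the start: \<open>0 <= r\<close>
  makes it admissible, so it replaces an infinite initial value.\<close>

definition is_best :: "(nat \<Rightarrow> real) \<Rightarrow> real \<Rightarrow> (nat \<Rightarrow> real) \<Rightarrow> (nat \<Rightarrow> real) \<Rightarrow> (nat \<Rightarrow> nat \<Rightarrow> real)
    \<Rightarrow> nat \<Rightarrow> nat \<Rightarrow> nat \<Rightarrow> real \<Rightarrow> real \<Rightarrow> bool" where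
  "is_best x r bx by B k j N v a \<longleftrightarrow>
     (\<exists>p\<le>j. a = real p \<and> reach x r p j \<and> v = edge x r bx by B k p j) \<and>
     (\<forall>i. i < N \<or> i = j \<longrightarrow> reach x r i j \<longrightarrow> v \<le> edge x r bx by B k i j)"

definition inner_body :: com where
  "inner_body = calc ;; IfLess (Var vHi) (Var vLo) Skip
     (IfLess (Var vVal) (Var vBest) (Asg vBest (Var vVal) ;; Asg vArg (Var vI)) Skip)"

lemma modifies_inner_body [simp]:
  "modifies inner_body l \<longleftrightarrow> l \<in> {Rg vLo, Rg vHi, Rg vPos, Rg vVal, Rg vBest, Rg vArg}"
  by (auto simp: inner_body_def)

lemma inner_correct:
  assumes s: "stored n m r x bx by c s" "s (Rg vJ) = real j" "s (Rg vK) = real k" "j < n" "k < m"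
    and best: "is_best x r bx by (\<lambda>i k. s (Ar aB i k)) k j 0 (s (Rg vBest)) (s (Rg vArg))"
  shows "hoare (For vI (Var vJ) inner_body) s (j * (12 + 2) + 2)
    (\<lambda>s'. is_best x r bx by (\<lambda>i k. s (Ar aB i k)) k j j (s' (Rg vBest)) (s' (Rg vArg)))"
proof -
  let ?B = "\<lambda>i k. s (Ar aB i k)"
  let ?I = "\<lambda>i s'. is_best x r bx by ?B k j i (s' (Rg vBest)) (s' (Rg vArg))"
  show ?thesis
  proof (rule hoare_For[where I = ?I])
    fix i s' assume i: "i < j" "s' (Rg vI) = real i" and f: "frame (For vI (Var vJ) inner_body) s s'"
      and I: "?I i s'"
    have f': "s' (Rg vJ) = real j" "s' (Rg vK) = real k" "(\<lambda>i k. s' (Ar aB i k)) = ?B"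
      using s(2,3) f by (auto simp: frame_def)
    have s': "stored n m r x bx by c s'" by (rule stored_frame[OF s(1) f]) auto
    have "hoare inner_body s' 12 (?I (Suc i))"
      unfolding inner_body_def
    proof (rule hoare_Seq[OF calc_correct[OF s' f'(1,2) i(2) s(4,5)]])
      show "i < n" using i s by simp
      fix s2 assume c: "s2 (Rg vLo) = x j - r \<and> s2 (Rg vHi) = x i + r \<and>
         s2 (Rg vPos) = sensor_pos x r bx k i j \<and> s2 (Rg vVal) = edge x r bx by (\<lambda>i k. s' (Ar aB i k)) k i j"
        and f2: "frame calc s' s2"
      have e: "s2 (Rg vBest) = s' (Rg vBest)" "s2 (Rg vArg) = s' (Rg vArg)" "s2 (Rg vI) = real i"
        using f2 i(2) by (auto simp: frame_def)
      show "hoare (IfLess (Var vHi) (Var vLo) Skip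
         (IfLess (Var vVal) (Var vBest) (Asg vBest (Var vVal) ;; Asg vArg (Var vI)) Skip)) s2 4 (?I (Suc i))"
        by (rule hoare_wpl) (use I c e f'(3) i(1) in \<open>auto simp: is_best_def reach_def less_Suc_eq\<close>)
    qed simp
    then show "hoare inner_body s' 12 (\<lambda>s''. ?I (Suc i) (s''(Rg vI := real (Suc i))))"
      by (rule hoare_conseq) auto
  qed (use s best in \<open>auto simp: frame_def\<close>)
qed

text \<open>Targets are numbered from 0 and rows count covered targets, hence row
  \<open>vJ + 1\<close>. The running minimum over stations is initialised by station 0, again
  without an infinite value.\<close>

definition cell_prog :: com where
  "cell_prog = Asg vI (Var vJ) ;; calc ;; (Asg vBest (Var vVal) ;; Asg vArg (Var vJ)) ;;
     For vI (Var vJ) inner_body ;;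
     Sto aB (EAdd (Var vJ) (Num 1)) (Var vK) (Var vBest) ;;
     Sto aP (EAdd (Var vJ) (Num 1)) (Var vK) (Var vArg) ;;
     IfLess (Num 0) (Var vK)
       (IfLess (Var vBest) (Var vMin) (Asg vMin (Var vBest) ;; Asg vMinK (Var vK)) Skip)
       (Asg vMin (Var vBest) ;; Asg vMinK (Var vK))"

lemma modifies_cell_prog [simp]:
  "modifies cell_prog l \<longleftrightarrow> l \<in> {Rg vLo, Rg vHi, Rg vPos, Rg vVal, Rg vBest, Rg vArg, Rg vI, Rg vMin, Rg vMinK}
     \<or> (\<exists>i k. l = Ar aB i k \<or> l = Ar aP i k)"
  by (cases l) (auto simp: cell_prog_def)

lemma cell_correct:
  assumes s: "stored n m r x bx by c s" "s (Rg vJ) = real j" "s (Rg vK) = real k" "j < n" "k < m" and r: "0 \<le> r"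
  shows "hoare cell_prog s (j * 14 + 19) (\<lambda>s'. \<exists>v a.
      is_best x r bx by (\<lambda>i k. s (Ar aB i k)) k j j v a \<and>
      (\<forall>i k'. s' (Ar aB i k') = (if i = Suc j \<and> k' = k then v else s (Ar aB i k'))) \<and>
      (\<forall>i k'. s' (Ar aP i k') = (if i = Suc j \<and> k' = k then a else s (Ar aP i k'))) \<and>
      s' (Rg vMin) = (if k = 0 \<or> v < s (Rg vMin) then v else s (Rg vMin)) \<and>
      s' (Rg vMinK) = (if k = 0 \<or> v < s (Rg vMin) then real k else s (Rg vMinK)))" (is "hoare _ _ _ (\<lambda>s'. \<exists>v a. ?Q v a s')")
proof -
  let ?B = "\<lambda>i k. s (Ar aB i k)"
  let ?s = "s(Rg vI := real j)"
  have "hoare (Asg vI (Var vJ)) s 1 (\<lambda>s'. s' = ?s)" by (rule hoare_wpl) (use s in auto)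
  then show ?thesis unfolding cell_prog_def
  proof (rule hoare_Seq)
    fix s1 assume s1: "s1 = ?s"
    let ?R = "(Asg vBest (Var vVal) ;; Asg vArg (Var vJ)) ;; For vI (Var vJ) inner_body ;;
     Sto aB (EAdd (Var vJ) (Num 1)) (Var vK) (Var vBest) ;;
     Sto aP (EAdd (Var vJ) (Num 1)) (Var vK) (Var vArg) ;;
     IfLess (Num 0) (Var vK)
       (IfLess (Var vBest) (Var vMin) (Asg vMin (Var vBest) ;; Asg vMinK (Var vK)) Skip)
       (Asg vMin (Var vBest) ;; Asg vMinK (Var vK))"
    have s1': "stored n m r x bx by c s1" using s1 s(1) by simp
    show "hoare (calc ;; ?R) s1 (j * 14 + 18) (\<lambda>s'. \<exists>v a. ?Q v a s')"
    proof (rule hoare_Seq[OF calc_correct[OF s1', of j k j]])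
      fix s2 assume c: "s2 (Rg vLo) = x j - r \<and> s2 (Rg vHi) = x j + r \<and>
         s2 (Rg vPos) = sensor_pos x r bx k j j \<and> s2 (Rg vVal) = edge x r bx by (\<lambda>i k. s1 (Ar aB i k)) k j j"
        and f2: "frame calc s1 s2"
      have s2': "stored n m r x bx by c s2" by (rule stored_frame[OF s1' f2]) auto
      let ?s3 = "s2(Rg vBest := edge x r bx by ?B k j j, Rg vArg := real j)"
      have "hoare (Asg vBest (Var vVal) ;; Asg vArg (Var vJ)) s2 2 (\<lambda>s'. s' = ?s3)"
        by (rule hoare_wpl) (use c f2 s s1 in \<open>auto simp: frame_def\<close>)
      then show "hoare ?R s2 (j * 14 + 10) (\<lambda>s'. \<exists>v a. ?Q v a s')"
      proof (rule hoare_Seq)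
        fix s3 assume s3: "s3 = ?s3"
        have s3': "stored n m r x bx by c s3" using s3 s2' by simp
        have B3: "(\<lambda>i k. s3 (Ar aB i k)) = ?B" "s3 (Rg vJ) = real j" "s3 (Rg vK) = real k"
          "\<And>i k. s3 (Ar aP i k) = s (Ar aP i k)" "s3 (Rg vMin) = s (Rg vMin)" "s3 (Rg vMinK) = s (Rg vMinK)"
          using s3 f2 s1 s(2,3) by (auto simp: frame_def)
        have best: "is_best x r bx by (\<lambda>i k. s3 (Ar aB i k)) k j 0 (s3 (Rg vBest)) (s3 (Rg vArg))"
          unfolding B3(1) using s3 r by (auto simp: is_best_def reach_def)
        show "hoare (For vI (Var vJ) inner_body ;; Sto aB (EAdd (Var vJ) (Num 1)) (Var vK) (Var vBest) ;;
            Sto aP (EAdd (Var vJ) (Num 1)) (Var vK) (Var vArg) ;; IfLess (Num 0) (Var vK)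
            (IfLess (Var vBest) (Var vMin) (Asg vMin (Var vBest) ;; Asg vMinK (Var vK)) Skip)
            (Asg vMin (Var vBest) ;; Asg vMinK (Var vK))) s3 (j * 14 + 8) (\<lambda>s'. \<exists>v a. ?Q v a s')"
        proof (rule hoare_Seq[OF inner_correct[OF s3' B3(2,3) s(4,5) best]])
          fix s4 assume b4: "is_best x r bx by (\<lambda>i k. s3 (Ar aB i k)) k j j (s4 (Rg vBest)) (s4 (Rg vArg))"
            and f4: "frame (For vI (Var vJ) inner_body) s3 s4"
          have B4: "\<And>i k. s4 (Ar aB i k) = s (Ar aB i k)" "s4 (Rg vJ) = real j" "s4 (Rg vK) = real k"
            "\<And>i k. s4 (Ar aP i k) = s (Ar aP i k)" "s4 (Rg vMin) = s (Rg vMin)" "s4 (Rg vMinK) = s (Rg vMinK)"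
            using f4 B3 fun_cong[OF fun_cong[OF B3(1)]] by (auto simp: frame_def)
          have "hoare (Sto aB (EAdd (Var vJ) (Num 1)) (Var vK) (Var vBest) ;;
            Sto aP (EAdd (Var vJ) (Num 1)) (Var vK) (Var vArg) ;; IfLess (Num 0) (Var vK)
            (IfLess (Var vBest) (Var vMin) (Asg vMin (Var vBest) ;; Asg vMinK (Var vK)) Skip)
            (Asg vMin (Var vBest) ;; Asg vMinK (Var vK))) s4 6 (?Q (s4 (Rg vBest)) (s4 (Rg vArg)))"
            by (rule hoare_wpl) (use b4 B4 B3(1) in auto)
          then show "hoare (Sto aB (EAdd (Var vJ) (Num 1)) (Var vK) (Var vBest) ;;
            Sto aP (EAdd (Var vJ) (Num 1)) (Var vK) (Var vArg) ;; IfLess (Num 0) (Var vK)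
            (IfLess (Var vBest) (Var vMin) (Asg vMin (Var vBest) ;; Asg vMinK (Var vK)) Skip)
            (Asg vMin (Var vBest) ;; Asg vMinK (Var vK))) s4 6 (\<lambda>s'. \<exists>v a. ?Q v a s')"
            by (rule hoare_conseq) (simp, blast)
        qed simp
      qed simp
    qed (use s1 s in auto)
  qed simp
qed

section \<open>Rows of the table: scan over the stations, then changes of station\<close>

abbreviation tabB :: "st \<Rightarrow> nat \<Rightarrow> nat \<Rightarrow> real" where "tabB s \<equiv> (\<lambda>i k. s (Ar aB i k))"
abbreviation tabP :: "st \<Rightarrow> nat \<Rightarrow> nat \<Rightarrow> real" where "tabP s \<equiv> (\<lambda>i k. s (Ar aP i k))"
abbreviation tabK :: "st \<Rightarrow> nat \<Rightarrow> real" where "tabK s \<equiv> (\<lambda>i. s (Ar aK 0 i))"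

lemma edge_cong: "B i k = B' i k \<Longrightarrow> edge x r bx by B k i j = edge x r bx by B' k i j"
  by (simp add: edge_def)

lemma is_best_cong:
  assumes "\<And>i. i \<le> j \<Longrightarrow> B i k = B' i k" "is_best x r bx by B k j j v a"
  shows "is_best x r bx by B' k j j v a"
proof -
  have e: "edge x r bx by B k i j = edge x r bx by B' k i j" if "i \<le> j" for i
    using assms(1)[OF that] by (simp add: edge_def)
  show ?thesis using assms(2) unfolding is_best_def
    by (metis e less_imp_le order_refl)
qed

text \<open>\<open>B i k\<close> is the least cost of covering the first \<open>i\<close> sorted targets while paying for station \<open>k\<close>
  to be open at the end.  Row \<open>Suc j\<close> has its minimum at \<open>\<kappa>\<close>, and a pointer \<open>P (Suc j) k = Suc j\<close> to the row itself
  means that \<open>k\<close> has been opened only after the first \<open>Suc j\<close> targets were covered through \<open>\<kappa>\<close>.\<close>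
definition row_ok :: "(nat \<Rightarrow> real) \<Rightarrow> real \<Rightarrow> (nat \<Rightarrow> real) \<Rightarrow> (nat \<Rightarrow> real) \<Rightarrow> (nat \<Rightarrow> real) \<Rightarrow> nat
    \<Rightarrow> (nat \<Rightarrow> nat \<Rightarrow> real) \<Rightarrow> (nat \<Rightarrow> nat \<Rightarrow> real) \<Rightarrow> nat \<Rightarrow> nat \<Rightarrow> bool" where
  "row_ok x r bx by c m B P \<kappa> j \<longleftrightarrow> \<kappa> < m \<and>
     (\<exists>p\<le>j. P (Suc j) \<kappa> = real p \<and> reach x r p j \<and> B (Suc j) \<kappa> = edge x r bx by B \<kappa> p j) \<and>
     (\<forall>k<m. B (Suc j) \<kappa> \<le> B (Suc j) k \<and> B (Suc j) k \<le> B (Suc j) \<kappa> + c k \<and>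
        (\<forall>i\<le>j. reach x r i j \<longrightarrow> B (Suc j) k \<le> edge x r bx by B k i j) \<and>
        ((\<exists>p\<le>j. P (Suc j) k = real p \<and> reach x r p j \<and> B (Suc j) k = edge x r bx by B k p j) \<or>
         P (Suc j) k = real (Suc j) \<and> B (Suc j) k = B (Suc j) \<kappa> + c k))"

lemma row_ok_cong:
  assumes "\<And>i k. i \<le> Suc j \<Longrightarrow> B' i k = B i k" "\<And>k. P' (Suc j) k = P (Suc j) k"
    "row_ok x r bx by c m B P \<kappa> j"
  shows "row_ok x r bx by c m B' P' \<kappa> j"
proof -
  have e: "edge x r bx by B' k i j = edge x r bx by B k i j" if "i \<le> j" for i k
    using assms(1)[of i k] that by (simp add: edge_def)
  have b: "B' (Suc j) k = B (Suc j) k" for k using assms(1)[of "Suc j" k] by simp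
  show ?thesis using assms(3) unfolding row_ok_def b assms(2) by (metis e)
qed

text \<open>\<open>s\<close> is the state before the scan of the row: candidates read only rows up
  to \<open>j\<close>, which the scan leaves alone, so all are valued in
  \<open>tabB s\<close>.\<close>

definition scanned :: "(nat \<Rightarrow> real) \<Rightarrow> real \<Rightarrow> (nat \<Rightarrow> real) \<Rightarrow> (nat \<Rightarrow> real) \<Rightarrow> nat \<Rightarrow> st \<Rightarrow> nat \<Rightarrow> st \<Rightarrow> bool" where
  "scanned x r bx by j s k s' \<longleftrightarrow>
     (\<forall>i k'. i \<noteq> Suc j \<longrightarrow> tabB s' i k' = tabB s i k' \<and> tabP s' i k' = tabP s i k') \<and>
     (\<forall>k'<k. is_best x r bx by (tabB s) k' j j (tabB s' (Suc j) k') (tabP s' (Suc j) k')) \<and>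
     (0 < k \<longrightarrow> (\<exists>\<kappa><k. s' (Rg vMinK) = real \<kappa> \<and> s' (Rg vMin) = tabB s' (Suc j) \<kappa> \<and>
        (\<forall>k'<k. s' (Rg vMin) \<le> tabB s' (Suc j) k')))"

lemma row_scan_correct:
  assumes s: "stored n m r x bx by c s" "s (Rg vJ) = real j" "j < n" and r: "0 \<le> r"
  shows "hoare (For vK (Var vM) cell_prog) s (m * ((n * 14 + 19) + 2) + 2) (scanned x r bx by j s m)"
proof (rule hoare_For[where I = "scanned x r bx by j s"])
  fix k s' assume k: "k < m" "s' (Rg vK) = real k" and f: "frame (For vK (Var vM) cell_prog) s s'"
    and I: "scanned x r bx by j s k s'"
  have s': "stored n m r x bx by c s'" by (rule stored_frame[OF s(1) f]) auto
  have j': "s' (Rg vJ) = real j" using f s(2) by (simp add: frame_def)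
  show "hoare cell_prog s' (n * 14 + 19) (\<lambda>s''. scanned x r bx by j s (Suc k) (s''(Rg vK := real (Suc k))))"
  proof (rule hoare_conseq[OF cell_correct[OF s' j' k(2) s(3) k(1) r]])
    fix t assume "\<exists>v a. is_best x r bx by (tabB s') k j j v a \<and>
      (\<forall>i k'. t (Ar aB i k') = (if i = Suc j \<and> k' = k then v else s' (Ar aB i k'))) \<and>
      (\<forall>i k'. t (Ar aP i k') = (if i = Suc j \<and> k' = k then a else s' (Ar aP i k'))) \<and>
      t (Rg vMin) = (if k = 0 \<or> v < s' (Rg vMin) then v else s' (Rg vMin)) \<and>
      t (Rg vMinK) = (if k = 0 \<or> v < s' (Rg vMin) then real k else s' (Rg vMinK))"
    then obtain v a where t: "is_best x r bx by (tabB s') k j j v a"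
      "\<And>i k'. t (Ar aB i k') = (if i = Suc j \<and> k' = k then v else s' (Ar aB i k'))"
      "\<And>i k'. t (Ar aP i k') = (if i = Suc j \<and> k' = k then a else s' (Ar aP i k'))"
      "t (Rg vMin) = (if k = 0 \<or> v < s' (Rg vMin) then v else s' (Rg vMin))"
      "t (Rg vMinK) = (if k = 0 \<or> v < s' (Rg vMin) then real k else s' (Rg vMinK))"
      by blast
    have b: "is_best x r bx by (tabB s) k j j v a"
      by (rule is_best_cong[OF _ t(1)]) (use I in \<open>auto simp: scanned_def\<close>)
    have 1: "tabB t i k' = tabB s i k' \<and> tabP t i k' = tabP s i k'" if "i \<noteq> Suc j" for i k'
      using that I t(2,3) by (simp add: scanned_def)
    have 2: "is_best x r bx by (tabB s) k' j j (tabB t (Suc j) k') (tabP t (Suc j) k')" if "k' < Suc k" for k'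
      using that I t(2,3) b by (auto simp: scanned_def less_Suc_eq)
    have 3: "\<exists>\<kappa><Suc k. t (Rg vMinK) = real \<kappa> \<and> t (Rg vMin) = tabB t (Suc j) \<kappa> \<and>
        (\<forall>k'<Suc k. t (Rg vMin) \<le> tabB t (Suc j) k')"
    proof (cases "k = 0 \<or> v < s' (Rg vMin)")
      case True
      have "v \<le> tabB s' (Suc j) k'" if "k' < k" for k'
      proof -
        have "s' (Rg vMin) \<le> tabB s' (Suc j) k'" using I that by (auto simp: scanned_def)
        then show ?thesis using True that by auto
      qed
      then show ?thesis using True t by (intro exI[of _ k]) (auto simp: less_Suc_eq)
    next
      case False
      then obtain \<kappa> where "\<kappa> < k" "s' (Rg vMinK) = real \<kappa>" "s' (Rg vMin) = tabB s' (Suc j) \<kappa>"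
        "\<forall>k'<k. s' (Rg vMin) \<le> tabB s' (Suc j) k'" using I by (auto simp: scanned_def)
      then show ?thesis using False t by (intro exI[of _ \<kappa>]) (auto simp: less_Suc_eq)
    qed
    show "scanned x r bx by j s (Suc k) (t(Rg vK := real (Suc k)))"
      using 1 2 3 unfolding scanned_def by simp
  qed (use s(3) in auto)
qed (use s in \<open>auto simp: scanned_def frame_def stored_def\<close>)

text \<open>Run only after the whole row has been scanned. The minimum is kept in a register, and
  with nonnegative costs changed entries never fall below it, so updating in place is
  harmless.\<close>

definition switch_body :: com where
  "switch_body = IfLess (EAdd (Var vMin) (stationE 5 (Var vK))) (EArr aB (EAdd (Var vJ) (Num 1)) (Var vK))
     (Sto aB (EAdd (Var vJ) (Num 1)) (Var vK) (EAdd (Var vMin) (stationE 5 (Var vK))) ;;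
      Sto aP (EAdd (Var vJ) (Num 1)) (Var vK) (EAdd (Var vJ) (Num 1))) Skip"

lemma modifies_switch_body [simp]: "modifies switch_body l \<longleftrightarrow> (\<exists>i k. l = Ar aB i k \<or> l = Ar aP i k)"
  by (cases l) (auto simp: switch_body_def)

lemma switch_correct:
  assumes s: "stored n m r x bx by c s" "s (Rg vJ) = real j"
  shows "hoare (For vK (Var vM) switch_body) s (m * (3 + 2) + 2) (\<lambda>s'. \<forall>i k.
     tabB s' i k = (if i = Suc j \<and> k < m \<and> s (Rg vMin) + c k < tabB s i k then s (Rg vMin) + c k else tabB s i k) \<and>
     tabP s' i k = (if i = Suc j \<and> k < m \<and> s (Rg vMin) + c k < tabB s i k then real (Suc j) else tabP s i k))"
proof -
  let ?I = "\<lambda>N s'. \<forall>i k.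
     tabB s' i k = (if i = Suc j \<and> k < N \<and> s (Rg vMin) + c k < tabB s i k then s (Rg vMin) + c k else tabB s i k) \<and>
     tabP s' i k = (if i = Suc j \<and> k < N \<and> s (Rg vMin) + c k < tabB s i k then real (Suc j) else tabP s i k)"
  show ?thesis
  proof (rule hoare_For[where I = ?I])
    fix k s' assume k: "k < m" "s' (Rg vK) = real k" and f: "frame (For vK (Var vM) switch_body) s s'"
      and I: "?I k s'"
    have s': "stored n m r x bx by c s'" by (rule stored_frame[OF s(1) f]) auto
    have j': "s' (Rg vJ) = real j" "s' (Rg vMin) = s (Rg vMin)" using f s(2) by (simp_all add: frame_def)
    have "wp switch_body (?I (Suc k)) s'"
      using I j' k s' unfolding switch_body_def
      by (auto simp: stationE_def stored_def less_Suc_eq)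
    then have "hoare switch_body s' 3 (?I (Suc k))" by (rule hoare_wpl) (simp add: switch_body_def)
    then show "hoare switch_body s' 3 (\<lambda>s''. ?I (Suc k) (s''(Rg vK := real (Suc k))))"
      by (rule hoare_conseq) auto
  qed (use s in \<open>auto simp: frame_def stored_def\<close>)
qed

definition row_prog :: com where
  "row_prog = For vK (Var vM) cell_prog ;; Sto aK (Num 0) (EAdd (Var vJ) (Num 1)) (Var vMinK) ;;
     For vK (Var vM) switch_body"

lemma modifies_row_prog [simp]:
  "modifies row_prog l \<longleftrightarrow> l \<in> {Rg vLo, Rg vHi, Rg vPos, Rg vVal, Rg vBest, Rg vArg, Rg vI, Rg vMin, Rg vMinK, Rg vK}
     \<or> (\<exists>i k. l = Ar aB i k \<or> l = Ar aP i k \<or> l = Ar aK i k)"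
  by (cases l) (auto simp: row_prog_def)

lemma row_ok_after_switch:
  assumes sc: "scanned x r bx by j s m s1" and m: "0 < m" and c: "\<And>k. k < m \<Longrightarrow> 0 \<le> c k"
    and B: "\<And>i k. B i k = (if i = Suc j \<and> k < m \<and> s1 (Rg vMin) + c k < tabB s1 i k
       then s1 (Rg vMin) + c k else tabB s1 i k)"
    and P: "\<And>i k. P i k = (if i = Suc j \<and> k < m \<and> s1 (Rg vMin) + c k < tabB s1 i k
       then real (Suc j) else tabP s1 i k)"
  obtains \<kappa> where "s1 (Rg vMinK) = real \<kappa>" "row_ok x r bx by c m B P \<kappa> j"
proof -
  obtain \<kappa> where \<kappa>: "\<kappa> < m" "s1 (Rg vMinK) = real \<kappa>" "s1 (Rg vMin) = tabB s1 (Suc j) \<kappa>"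
    "\<And>k'. k' < m \<Longrightarrow> s1 (Rg vMin) \<le> tabB s1 (Suc j) k'" using sc m by (auto simp: scanned_def)
  have e: "edge x r bx by B k i j = edge x r bx by (tabB s) k i j" if "i \<le> j" for i k
    by (rule edge_cong) (use that B sc in \<open>auto simp: scanned_def\<close>)
  have best: "\<exists>p\<le>j. tabP s1 (Suc j) k = real p \<and> reach x r p j \<and> tabB s1 (Suc j) k = edge x r bx by B k p j"
    "\<And>i. i \<le> j \<Longrightarrow> reach x r i j \<Longrightarrow> tabB s1 (Suc j) k \<le> edge x r bx by B k i j" if "k < m" for k
  proof -
    have b: "is_best x r bx by (tabB s) k j j (tabB s1 (Suc j) k) (tabP s1 (Suc j) k)"
      using sc that by (auto simp: scanned_def)
    show "\<exists>p\<le>j. tabP s1 (Suc j) k = real p \<and> reach x r p j \<and> tabB s1 (Suc j) k = edge x r bx by B k p j"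
      using b e unfolding is_best_def by metis
    show "tabB s1 (Suc j) k \<le> edge x r bx by B k i j" if "i \<le> j" "reach x r i j" for i
      using b that unfolding is_best_def e[OF that(1)] by (metis le_neq_implies_less)
  qed
  \<comment> \<open>As \<open>c \<kappa>\<close> is nonnegative, the minimal entry is not replaced,
    so its pointer still leads to an earlier row.\<close>
  have B\<kappa>: "B (Suc j) \<kappa> = tabB s1 (Suc j) \<kappa>" "P (Suc j) \<kappa> = tabP s1 (Suc j) \<kappa>"
    using B[of "Suc j" \<kappa>] P[of "Suc j" \<kappa>] c[OF \<kappa>(1)] \<kappa>(3) by auto
  have Bk: "B (Suc j) k \<le> tabB s1 (Suc j) k" "B (Suc j) \<kappa> \<le> B (Suc j) k" "B (Suc j) k \<le> B (Suc j) \<kappa> + c k"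
    if "k < m" for k
    using B[of "Suc j" k] B\<kappa>(1) \<kappa>(3) \<kappa>(4)[OF that] c[OF that] that by auto
  have "row_ok x r bx by c m B P \<kappa> j"
    unfolding row_ok_def
  proof (intro conjI allI impI)
    show "\<exists>p\<le>j. P (Suc j) \<kappa> = real p \<and> reach x r p j \<and> B (Suc j) \<kappa> = edge x r bx by B \<kappa> p j"
      using best(1)[OF \<kappa>(1)] unfolding B\<kappa> by blast
    fix k assume k: "k < m"
    show "(\<exists>p\<le>j. P (Suc j) k = real p \<and> reach x r p j \<and> B (Suc j) k = edge x r bx by B k p j) \<or>
         P (Suc j) k = real (Suc j) \<and> B (Suc j) k = B (Suc j) \<kappa> + c k"
    proof (cases "s1 (Rg vMin) + c k < tabB s1 (Suc j) k")
      case True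
      then show ?thesis using B[of "Suc j" k] P[of "Suc j" k] k B\<kappa>(1) \<kappa>(3) by simp
    next
      case False
      then have "B (Suc j) k = tabB s1 (Suc j) k" "P (Suc j) k = tabP s1 (Suc j) k"
        using B[of "Suc j" k] P[of "Suc j" k] by simp_all
      then show ?thesis using best(1)[OF k] by simp
    qed
    fix i assume "i \<le> j" "reach x r i j"
    then show "B (Suc j) k \<le> edge x r bx by B k i j" using best(2)[OF k] Bk(1)[OF k] by fastforce
  qed (use \<kappa>(1) Bk in auto)
  then show ?thesis using that \<kappa>(2) by blast
qed

lemma row_correct:
  assumes s: "stored n m r x bx by c s" "s (Rg vJ) = real j" "j < n" and r: "0 \<le> r" and m: "0 < m"
    and c: "\<And>k. k < m \<Longrightarrow> 0 \<le> c k"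
  shows "hoare row_prog s (m * (n * 14 + 26) + 5) (\<lambda>s'.
     (\<forall>i k. i \<noteq> Suc j \<longrightarrow> tabB s' i k = tabB s i k \<and> tabP s' i k = tabP s i k \<and> tabK s' i = tabK s i) \<and>
     (\<exists>\<kappa>. tabK s' (Suc j) = real \<kappa> \<and> row_ok x r bx by c m (tabB s') (tabP s') \<kappa> j))" (is "hoare _ _ _ ?Q")
  unfolding row_prog_def
proof (rule hoare_Seq[OF row_scan_correct[OF s r]])
  fix s1 assume sc: "scanned x r bx by j s m s1" and f: "frame (For vK (Var vM) cell_prog) s s1"
  have s1: "stored n m r x bx by c s1" by (rule stored_frame[OF s(1) f]) auto
  have j1: "s1 (Rg vJ) = real j" "\<And>i. tabK s1 i = tabK s i" using f s(2) by (simp_all add: frame_def)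
  let ?s2 = "s1(Ar aK 0 (Suc j) := s1 (Rg vMinK))"
  have "hoare (Sto aK (Num 0) (EAdd (Var vJ) (Num 1)) (Var vMinK)) s1 1 (\<lambda>s'. s' = ?s2)"
    by (rule hoare_wpl) (use j1 in auto)
  then show "hoare (Sto aK (Num 0) (EAdd (Var vJ) (Num 1)) (Var vMinK) ;; For vK (Var vM) switch_body) s1
      (1 + (m * (3 + 2) + 2)) ?Q"
  proof (rule hoare_Seq)
    fix s2 assume s2: "s2 = ?s2"
    have s2': "stored n m r x bx by c s2" "s2 (Rg vJ) = real j" using s2 s1 j1 by simp_all
    show "hoare (For vK (Var vM) switch_body) s2 (m * (3 + 2) + 2) ?Q"
    proof (rule hoare_conseq[OF switch_correct[OF s2']])
      fix s3 assume t: "\<forall>i k.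
       tabB s3 i k = (if i = Suc j \<and> k < m \<and> s2 (Rg vMin) + c k < tabB s2 i k then s2 (Rg vMin) + c k else tabB s2 i k) \<and>
       tabP s3 i k = (if i = Suc j \<and> k < m \<and> s2 (Rg vMin) + c k < tabB s2 i k then real (Suc j) else tabP s2 i k)"
        and f3: "frame (For vK (Var vM) switch_body) s2 s3"
      have K: "tabK s3 i = (if i = Suc j then s1 (Rg vMinK) else tabK s i)" for i
        using f3 s2 j1(2) by (simp add: frame_def)
      obtain \<kappa> where "s1 (Rg vMinK) = real \<kappa>" "row_ok x r bx by c m (tabB s3) (tabP s3) \<kappa> j"
        by (rule row_ok_after_switch[OF sc m c, where B = "tabB s3" and P = "tabP s3"]) (use t s2 in auto)
      moreover have "tabB s3 i k = tabB s i k \<and> tabP s3 i k = tabP s i k" if "i \<noteq> Suc j" for i k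
        using t s2 sc that by (simp add: scanned_def)
      ultimately show "?Q s3" using K by simp
    qed simp
  qed simp
qed (simp add: algebra_simps)

definition table_ok :: "(nat \<Rightarrow> real) \<Rightarrow> real \<Rightarrow> (nat \<Rightarrow> real) \<Rightarrow> (nat \<Rightarrow> real) \<Rightarrow> (nat \<Rightarrow> real) \<Rightarrow> nat
    \<Rightarrow> (nat \<Rightarrow> nat \<Rightarrow> real) \<Rightarrow> (nat \<Rightarrow> nat \<Rightarrow> real) \<Rightarrow> (nat \<Rightarrow> real) \<Rightarrow> nat \<Rightarrow> bool" where
  "table_ok x r bx by c m B P K N \<longleftrightarrow> (\<forall>k<m. B 0 k = c k) \<and>
     (\<forall>j<N. \<exists>\<kappa>. K (Suc j) = real \<kappa> \<and> row_ok x r bx by c m B P \<kappa> j)"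

definition dp_prog :: com where
  "dp_prog = For vK (Var vM) (Sto aB (Num 0) (Var vK) (stationE 5 (Var vK))) ;; For vJ (Var vN) row_prog"

lemma modifies_dp_prog [simp]:
  "modifies dp_prog l \<longleftrightarrow> l \<in> {Rg vLo, Rg vHi, Rg vPos, Rg vVal, Rg vBest, Rg vArg, Rg vI, Rg vMin, Rg vMinK, Rg vK, Rg vJ}
     \<or> (\<exists>i k. l = Ar aB i k \<or> l = Ar aP i k \<or> l = Ar aK i k)"
  by (cases l) (auto simp: dp_prog_def)

lemma dp_correct:
  assumes s: "stored n m r x bx by c s" and r: "0 \<le> r" and m: "0 < m" and c: "\<And>k. k < m \<Longrightarrow> 0 \<le> c k"
  shows "hoare dp_prog s (m * 3 + n * (m * (n * 14 + 26) + 7) + 4)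
    (\<lambda>s'. table_ok x r bx by c m (tabB s') (tabP s') (tabK s') n)"
  unfolding dp_prog_def
proof (rule hoare_Seq)
  let ?p = "Sto aB (Num 0) (Var vK) (stationE 5 (Var vK))"
  let ?I = "\<lambda>k s'. \<forall>k'<k. tabB s' 0 k' = c k'"
  show "hoare (For vK (Var vM) ?p) s (m * (1 + 2) + 2) (?I m)"
  proof (rule hoare_For[where I = ?I])
    fix k s' assume k: "k < m" "s' (Rg vK) = real k" "?I k s'" and f: "frame (For vK (Var vM) ?p) s s'"
    have s': "stored n m r x bx by c s'" by (rule stored_frame[OF s(1) f]) auto
    show "hoare ?p s' 1 (\<lambda>s''. ?I (Suc k) (s''(Rg vK := real (Suc k))))"
      by (rule hoare_wpl) (use k s' in \<open>auto simp: stationE_def stored_def less_Suc_eq\<close>)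
  qed (use s in \<open>auto simp: frame_def stored_def\<close>)
next
  fix s1 assume B0: "\<forall>k<m. tabB s1 0 k = c k"
    and f1: "frame (For vK (Var vM) (Sto aB (Num 0) (Var vK) (stationE 5 (Var vK)))) s s1"
  have s1: "stored n m r x bx by c s1" by (rule stored_frame[OF s(1) f1]) auto
  let ?I = "\<lambda>j s'. table_ok x r bx by c m (tabB s') (tabP s') (tabK s') j"
  show "hoare (For vJ (Var vN) row_prog) s1 (n * ((m * (n * 14 + 26) + 5) + 2) + 2) (?I n)"
  proof (rule hoare_For[where I = ?I])
    fix j s' assume j: "j < n" "s' (Rg vJ) = real j" "?I j s'" and f: "frame (For vJ (Var vN) row_prog) s1 s'"
    have s': "stored n m r x bx by c s'" by (rule stored_frame[OF s1 f]) auto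
    show "hoare row_prog s' (m * (n * 14 + 26) + 5) (\<lambda>s''. ?I (Suc j) (s''(Rg vJ := real (Suc j))))"
    proof (rule hoare_conseq[OF row_correct[OF s' j(2,1) r m c]])
      fix t assume "(\<forall>i k. i \<noteq> Suc j \<longrightarrow> tabB t i k = tabB s' i k \<and> tabP t i k = tabP s' i k \<and> tabK t i = tabK s' i) \<and>
         (\<exists>\<kappa>. tabK t (Suc j) = real \<kappa> \<and> row_ok x r bx by c m (tabB t) (tabP t) \<kappa> j)"
      then have old: "\<And>i k. i \<noteq> Suc j \<Longrightarrow> tabB t i k = tabB s' i k"
          "\<And>i k. i \<noteq> Suc j \<Longrightarrow> tabP t i k = tabP s' i k" "\<And>i. i \<noteq> Suc j \<Longrightarrow> tabK t i = tabK s' i"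
        and new: "\<exists>\<kappa>. tabK t (Suc j) = real \<kappa> \<and> row_ok x r bx by c m (tabB t) (tabP t) \<kappa> j" by auto
      have "\<exists>\<kappa>. tabK t (Suc i) = real \<kappa> \<and> row_ok x r bx by c m (tabB t) (tabP t) \<kappa> i" if "i < Suc j" for i
      proof (cases "i = j")
        case False
        then have ij: "i < j" using that by simp
        then obtain \<kappa> where "tabK s' (Suc i) = real \<kappa>" "row_ok x r bx by c m (tabB s') (tabP s') \<kappa> i"
          using j(3) by (auto simp: table_ok_def)
        moreover have "row_ok x r bx by c m (tabB t) (tabP t) \<kappa> i"
          by (rule row_ok_cong[OF _ _ calculation(2)]) (use ij old in auto)
        ultimately show ?thesis using old(3)[of "Suc i"] ij by auto
      qed (use new in simp)
      then show "?I (Suc j) (t(Rg vJ := real (Suc j)))"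
        using j(3) old(1)[of 0] by (auto simp: table_ok_def)
    qed auto
  qed (use s1 B0 in \<open>auto simp: frame_def stored_def table_ok_def\<close>)
qed (simp add: algebra_simps)

section \<open>Reconstruction of a solution\<close>

text \<open>\<open>B j k\<close> already contains the opening cost of \<open>k\<close>, so \<open>k\<close> is excluded from the sum.\<close>
definition recon_inv :: "(nat \<Rightarrow> real) \<Rightarrow> real \<Rightarrow> (nat \<Rightarrow> real) \<Rightarrow> (nat \<Rightarrow> real) \<Rightarrow> (nat \<Rightarrow> real) \<Rightarrow> nat \<Rightarrow> nat
    \<Rightarrow> (nat \<Rightarrow> nat \<Rightarrow> real) \<Rightarrow> real \<Rightarrow> (nat \<times> real) list \<Rightarrow> nat \<Rightarrow> nat \<Rightarrow> bool" where
  "recon_inv x r bx by c n m B V S j k \<longleftrightarrow> j \<le> n \<and> k < m \<and> fst ` set S \<subseteq> {..<m} \<and>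
     (\<forall>i. j \<le> i \<longrightarrow> i < n \<longrightarrow> (\<exists>s\<in>set S. \<bar>x i - snd s\<bar> \<le> r)) \<and>
     (\<Sum>\<kappa>\<in>fst ` set S - {k}. c \<kappa>) + (\<Sum>s\<leftarrow>S. move_dist bx by s) + B j k \<le> V"

text \<open>\<open>V\<close> is a budget. The edge equation splits \<open>B (Suc j) k\<close> into
  the distance of the new sensor and \<open>B p k\<close>, so the total is unchanged; no opening
  cost appears because \<open>k\<close> stays the excluded station.\<close>

lemma recon_inv_emit:
  assumes inv: "recon_inv x r bx by c n m B V S (Suc j) k"
    and p: "p \<le> j" "reach x r p j" "B (Suc j) k = edge x r bx by B k p j"
    and sorted: "\<And>a b. a \<le> b \<Longrightarrow> b < n \<Longrightarrow> x a \<le> x b"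
  shows "recon_inv x r bx by c n m B V (S @ [(k, sensor_pos x r bx k p j)]) p k"
  unfolding recon_inv_def
proof (intro conjI allI impI)
  let ?d = "sensor_pos x r bx k p j"
  have jn: "j < n" using inv by (simp add: recon_inv_def)
  have d: "x j - r \<le> ?d" "?d \<le> x p + r"
    using clamp_in[of "x j - r" "x p + r"] p(2) by (auto simp: sensor_pos_def reach_def)
  fix i assume i: "p \<le> i" "i < n"
  show "\<exists>s\<in>set (S @ [(k, ?d)]). \<bar>x i - snd s\<bar> \<le> r"
  proof (cases "i \<le> j")
    case True
    then have "\<bar>x i - ?d\<bar> \<le> r" using d sorted[OF i] sorted[OF True jn] by auto
    then show ?thesis by simp
  next
    case False
    then have "\<exists>s\<in>set S. \<bar>x i - snd s\<bar> \<le> r" using inv i by (simp add: recon_inv_def)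
    then show ?thesis by auto
  qed
next
  show "(\<Sum>\<kappa>\<in>fst ` set (S @ [(k, sensor_pos x r bx k p j)]) - {k}. c \<kappa>)
      + (\<Sum>s\<leftarrow>S @ [(k, sensor_pos x r bx k p j)]. move_dist bx by s) + B p k \<le> V"
    using inv p(3) by (simp add: recon_inv_def edge_def)
qed (use inv p in \<open>auto simp: recon_inv_def\<close>)

text \<open>Used with \<open>G = {\<kappa>}\<close> at a change of station and with
  \<open>G = {}\<close> at the end; \<open>F - G\<close> always lies in
  \<open>insert k (F - {k})\<close>.\<close>

lemma sum_remove_le:
  fixes c :: "nat \<Rightarrow> real"
  assumes "finite F" "F \<subseteq> {..<m}" "k < m" "\<And>k. k < m \<Longrightarrow> 0 \<le> c k"
  shows "sum c (F - G) \<le> sum c (F - {k}) + c k"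
proof -
  have "sum c (F - G) \<le> sum c (insert k (F - {k}))"
    by (rule sum_mono2) (use assms in auto)
  also have "\<dots> = c k + sum c (F - {k})" by (rule sum.insert) (use assms(1) in auto)
  finally show ?thesis by simp
qed

text \<open>The \<open>c k\<close> set free from \<open>B j k\<close> pays for \<open>k\<close>,
  which is no longer excluded. If \<open>\<kappa>\<close> already has sensors, excluding it only
  lowers the sum.\<close>

lemma recon_inv_switch:
  assumes inv: "recon_inv x r bx by c n m B V S j k" and "\<kappa> < m" "B j k = B j \<kappa> + c k"
    and c: "\<And>k. k < m \<Longrightarrow> 0 \<le> c k"
  shows "recon_inv x r bx by c n m B V S j \<kappa>"
  using assms sum_remove_le[of "fst ` set S" m k c "{\<kappa>}"] by (auto simp: recon_inv_def)

text \<open>One redirection suffices, since the pointer of the row minimum \<open>\<kappa>\<close>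
  always leads to an earlier row. So every step emits exactly one sensor and strictly decreases the
  number of targets left.\<close>

lemma recon_step:
  assumes row: "row_ok x r bx by c m B P \<kappa> j" and inv: "recon_inv x r bx by c n m B V S (Suc j) k"
    and c: "\<And>k. k < m \<Longrightarrow> 0 \<le> c k" and sorted: "\<And>a b. a \<le> b \<Longrightarrow> b < n \<Longrightarrow> x a \<le> x b"
    and k': "k' = (if P (Suc j) k < real (Suc j) then k else \<kappa>)"
  obtains p where "p \<le> j" "P (Suc j) k' = real p" "k' < m"
    "recon_inv x r bx by c n m B V (S @ [(k', sensor_pos x r bx k' p j)]) p k'"
proof -
  have k: "k < m" using inv by (simp add: recon_inv_def)
  have disj: "(\<exists>p\<le>j. P (Suc j) k = real p \<and> reach x r p j \<and> B (Suc j) k = edge x r bx by B k p j) \<or>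
      P (Suc j) k = real (Suc j) \<and> B (Suc j) k = B (Suc j) \<kappa> + c k"
    using row k by (auto simp: row_ok_def)
  have "recon_inv x r bx by c n m B V S (Suc j) k' \<and>
    (\<exists>p\<le>j. P (Suc j) k' = real p \<and> reach x r p j \<and> B (Suc j) k' = edge x r bx by B k' p j)"
  proof (cases "P (Suc j) k < real (Suc j)")
    case True
    then show ?thesis using k' disj inv by auto
  next
    case False
    then have "B (Suc j) k = B (Suc j) \<kappa> + c k" using disj by auto
    moreover have "\<kappa> < m" using row by (simp add: row_ok_def)
    ultimately show ?thesis using recon_inv_switch[OF inv _ _ c] row k' False by (auto simp: row_ok_def)
  qed
  then obtain p where p: "recon_inv x r bx by c n m B V S (Suc j) k'" "p \<le> j" "P (Suc j) k' = real p"
    "reach x r p j" "B (Suc j) k' = edge x r bx by B k' p j" by auto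
  show ?thesis
    by (rule that[OF p(2,3) _ recon_inv_emit[OF p(1,2,4,5) sorted]]) (use p(1) in \<open>auto simp: recon_inv_def\<close>)
qed

text \<open>Cell 0 is left out because the number of sensors is written only after the
  trace-back.\<close>

definition emitted :: "nat \<Rightarrow> (nat \<times> real) list \<Rightarrow> (nat \<Rightarrow> real) \<Rightarrow> bool" where
  "emitted m S out \<longleftrightarrow> (\<forall>q<length S. out (m + 1 + 2 * q) = real (fst (S ! q)) \<and> out (m + 2 + 2 * q) = snd (S ! q)) \<and>
     (\<forall>k<m. out (1 + k) = (if k \<in> fst ` set S then 1 else 0))"

lemma emitted_snoc:
  assumes "emitted m S out" "k < m"
  shows "emitted m (S @ [(k, d)])
    (out(m + 1 + 2 * length S := real k, m + 2 + 2 * length S := d, 1 + k := 1))"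
  unfolding emitted_def
proof (intro conjI allI impI)
  let ?out = "out(m + 1 + 2 * length S := real k, m + 2 + 2 * length S := d, 1 + k := 1)"
  fix q assume q: "q < length (S @ [(k, d)])"
  \<comment> \<open>Flags end at index \<open>m\<close>; above it, station and destination cells
    differ in parity.\<close>
  have ne: "m + 1 + 2 * q \<noteq> 1 + k" "m + 2 + 2 * q \<noteq> 1 + k" "m + 1 + 2 * q \<noteq> m + 2 + 2 * length S"
    "m + 2 + 2 * q \<noteq> m + 1 + 2 * length S" using assms(2) by presburger+
  show "?out (m + 1 + 2 * q) = real (fst ((S @ [(k, d)]) ! q))"
    using ne assms q by (cases "q = length S") (auto simp: emitted_def nth_append)
  show "?out (m + 2 + 2 * q) = snd ((S @ [(k, d)]) ! q)"
    using ne assms q by (cases "q = length S") (auto simp: emitted_def nth_append)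
next
  fix i assume "i < m"
  then show "(out(m + 1 + 2 * length S := real k, m + 2 + 2 * length S := d, 1 + k := 1)) (1 + i)
      = (if i \<in> fst ` set (S @ [(k, d)]) then 1 else 0)"
    using assms by (auto simp: emitted_def)
qed

abbreviation outs :: "st \<Rightarrow> nat \<Rightarrow> real" where "outs s \<equiv> (\<lambda>i. s (Ar aOut 0 i))"

definition emit_prog :: com where
  "emit_prog = Sto aOut (Num 0) (EAdd (EAdd (Var vM) (Num 1)) (EMul (Num 2) (Var vQ))) (Var vK) ;;
     Sto aOut (Num 0) (EAdd (EAdd (Var vM) (Num 2)) (EMul (Num 2) (Var vQ))) (Var vPos) ;;
     Sto aOut (Num 0) (EAdd (Num 1) (Var vK)) (Num 1) ;;
     Asg vQ (EAdd (Var vQ) (Num 1)) ;; Asg vC (Var vI)"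

definition locate_prog :: com where
  "locate_prog = IfLess (EArr aP (Var vC) (Var vK)) (Var vC) Skip (Asg vK (EArr aK (Num 0) (Var vC))) ;;
     Asg vI (EArr aP (Var vC) (Var vK)) ;; Asg vJ (ESub (Var vC) (Num 1))"

text \<open>The loop always runs \<open>n\<close> rounds; the guard makes them idle once no target
  is left. The destination is recomputed by \<open>calc\<close> from the pointer instead of being
  stored in the table.\<close>

definition recon_body :: com where
  "recon_body = IfLess (Num 0) (Var vC) (locate_prog ;; calc ;; emit_prog) Skip"

lemma modifies_emit_prog [simp]: "modifies emit_prog l \<longleftrightarrow> l \<in> {Rg vQ, Rg vC} \<or> (\<exists>i k. l = Ar aOut i k)"
  by (cases l) (auto simp: emit_prog_def)
lemma modifies_locate_prog [simp]: "modifies locate_prog l \<longleftrightarrow> l \<in> {Rg vK, Rg vI, Rg vJ}"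
  by (auto simp: locate_prog_def)
lemma modifies_recon_body [simp]: "modifies recon_body l \<longleftrightarrow> modifies locate_prog l \<or> modifies calc l \<or> modifies emit_prog l"
  by (simp add: recon_body_def)

text \<open>After \<open>N\<close> rounds at most \<open>n - N\<close> targets are left, so
  \<open>N = n\<close> forces \<open>j = 0\<close>; the bound on \<open>length S\<close> later
  limits the size of the output.\<close>

definition recon_state :: "(nat \<Rightarrow> real) \<Rightarrow> real \<Rightarrow> (nat \<Rightarrow> real) \<Rightarrow> (nat \<Rightarrow> real) \<Rightarrow> (nat \<Rightarrow> real) \<Rightarrow> nat \<Rightarrow> nat
    \<Rightarrow> (nat \<Rightarrow> nat \<Rightarrow> real) \<Rightarrow> real \<Rightarrow> nat \<Rightarrow> st \<Rightarrow> bool" where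
  "recon_state x r bx by c n m B V N s \<longleftrightarrow> (\<exists>S j k. s (Rg vC) = real j \<and> s (Rg vK) = real k \<and>
     s (Rg vQ) = real (length S) \<and> j \<le> n - N \<and> length S \<le> N \<and> emitted m S (outs s) \<and>
     recon_inv x r bx by c n m B V S j k)"

lemma recon_body_correct:
  assumes s: "stored n m r x bx by c s" and c: "\<And>k. k < m \<Longrightarrow> 0 \<le> c k"
    and sorted: "\<And>a b. a \<le> b \<Longrightarrow> b < n \<Longrightarrow> x a \<le> x b"
    and tab: "table_ok x r bx by c m (tabB s) (tabP s) (tabK s) n"
    and st: "recon_state x r bx by c n m (tabB s) V N s" and N: "N < n"
  shows "hoare recon_body s 18 (recon_state x r bx by c n m (tabB s) V (Suc N))"
proof -
  let ?Q = "recon_state x r bx by c n m (tabB s) V (Suc N)"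
  obtain S j k where st: "s (Rg vC) = real j" "s (Rg vK) = real k" "s (Rg vQ) = real (length S)"
    "j \<le> n - N" "length S \<le> N" "emitted m S (outs s)" "recon_inv x r bx by c n m (tabB s) V S j k"
    using st by (auto simp: recon_state_def)
  have m: "s (Rg vM) = real m" using s by (simp add: stored_def)
  show ?thesis
  proof (cases j)
    case 0
    have "?Q s" unfolding recon_state_def using st 0 by (intro exI[of _ S] exI[of _ j] exI[of _ k]) simp
    then have "hoare recon_body s (Suc 0) ?Q" unfolding recon_body_def
      by (intro hoare_IfLess hoare_wpl) (use st 0 in auto)
    then show ?thesis by (rule hoare_conseq) auto
  next
    case (Suc jj)
    have jjn: "jj < n" using st(4) N Suc by simp
    obtain \<kappa> where \<kappa>: "tabK s (Suc jj) = real \<kappa>" "row_ok x r bx by c m (tabB s) (tabP s) \<kappa> jj"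
      using tab jjn by (auto simp: table_ok_def)
    define k' where "k' = (if tabP s (Suc jj) k < real (Suc jj) then k else \<kappa>)"
    obtain p where p: "p \<le> jj" "tabP s (Suc jj) k' = real p" "k' < m"
      "recon_inv x r bx by c n m (tabB s) V (S @ [(k', sensor_pos x r bx k' p jj)]) p k'"
      using recon_step[OF \<kappa>(2) st(7)[unfolded Suc] c sorted k'_def] by blast
    have "hoare locate_prog s 4 (\<lambda>s'. s' (Rg vK) = real k' \<and> s' (Rg vI) = real p \<and> s' (Rg vJ) = real jj)"
      by (rule hoare_wpl) (use st Suc p \<kappa> k'_def in \<open>auto simp: locate_prog_def split: if_splits\<close>)
    then have "hoare (locate_prog ;; calc ;; emit_prog) s 17 ?Q"
    proof (rule hoare_Seq)
      fix s1 assume s1: "s1 (Rg vK) = real k' \<and> s1 (Rg vI) = real p \<and> s1 (Rg vJ) = real jj"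
        and f1: "frame locate_prog s s1"
      have s1': "stored n m r x bx by c s1" by (rule stored_frame[OF s f1]) auto
      show "hoare (calc ;; emit_prog) s1 13 ?Q"
      proof (rule hoare_Seq[OF calc_correct[OF s1', of jj k' p]])
        fix s2 assume c2: "s2 (Rg vLo) = x jj - r \<and> s2 (Rg vHi) = x p + r \<and>
         s2 (Rg vPos) = sensor_pos x r bx k' p jj \<and> s2 (Rg vVal) = edge x r bx by (\<lambda>i k. s1 (Ar aB i k)) k' p jj"
          and f2: "frame calc s1 s2"
        let ?d = "sensor_pos x r bx k' p jj"
        let ?q = "length S"
        have e: "s2 (Rg vK) = real k'" "s2 (Rg vI) = real p" "s2 (Rg vQ) = real ?q" "s2 (Rg vM) = real m"
          "s2 (Rg vPos) = ?d" "outs s2 = outs s"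
          using s1 f1 f2 c2 m st(3) by (simp_all add: frame_def)
        have "hoare emit_prog s2 5 (\<lambda>s'. s' (Rg vC) = real p \<and> s' (Rg vK) = real k' \<and> s' (Rg vQ) = real (Suc ?q) \<and>
           outs s' = (outs s)(m + 1 + 2 * ?q := real k', m + 2 + 2 * ?q := ?d, 1 + k' := 1))"
          by (rule hoare_wpl) (use e fun_cong[OF e(6)] in \<open>auto simp: emit_prog_def\<close>)
        then show "hoare emit_prog s2 5 ?Q"
        proof (rule hoare_conseq)
          fix s3 assume s3: "s3 (Rg vC) = real p \<and> s3 (Rg vK) = real k' \<and> s3 (Rg vQ) = real (Suc ?q) \<and>
           outs s3 = (outs s)(m + 1 + 2 * ?q := real k', m + 2 + 2 * ?q := ?d, 1 + k' := 1)"
          show "?Q s3" unfolding recon_state_def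
          proof (intro exI conjI)
            show "emitted m (S @ [(k', ?d)]) (outs s3)" using emitted_snoc[OF st(6) p(3), of ?d] s3 by simp
            show "recon_inv x r bx by c n m (tabB s) V (S @ [(k', ?d)]) p k'" by (rule p(4))
            show "p \<le> n - Suc N" using p(1) Suc st(4) by simp
          qed (use s3 st(5) in auto)
        qed simp
      qed (use s1 p jjn in auto)
    qed simp
    then show ?thesis unfolding recon_body_def
      by (intro hoare_IfLess[where T = 17, simplified]) (use st Suc in auto)
  qed
qed

definition recon_prog :: com where
  "recon_prog = (Asg vC (Var vN) ;; Asg vK (EArr aK (Num 0) (Var vN)) ;; Asg vQ (Num 0)) ;;
     For vIt (Var vN) recon_body ;; Sto aOut (Num 0) (Num 0) (Var vQ)"

lemma recon_correct:
  assumes s: "stored n m r x bx by c s" and c: "\<And>k. k < m \<Longrightarrow> 0 \<le> c k"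
    and sorted: "\<And>a b. a \<le> b \<Longrightarrow> b < n \<Longrightarrow> x a \<le> x b"
    and tab: "table_ok x r bx by c m (tabB s) (tabP s) (tabK s) n"
    and \<kappa>: "tabK s n = real \<kappa>" "\<kappa> < m" and out0: "\<And>i. outs s i = 0"
  shows "hoare recon_prog s (n * 20 + 6) (\<lambda>s'. \<exists>S. length S \<le> n \<and> outs s' 0 = real (length S) \<and>
     emitted m S (outs s') \<and> fst ` set S \<subseteq> {..<m} \<and> feasible n x r S \<and>
     sol_cost bx by c (fst ` set S) S \<le> tabB s n \<kappa>)" (is "hoare _ _ _ ?Q")
proof -
  let ?V = "tabB s n \<kappa>"
  have "hoare (Asg vC (Var vN) ;; Asg vK (EArr aK (Num 0) (Var vN)) ;; Asg vQ (Num 0)) s 3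
     (\<lambda>s'. s' (Rg vC) = real n \<and> s' (Rg vK) = real \<kappa> \<and> s' (Rg vQ) = 0)"
    by (rule hoare_wpl) (use s \<kappa> in \<open>auto simp: stored_def\<close>)
  then show ?thesis unfolding recon_prog_def
  proof (rule hoare_Seq)
    fix s1 assume s1: "s1 (Rg vC) = real n \<and> s1 (Rg vK) = real \<kappa> \<and> s1 (Rg vQ) = 0"
      and f1: "frame (Asg vC (Var vN) ;; Asg vK (EArr aK (Num 0) (Var vN)) ;; Asg vQ (Num 0)) s s1"
    have s1': "stored n m r x bx by c s1" by (rule stored_frame[OF s f1]) auto
    have t1: "tabB s1 = tabB s" "tabP s1 = tabP s" "tabK s1 = tabK s" "outs s1 = outs s"
      using f1 by (auto simp: frame_def)
    let ?I = "recon_state x r bx by c n m (tabB s) ?V"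
    \<comment> \<open>The empty list counts as emitted only if all opening flags are 0, which
      \<open>out0\<close> provides.\<close>
    have init: "?I 0 s1"
      unfolding recon_state_def
      using s1 t1(4) \<kappa>(2) out0 by (intro exI[of _ "[]"] exI[of _ n] exI[of _ \<kappa>]) (simp add: emitted_def recon_inv_def)
    have "hoare (For vIt (Var vN) recon_body) s1 (n * (18 + 2) + 2) (?I n)"
    proof (rule hoare_For[where I = ?I])
      show "?I 0 (s1(Rg vIt := 0))" using init by (simp add: recon_state_def)
      fix i s' assume i: "i < n" "s' (Rg vIt) = real i" "?I i s'" and f: "frame (For vIt (Var vN) recon_body) s1 s'"
      have s': "stored n m r x bx by c s'" by (rule stored_frame[OF s1' f]) auto
      have t': "tabB s' = tabB s1" "tabP s' = tabP s1" "tabK s' = tabK s1" using f by (auto simp: frame_def)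
      have "hoare recon_body s' 18 (?I (Suc i))"
        using recon_body_correct[OF s' c sorted _ _ i(1), of ?V] tab i(3) unfolding t' t1 by blast
      then show "hoare recon_body s' 18 (\<lambda>s''. ?I (Suc i) (s''(Rg vIt := real (Suc i))))"
        by (rule hoare_conseq) (auto simp: recon_state_def)
    qed (use s1' in \<open>auto simp: frame_def stored_def\<close>)
    then show "hoare (For vIt (Var vN) recon_body ;; Sto aOut (Num 0) (Num 0) (Var vQ)) s1 (n * 20 + 3) ?Q"
    proof (rule hoare_Seq)
      fix s2 assume "?I n s2"
      then obtain S k where S: "s2 (Rg vC) = 0" "s2 (Rg vQ) = real (length S)" "length S \<le> n" "emitted m S (outs s2)"
        "recon_inv x r bx by c n m (tabB s) ?V S 0 k" by (auto simp: recon_state_def)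
      \<comment> \<open>With \<open>j = 0\<close> the remaining term \<open>B 0 k = c k\<close> pays
        for the station still excluded.\<close>
      have "sum c (fst ` set S) \<le> sum c (fst ` set S - {k}) + c k"
        using sum_remove_le[of "fst ` set S" m k c "{}"] S(5) c by (simp add: recon_inv_def)
      moreover have "tabB s 0 k = c k" using tab S(5) by (simp add: table_ok_def recon_inv_def)
      ultimately have "sol_cost bx by c (fst ` set S) S \<le> ?V"
        using S(5) by (simp add: recon_inv_def sol_cost_def)
      moreover have "feasible n x r S" using S(5) by (simp add: recon_inv_def feasible_def)
      moreover have "emitted m S ((outs s2)(0 := real (length S)))" using S(4) by (simp add: emitted_def)
      ultimately have "?Q (s2(Ar aOut 0 0 := real (length S)))"
        using S(3,5) by (intro exI[of _ S]) (auto simp: recon_inv_def fun_upd_def)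
      then show "hoare (Sto aOut (Num 0) (Num 0) (Var vQ)) s2 1 ?Q"
        by (intro hoare_wpl) (use S(2) in simp_all)
    qed simp
  qed simp
qed

section \<open>Optimality of the traced-back solution\<close>

definition solve_prog :: com where
  "solve_prog = sort_prog ;; dp_prog ;; recon_prog"

text \<open>The lower bound holds for some entry of the last row, where \<open>\<kappa>\<close> is
  minimal. Its inequality for a change from \<open>k'\<close> to \<open>k\<close> goes through the
  row minimum: \<open>B j k <= B j \<kappa> + c k <= B j k' + c k\<close>.\<close>

lemma table_optimal:
  assumes tab: "table_ok x r bx by c m B P K n" and \<kappa>: "row_ok x r bx by c m B P \<kappa> (n - 1)"
    and n: "0 < n" and c: "\<And>k. k < m \<Longrightarrow> 0 \<le> c k"
    and sorted: "\<And>a b. a \<le> b \<Longrightarrow> b < n \<Longrightarrow> x a \<le> x b"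
    and sol: "is_solution m Op S" "feasible n x r S"
  shows "B n \<kappa> \<le> sol_cost bx by c Op S"
proof -
  have "\<exists>k<m. B n k \<le> sol_cost bx by c Op S"
  proof (rule dp_lower_bound[OF sorted c _ _ _ sol n])
    fix k assume "k < m"
    then show "B 0 k \<le> c k" using tab by (simp add: table_ok_def)
  next
    fix i j k assume "i \<le> j" "j < n" "k < m" "x j - r \<le> x i + r"
    then show "B (Suc j) k \<le> B i k + move_dist bx by (k, sensor_pos x r bx k i j)"
      using tab by (fastforce simp: table_ok_def row_ok_def reach_def edge_def)
  next
    fix j k k' assume j: "j \<le> n" and k: "k < m" "k' < m"
    show "B j k \<le> B j k' + c k"
    proof (cases j)
      case 0
      then show ?thesis using tab k c by (simp add: table_ok_def)
    next
      case (Suc i)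
      then have "i < n" using j by simp
      then obtain \<kappa> where "row_ok x r bx by c m B P \<kappa> i" using tab by (auto simp: table_ok_def)
      then have "B (Suc i) k \<le> B (Suc i) \<kappa> + c k" "B (Suc i) \<kappa> \<le> B (Suc i) k'"
        using k by (auto simp: row_ok_def)
      then show ?thesis using Suc by simp
    qed
  qed
  then show ?thesis using \<kappa> n by (force simp: row_ok_def)
qed

lemma solve_correct:
  assumes s: "stored n m r tx bx by c s" and n: "0 < n" and m: "0 < m" and r: "0 \<le> r"
    and c: "\<And>k. k < m \<Longrightarrow> 0 \<le> c k" and out0: "\<And>i. outs s i = 0"
  shows "hoare solve_prog s (n * (n * 7 + 4) + m * 3 + n * (m * (n * 14 + 26) + 7) + n * 20 + 12)
    (\<lambda>s'. \<exists>S. length S \<le> n \<and> outs s' 0 = real (length S) \<and> emitted m S (outs s') \<and>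
      optimal_solution n m tx bx by c r (fst ` set S) S)" (is "hoare _ _ _ ?Q")
  unfolding solve_prog_def
proof (rule hoare_Seq[OF sort_correct[OF s]])
  fix s1 assume "\<exists>x. stored n m r x bx by c s1 \<and> x ` {..<n} = tx ` {..<n} \<and> (\<forall>a b. a \<le> b \<longrightarrow> b < n \<longrightarrow> x a \<le> x b)"
    and f1: "frame sort_prog s s1"
  then obtain x where s1: "stored n m r x bx by c s1" and img: "x ` {..<n} = tx ` {..<n}"
    and sorted: "\<And>a b. a \<le> b \<Longrightarrow> b < n \<Longrightarrow> x a \<le> x b" by auto
  have feas: "feasible n x r S \<longleftrightarrow> feasible n tx r S" for S
  proof -
    have "feasible n y r S \<longleftrightarrow> (\<forall>z\<in>y ` {..<n}. \<exists>s\<in>set S. \<bar>z - snd s\<bar> \<le> r)" for y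
      by (auto simp: feasible_def)
    then show ?thesis by (simp only: img)
  qed
  show "hoare (dp_prog ;; recon_prog) s1 (m * 3 + n * (m * (n * 14 + 26) + 7) + n * 20 + 10) ?Q"
  proof (rule hoare_Seq[OF dp_correct[OF s1 r m c]])
    fix s2 assume tab: "table_ok x r bx by c m (tabB s2) (tabP s2) (tabK s2) n" and f2: "frame dp_prog s1 s2"
    have s2: "stored n m r x bx by c s2" by (rule stored_frame[OF s1 f2]) auto
    have out: "outs s2 i = 0" for i using f1 f2 out0 by (simp add: frame_def)
    obtain \<kappa> where \<kappa>: "tabK s2 n = real \<kappa>" "row_ok x r bx by c m (tabB s2) (tabP s2) \<kappa> (n - 1)"
      using tab n by (auto simp: table_ok_def dest!: spec[of _ "n - 1"])
    have "\<kappa> < m" using \<kappa>(2) by (simp add: row_ok_def)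
    from recon_correct[OF s2 c sorted tab \<kappa>(1) this out]
    show "hoare recon_prog s2 (n * 20 + 6) ?Q"
    proof (rule hoare_conseq)
      fix s3 assume "\<exists>S. length S \<le> n \<and> outs s3 0 = real (length S) \<and>
         emitted m S (outs s3) \<and> fst ` set S \<subseteq> {..<m} \<and> feasible n x r S \<and>
         sol_cost bx by c (fst ` set S) S \<le> tabB s2 n \<kappa>"
      then obtain S where S: "length S \<le> n" "outs s3 0 = real (length S)" "emitted m S (outs s3)"
        "fst ` set S \<subseteq> {..<m}" "feasible n x r S" "sol_cost bx by c (fst ` set S) S \<le> tabB s2 n \<kappa>" by blast
      have "optimal_solution n m tx bx by c r (fst ` set S) S"
        unfolding optimal_solution_def
        using S(4,5,6) feas table_optimal[OF tab \<kappa>(2) n c sorted]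
        by (auto simp: is_solution_def intro: order_trans)
      then show "?Q s3" using S by blast
    qed auto
  qed auto
qed auto

section \<open>Loading the input and delivering the output\<close>

text \<open>Cells 2 to \<open>regs - 1\<close> were moved by the prologue to addresses
  \<open>(v - 2) * m\<close> above the content of register 2; higher input cells are still in
  place.\<close>

definition copy_body :: com where
  "copy_body = IfLess (Var vK) (Num (int regs))
     (IfLess (Num 1) (Var vK)
       (Sto aIn (Num 0) (Var vK) (ERaw (EAdd (Var 2) (EMul (ESub (Var vK) (Num 2)) (Var vM))))) Skip)
     (Sto aIn (Num 0) (Var vK) (ERaw (Var vK)))"

text \<open>Register 2 is \<open>64 * (n + 3 * m)\<close>, which gives back \<open>n\<close>; it is
  also the address of the saved cell 2, which holds \<open>r\<close>.\<close>

definition setup_prog :: com where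
  "setup_prog = (Asg vN (ESub (EDiv (Var 2) (Num 64)) (EMul (Num 3) (Var vM))) ;; Asg vR (ERaw (Var 2))) ;;
     For vK (EAdd (EAdd (Num 3) (Var vN)) (EMul (Num 3) (Var vM))) copy_body"

lemma modifies_copy_body [simp]: "modifies copy_body l \<longleftrightarrow> (\<exists>i k. l = Ar aIn i k)"
  by (cases l) (auto simp: copy_body_def)

lemma modifies_setup_prog [simp]: "modifies setup_prog l \<longleftrightarrow> l \<in> {Rg vN, Rg vR, Rg vK} \<or> (\<exists>i k. l = Ar aIn i k)"
  by (cases l) (auto simp: setup_prog_def)

lemma input_mem_simps:
  "input_mem n m r tx bx by c 2 = r"
  "i < n \<Longrightarrow> input_mem n m r tx bx by c (3 + i) = tx i"
  "k < m \<Longrightarrow> input_mem n m r tx bx by c (3 + n + 3 * k) = bx k"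
  "k < m \<Longrightarrow> input_mem n m r tx bx by c (4 + n + 3 * k) = by k"
  "k < m \<Longrightarrow> input_mem n m r tx bx by c (5 + n + 3 * k) = c k"
proof -
  have "(Suc (3 * k)) mod 3 = 1" "(Suc (3 * k)) div 3 = k" "(Suc (Suc (3 * k))) mod 3 = 2" "(Suc (Suc (3 * k))) div 3 = k" for k :: nat
    by presburger+
  then show "input_mem n m r tx bx by c 2 = r"
  "i < n \<Longrightarrow> input_mem n m r tx bx by c (3 + i) = tx i"
  "k < m \<Longrightarrow> input_mem n m r tx bx by c (3 + n + 3 * k) = bx k"
  "k < m \<Longrightarrow> input_mem n m r tx bx by c (4 + n + 3 * k) = by k"
  "k < m \<Longrightarrow> input_mem n m r tx bx by c (5 + n + 3 * k) = c k"
    by (auto simp: input_mem_def Let_def)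
qed

lemma setup_correct:
  fixes n m r tx bx "by" c
  defines "inp \<equiv> input_mem n m r tx bx by c"
  assumes s: "s (Rg vM) = real m" "s (Rg 2) = real (64 * (n + 3 * m))" "s (Rg 0) = real (128 * (n + 3 * m))"
    and saved: "\<And>v. 2 \<le> v \<Longrightarrow> v < regs \<Longrightarrow> s (Raw (64 * (n + 3 * m) + (v - 2) * m)) = inp v"
    and kept: "\<And>v. regs \<le> v \<Longrightarrow> v < 3 + n + 3 * m \<Longrightarrow> s (Raw v) = inp v"
    and m: "0 < m"
  shows "hoare setup_prog s ((3 + n + 3 * m) * 5 + 4) (stored n m r tx bx by c)"
  unfolding setup_prog_def
proof (rule hoare_Seq)
  let ?N = "3 + n + 3 * m"
  let ?p = "Asg vN (ESub (EDiv (Var 2) (Num 64)) (EMul (Num 3) (Var vM))) ;; Asg vR (ERaw (Var 2))"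
  have r: "s (Raw (64 * (n + 3 * m))) = r"
    using saved[of 2] by (simp add: regs_def inp_def input_mem_simps)
  have a2: "addr (s (Rg 2)) = 64 * (n + 3 * m)" "s (Rg 2) \<in> \<nat>"
    and a0: "addr (s (Rg 0)) = 128 * (n + 3 * m)" unfolding s by (simp_all only: addr_of_nat of_nat_in_Nats)
  show "hoare ?p s 2 (\<lambda>s'. s' (Rg vN) = real n \<and> s' (Rg vR) = r)"
    by (rule hoare_wpl) (use a2 a0 s(1,2) r m in \<open>auto simp: regs_def add_divide_distrib\<close>)
  fix s1 assume s1: "s1 (Rg vN) = real n \<and> s1 (Rg vR) = r" and f1: "frame ?p s s1"
  let ?I = "\<lambda>k s'. \<forall>v<k. 2 \<le> v \<longrightarrow> s' (Ar aIn 0 v) = inp v"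
  let ?E = "EAdd (EAdd (Num 3) (Var vN)) (EMul (Num 3) (Var vM))"
  have "hoare (For vK ?E copy_body) s1 (?N * (3 + 2) + 2) (?I ?N)"
  proof (rule hoare_For[where I = ?I])
    fix k s' assume k: "k < ?N" "s' (Rg vK) = real k" "?I k s'" and f: "frame (For vK ?E copy_body) s1 s'"
    have e: "s' (Rg vM) = real m" "s' (Rg 2) = s (Rg 2)" "addr (s' (Rg 0)) = 128 * (n + 3 * m)"
      "\<And>a. s' (Raw a) = s (Raw a)"
      using f f1 s(1) a0 by (simp_all add: frame_def)
    have "wp copy_body (?I (Suc k)) s'"
    proof (cases "2 \<le> k \<and> k < regs")
      case True
      then have eq: "real k - 2 = real (k - 2)" by simp
      have ad: "addr (real k - 2) = k - 2" "real k - 2 \<in> \<nat>"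
        unfolding eq by (simp_all only: addr_of_nat of_nat_in_Nats)
      \<comment> \<open>\<open>38\<close> is \<open>regs - 2\<close>: saved cells lie at offsets of
        at most \<open>38 * m\<close>, and the gap up to \<open>Z\<close> is
        \<open>64 * (n + 3 * m)\<close>.\<close>
      have "k - 2 \<le> 38" using True unfolding regs_def by linarith
      then have "(k - 2) * m \<le> 38 * m" by (rule mult_le_mono1)
      moreover have "64 * (n + 3 * m) + y < 128 * (n + 3 * m)" if "y \<le> 38 * m" for y
        using that m by simp
      ultimately have "64 * (n + 3 * m) + (k - 2) * m < 128 * (n + 3 * m)" by blast
      then show ?thesis using ad k e a2 saved[of k] True m
        by (auto simp: copy_body_def regs_def less_Suc_eq)
    next
      case False
      then show ?thesis using k e kept[of k] m by (auto simp: copy_body_def regs_def less_Suc_eq)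
    qed
    then have "hoare copy_body s' 3 (?I (Suc k))" by (rule hoare_wpl) (simp add: copy_body_def)
    then show "hoare copy_body s' 3 (\<lambda>s''. ?I (Suc k) (s''(Rg vK := real (Suc k))))"
      by (rule hoare_conseq) auto
  qed (use s1 f1 s in \<open>auto simp: frame_def\<close>)
  then show "hoare (For vK ?E copy_body) s1 (?N * 5 + 2) (stored n m r tx bx by c)"
  proof (rule hoare_conseq)
    fix s2 assume I: "?I ?N s2" and f2: "frame (For vK ?E copy_body) s1 s2"
    show "stored n m r tx bx by c s2"
      unfolding stored_def
    proof (intro conjI allI impI)
      fix i assume "i < n"
      then show "s2 (Ar aIn 0 (3 + i)) = tx i" using I[rule_format, of "3 + i"] by (simp add: inp_def input_mem_simps)
    next
      fix k assume k: "k < m"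
      show "s2 (Ar aIn 0 (3 + n + 3 * k)) = bx k"
        using I[rule_format, of "3 + n + 3 * k"] k unfolding inp_def input_mem_simps(3)[OF k] by simp
      show "s2 (Ar aIn 0 (4 + n + 3 * k)) = by k"
        using I[rule_format, of "4 + n + 3 * k"] k unfolding inp_def input_mem_simps(4)[OF k] by simp
      show "s2 (Ar aIn 0 (5 + n + 3 * k)) = c k"
        using I[rule_format, of "5 + n + 3 * k"] k unfolding inp_def input_mem_simps(5)[OF k] by simp
    qed (use s1 f1 f2 s in \<open>simp_all add: frame_def\<close>)
  qed simp
qed simp

text \<open>Cells below \<open>regs\<close> still serve as registers and stack; the epilogue fills
  them.\<close>

definition export_body :: com where
  "export_body = IfLess (Var vK) (Num (int regs)) Skip (RawSto (Var vK) (EArr aOut (Num 0) (Var vK)))"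

definition export_prog :: com where
  "export_prog = For vK (EAdd (EAdd (Var vM) (Num 1)) (EMul (Num 2) (EArr aOut (Num 0) (Num 0)))) export_body"

lemma modifies_export_body [simp]: "modifies export_body l \<longleftrightarrow> (\<exists>a. l = Raw a)"
  by (cases l) (auto simp: export_body_def)

lemma modifies_export_prog [simp]: "modifies export_prog l \<longleftrightarrow> l = Rg vK \<or> (\<exists>a. l = Raw a)"
  by (simp add: export_prog_def)

lemma export_correct:
  assumes s: "s (Rg vM) = real m" "outs s 0 = real l" "s (Rg 0) = real Z" and Z: "m + 1 + 2 * l \<le> Z"
  shows "hoare export_prog s ((m + 1 + 2 * l) * 4 + 2) (\<lambda>s'. \<forall>v. regs \<le> v \<longrightarrow> v < m + 1 + 2 * l \<longrightarrow> s' (Raw v) = outs s v)"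
proof -
  let ?I = "\<lambda>N s'. \<forall>v. regs \<le> v \<longrightarrow> v < N \<longrightarrow> s' (Raw v) = outs s v"
  let ?N = "m + 1 + 2 * l"
  have "hoare export_prog s (?N * (2 + 2) + 2) (?I ?N)"
    unfolding export_prog_def
  proof (rule hoare_For[where I = ?I])
    fix k s' assume k: "k < ?N" "s' (Rg vK) = real k" "?I k s'"
      and f: "frame (For vK (EAdd (EAdd (Var vM) (Num 1)) (EMul (Num 2) (EArr aOut (Num 0) (Num 0)))) export_body) s s'"
    have e: "s' (Rg 0) = real Z" "outs s' = outs s" using f s by (auto simp: frame_def)
    have "wp export_body (?I (Suc k)) s'"
      using k e fun_cong[OF e(2)] Z by (auto simp: export_body_def less_Suc_eq)
    then have "hoare export_body s' 2 (?I (Suc k))" by (rule hoare_wpl) (simp add: export_body_def)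
    then show "hoare export_body s' 2 (\<lambda>s''. ?I (Suc k) (s''(Rg vK := real (Suc k))))"
      by (rule hoare_conseq) auto
  qed (use s in \<open>auto simp: frame_def regs_def\<close>)
  then show ?thesis by simp
qed

section \<open>The assembled program and its running time\<close>

definition main_prog :: com where
  "main_prog = setup_prog ;; solve_prog ;; export_prog"

lemma wfc_main_prog: "wfc main_prog"
  by (simp add: main_prog_def setup_prog_def copy_body_def solve_prog_def sort_prog_def dp_prog_def
      row_prog_def cell_prog_def inner_body_def switch_body_def recon_prog_def recon_body_def locate_prog_def
      emit_prog_def calc_def xE_def stationE_def export_prog_def export_body_def tmpreg_def regs_def)

text \<open>For positive \<open>n\<close> and \<open>m\<close> every monomial of the total,
  constants included, is at most \<open>n ^ 4 * m\<close>; \<open>150\<close> is the sum of the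
  coefficients, with \<open>l <= n\<close>.\<close>

lemma main_time:
  fixes n m l :: nat
  assumes "0 < n" "0 < m" "l \<le> n"
  shows "(3 + n + 3 * m) * 5 + 4 + ((n * (n * 7 + 4) + m * 3 + n * (m * (n * 14 + 26) + 7) + n * 20 + 12)
     + ((m + 1 + 2 * l) * 4 + 2)) \<le> 150 * (n ^ 4 * m)"
proof -
  let ?w = "n ^ 4 * m"
  have 1: "1 \<le> n * n" "1 \<le> n * n * m" using assms by (simp_all add: Suc_le_eq)
  have w: "n * n * m \<le> ?w" using mult_le_mono[OF 1(1) order_refl[of "n * n * m"]]
    by (simp add: power4_eq_xxxx mult.assoc)
  have a: "n * m \<le> n * n * m" "n * n \<le> n * n * m" "m \<le> n * m" "n \<le> n * m" using assms by simp_all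
  have "n * n * m \<le> ?w" "n * m \<le> ?w" "n * n \<le> ?w" "m \<le> ?w" "n \<le> ?w" "1 \<le> ?w"
    using w a 1(2) by linarith+
  moreover have "(3 + n + 3 * m) * 5 + 4 + ((n * (n * 7 + 4) + m * 3 + n * (m * (n * 14 + 26) + 7) + n * 20 + 12)
     + ((m + 1 + 2 * l) * 4 + 2)) = 37 + 36 * n + 22 * m + 7 * (n * n) + 14 * (n * n * m) + 26 * (n * m) + 8 * l"
    by (simp add: algebra_simps)
  ultimately show ?thesis using assms(3) by linarith
qed

lemma main_correct:
  fixes n m r tx bx "by" c
  defines "inp \<equiv> input_mem n m r tx bx by c"
  assumes s: "s (Rg vM) = real m" "s (Rg 2) = real (64 * (n + 3 * m))" "s (Rg 0) = real (128 * (n + 3 * m))"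
    and saved: "\<And>v. 2 \<le> v \<Longrightarrow> v < regs \<Longrightarrow> s (Raw (64 * (n + 3 * m) + (v - 2) * m)) = inp v"
    and kept: "\<And>v. regs \<le> v \<Longrightarrow> v < 3 + n + 3 * m \<Longrightarrow> s (Raw v) = inp v"
    and out0: "\<And>i. outs s i = 0"
    and n: "0 < n" and m: "0 < m" and r: "0 \<le> r" and c: "\<And>k. k < m \<Longrightarrow> 0 \<le> c k"
  shows "hoare main_prog s (150 * (n ^ 4 * m)) (\<lambda>s'. \<exists>S. length S \<le> n \<and> outs s' 0 = real (length S) \<and> emitted m S (outs s') \<and>
      optimal_solution n m tx bx by c r (fst ` set S) S \<and>
      (\<forall>v. regs \<le> v \<longrightarrow> v < m + 1 + 2 * length S \<longrightarrow> s' (Raw v) = outs s' v))" (is "hoare _ _ _ ?Q")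
  unfolding main_prog_def
proof (rule hoare_Seq[OF setup_correct[OF s saved[unfolded inp_def] kept[unfolded inp_def] m]])
  fix s1 assume s1: "stored n m r tx bx by c s1" and f1: "frame setup_prog s s1"
  have out1: "outs s1 i = 0" for i using f1 out0 by (simp add: frame_def)
  show "hoare (solve_prog ;; export_prog) s1 ((n * (n * 7 + 4) + m * 3 + n * (m * (n * 14 + 26) + 7) + n * 20 + 12)
     + ((m + 1 + 2 * n) * 4 + 2)) ?Q"
  proof (rule hoare_Seq[OF solve_correct[OF s1 n m r c out1]])
    fix s2 assume "\<exists>S. length S \<le> n \<and> outs s2 0 = real (length S) \<and> emitted m S (outs s2) \<and>
      optimal_solution n m tx bx by c r (fst ` set S) S" and f2: "frame solve_prog s1 s2"
    then obtain S where S: "length S \<le> n" "outs s2 0 = real (length S)" "emitted m S (outs s2)"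
      "optimal_solution n m tx bx by c r (fst ` set S) S" by blast
    have s2: "s2 (Rg vM) = real m" "s2 (Rg 0) = real (128 * (n + 3 * m))"
      using s1 f1 f2 s by (auto simp: frame_def stored_def solve_prog_def recon_prog_def)
    show "hoare export_prog s2 ((m + 1 + 2 * n) * 4 + 2) ?Q"
    proof (rule hoare_conseq[OF export_correct[OF s2(1) S(2) s2(2)]])
      fix s3 assume v: "\<forall>v. regs \<le> v \<longrightarrow> v < m + 1 + 2 * length S \<longrightarrow> s3 (Raw v) = outs s2 v"
        and f3: "frame export_prog s2 s3"
      have e: "outs s3 = outs s2" using f3 by (auto simp: frame_def)
      show "?Q s3" using S v e fun_cong[OF e] by (intro exI[of _ S]) auto
    qed (use S(1) n m in auto)
  qed auto
qed (use main_time[OF n m order_refl] in auto)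

text \<open>The input leaves no free cell whose address is known in advance.  Cell 0 is therefore overwritten by the address
  \<open>64 * (n + 3 * m)\<close>, from which \<open>n\<close> can be recovered; it then moves in steps of \<open>m\<close>, the only increment available,
  while the low cells are saved.\<close>
definition prologue :: "instr list" where
  "prologue = (replicate 3 (Add 0 0 1) @ replicate 6 (Add 0 0 0)) @
     concat (map (\<lambda>v. [Store 0 v, Add 0 0 1]) [2..<regs]) @
     [Const 2 (int (regs - 2)), Mul 2 2 1, Sub 2 0 2, Add 0 2 2]"

text \<open>The stride \<open>m > 0\<close> keeps saved cells apart, and \<open>2 + d <= A\<close>
  keeps them off the low cells that still have to be saved.\<close>

lemma run_straight_save:
  assumes "mem 0 = real A" "mem 1 = real m" "0 < m" "2 + d \<le> A"
  shows "\<exists>mem'. run_straight (concat (map (\<lambda>v. [Store 0 v, Add 0 0 1]) [2..<2 + d])) mem = Some mem' \<and>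
     mem' 0 = real (A + d * m) \<and> (\<forall>v. 2 \<le> v \<longrightarrow> v < 2 + d \<longrightarrow> mem' (A + (v - 2) * m) = mem v) \<and>
     (\<forall>a. 0 < a \<longrightarrow> a < A \<or> A + d * m \<le> a \<longrightarrow> mem' a = mem a)"
  using assms(4)
proof (induction d)
  case 0
  then show ?case using assms by simp
next
  case (Suc d)
  then obtain m1 where m1: "run_straight (concat (map (\<lambda>v. [Store 0 v, Add 0 0 1]) [2..<2 + d])) mem = Some m1"
    "m1 0 = real (A + d * m)" "\<forall>v. 2 \<le> v \<longrightarrow> v < 2 + d \<longrightarrow> m1 (A + (v - 2) * m) = mem v"
    "\<forall>a. 0 < a \<longrightarrow> a < A \<or> A + d * m \<le> a \<longrightarrow> m1 a = mem a" by auto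
  have one: "m1 1 = real m" "m1 (2 + d) = mem (2 + d)" using m1(4) Suc.prems assms(2) by auto
  let ?x = "A + d * m"
  let ?m = "m1(?x := mem (2 + d), 0 := real (A + Suc d * m))"
  have nat: "m1 0 \<in> \<nat>" "addr (m1 0) = ?x" unfolding m1(2) by (simp_all only: of_nat_in_Nats addr_of_nat)
  have x: "?x \<noteq> 0" "?x \<noteq> 1" using Suc.prems by auto
  have "run_straight [Store 0 (2 + d), Add 0 0 1] m1 = Some ?m"
    using nat x one m1(2) Suc.prems by (simp add: algebra_simps)
  then have "run_straight (concat (map (\<lambda>v. [Store 0 v, Add 0 0 1]) [2..<2 + Suc d])) mem = Some ?m"
    using run_straight_appendI[OF m1(1)] by simp
  moreover have "?m (A + (v - 2) * m) = mem v" if v: "2 \<le> v" "v < 2 + Suc d" for v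
  proof (cases "v = 2 + d")
    case False
    then have "(v - 2) * m < d * m" using v assms(3) by simp
    then show ?thesis using m1(3) v False Suc.prems by simp
  qed (use x Suc.prems in simp)
  moreover have "?m a = mem a" if "0 < a" "a < A \<or> A + Suc d * m \<le> a" for a
    using that m1(4) assms(3) by auto
  moreover have "?m 0 = real (A + Suc d * m)" by simp
  ultimately show ?case by blast
qed

lemma run_straight_add_repeat:
  "run_straight (replicate d (Add 0 0 1)) mem = Some (mem(0 := mem 0 + real d * mem 1))"
  by (induction d arbitrary: mem) (simp_all add: algebra_simps)

lemma run_straight_double_repeat:
  "run_straight (replicate d (Add 0 0 0)) mem = Some (mem(0 := 2 ^ d * mem 0))"
  by (induction d arbitrary: mem) (simp_all add: algebra_simps)

text \<open>Saving may dirty cells from \<open>64 * (n + 3 * m)\<close> on, so the arrays start at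
  twice that address; from there on cells keep their initial content, which is 0 for an input
  memory.\<close>

lemma prologue_correct:
  assumes "mem 0 = real n" "mem 1 = real m" "0 < m"
  obtains mem' where "run_straight prologue mem = Some mem'" "mem' 0 = real (128 * (n + 3 * m))"
    "mem' 1 = real m" "mem' 2 = real (64 * (n + 3 * m))"
    "\<And>v. 2 \<le> v \<Longrightarrow> v < regs \<Longrightarrow> mem' (64 * (n + 3 * m) + (v - 2) * m) = mem v"
    "\<And>a. 2 < a \<Longrightarrow> a < 64 * (n + 3 * m) \<or> 128 * (n + 3 * m) \<le> a \<Longrightarrow> mem' a = mem a"
proof -
  let ?A = "64 * (n + 3 * m)"
  let ?m0 = "mem(0 := real ?A)"
  have 0: "run_straight (replicate 3 (Add 0 0 1) @ replicate 6 (Add 0 0 0)) mem = Some ?m0"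
  proof -
    have "run_straight (replicate 3 (Add 0 0 1)) mem = Some (mem(0 := real (n + 3 * m)))"
      using run_straight_add_repeat[of 3 mem] assms(1,2) by simp
    moreover have "run_straight (replicate 6 (Add 0 0 0)) (mem(0 := real (n + 3 * m))) = Some ?m0"
      using run_straight_double_repeat[of 6 "mem(0 := real (n + 3 * m))"] by simp
    ultimately show ?thesis by (rule run_straight_appendI)
  qed
  have mem0: "?m0 0 = real ?A" "?m0 1 = real m" using assms(2) by simp_all
  have pre: "2 + (regs - 2) \<le> ?A" using assms(3) by (simp add: regs_def)
  obtain m1 where m1: "run_straight (concat (map (\<lambda>v. [Store 0 v, Add 0 0 1]) [2..<2 + (regs - 2)])) ?m0 = Some m1"
     "m1 0 = real (?A + (regs - 2) * m)" "\<And>v. 2 \<le> v \<Longrightarrow> v < 2 + (regs - 2) \<Longrightarrow> m1 (?A + (v - 2) * m) = ?m0 v"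
     "\<And>a. 0 < a \<Longrightarrow> a < ?A \<or> ?A + (regs - 2) * m \<le> a \<Longrightarrow> m1 a = ?m0 a"
    using run_straight_save[OF mem0 assms(3) pre] by blast
  have regs2: "2 + (regs - 2) = regs" by (simp add: regs_def)
  have one: "m1 1 = real m" using m1(4)[of 1] assms by simp
  let ?m = "m1(2 := real ?A, 0 := real (128 * (n + 3 * m)))"
  \<comment> \<open>With \<open>A\<close> for the start of the saved cells, cell 0 is now
    \<open>A + (regs - 2) * m\<close>; subtracting the product gives \<open>A\<close>, and doubling
    gives \<open>Z\<close>.\<close>
  have "run_straight [Const 2 (int (regs - 2)), Mul 2 2 1, Sub 2 0 2, Add 0 2 2] m1 = Some ?m"
    using m1(2) one by (simp add: regs_def algebra_simps)
  then have "run_straight prologue mem = Some ?m"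
    unfolding prologue_def by (intro run_straight_appendI[OF 0] run_straight_appendI[OF m1(1)[unfolded regs2]])
  moreover have "?m (?A + (v - 2) * m) = mem v" if "2 \<le> v" "v < regs" for v
    using that m1(3)[of v] assms(3) regs2 by auto
  moreover have "?m a = mem a" if "2 < a" "a < ?A \<or> 128 * (n + 3 * m) \<le> a" for a
  proof -
    have "(regs - 2) * m \<le> 64 * (n + 3 * m)" by (simp add: regs_def)
    then have "a < ?A \<or> ?A + (regs - 2) * m \<le> a" using that(2) by linarith
    then show ?thesis using m1(4)[of a] that(1) by simp
  qed
  ultimately show ?thesis using one by (intro that[of ?m]) auto
qed

text \<open>The output must replace the registers themselves: each of them receives the address of its final content and is then
  loaded through itself, register 0 (the array base, and the address of \<open>Ar aOut 0 0\<close>) last.\<close>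
definition epilogue :: "instr list" where
  "epilogue = concat (map (\<lambda>v. [Const v (int (prod_encode (aOut, prod_encode (0, v)))), Add v v 0, Load v v]) [1..<regs])
     @ [Load 0 0]"

text \<open>All writes go below \<open>regs <= Z\<close>, so the array entries still to be loaded
  survive.\<close>

lemma run_straight_restore:
  assumes "mem 0 = real Z" "regs \<le> Z" "1 + d \<le> regs"
  shows "\<exists>mem'. run_straight (concat (map (\<lambda>v. [Const v (int (prod_encode (aOut, prod_encode (0, v)))), Add v v 0, Load v v])
       [1..<1 + d])) mem = Some mem' \<and>
     (\<forall>v. mem' v = (if 1 \<le> v \<and> v < 1 + d then mem (cell Z aOut 0 v) else mem v))"
  using assms(3)
proof (induction d)
  case (Suc d)
  let ?f = "\<lambda>v. [Const v (int (prod_encode (aOut, prod_encode (0, v)))), Add v v 0, Load v v]"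
  obtain m1 where m1: "run_straight (concat (map ?f [1..<1 + d])) mem = Some m1"
    "\<forall>v. m1 v = (if 1 \<le> v \<and> v < 1 + d then mem (cell Z aOut 0 v) else mem v)" using Suc by auto
  let ?v = "1 + d"
  let ?m = "m1(?v := mem (cell Z aOut 0 ?v))"
  have ge: "cell Z aOut 0 ?v \<ge> regs" using cell_ge[of Z aOut 0 ?v] assms(2) by simp
  have "m1 0 = real Z" using m1(2) assms(1) by simp
  then have sum: "real (prod_encode (aOut, prod_encode (0, ?v))) + m1 0 = real (cell Z aOut 0 ?v)"
    by (simp add: cell_def)
  have "run_straight (?f ?v) m1 = Some ?m"
    using sum ge Suc.prems m1(2) by (simp add: cell_def add.commute)
  then have "run_straight (concat (map ?f [1..<1 + Suc d])) mem = Some ?m"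
    using run_straight_appendI[OF m1(1)] by simp
  then show ?case using m1(2) by (intro exI[of _ ?m]) auto
qed simp

lemma epilogue_correct:
  assumes "mem 0 = real Z" "regs \<le> Z"
  obtains mem' where "run_straight epilogue mem = Some mem'"
    "\<And>v. v < regs \<Longrightarrow> mem' v = mem (cell Z aOut 0 v)" "\<And>v. regs \<le> v \<Longrightarrow> mem' v = mem v"
proof -
  have pre: "1 + (regs - 1) \<le> regs" and regs1: "1 + (regs - 1) = regs" by (simp_all add: regs_def)
  obtain m1 where m1: "run_straight (concat (map (\<lambda>v. [Const v (int (prod_encode (aOut, prod_encode (0, v)))), Add v v 0, Load v v])
       [1..<regs])) mem = Some m1"
     "\<And>v. m1 v = (if 1 \<le> v \<and> v < regs then mem (cell Z aOut 0 v) else mem v)"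
    using run_straight_restore[of mem Z "regs - 1"] assms pre unfolding regs1 by blast
  have "cell Z aOut 0 0 = Z" by (simp add: cell_def prod_encode_def)
  then have "run_straight [Load 0 0] m1 = Some (m1(0 := mem (cell Z aOut 0 0)))"
    using m1(2)[of 0] m1(2)[of Z] assms by simp
  then have "run_straight epilogue mem = Some (m1(0 := mem (cell Z aOut 0 0)))"
    unfolding epilogue_def by (rule run_straight_appendI[OF m1(1)])
  then show ?thesis by (rule that) (use m1(2) assms in \<open>auto simp: regs_def\<close>)
qed

lemma nojump_prologue: "list_all nojump prologue"
  by (auto simp: prologue_def list_all_iff)

lemma nojump_epilogue: "list_all nojump epilogue"
  by (auto simp: epilogue_def list_all_iff)

lemma emitted_output:
  assumes e: "emitted m S out" and out0: "out 0 = real (length S)" and S: "fst ` set S \<subseteq> {..<m}"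
  shows "output_wf m out" "out_open m out = fst ` set S" "out_sensors m out = S"
proof -
  have "fst (S ! q) < m" if "q < length S" for q using S nth_mem[OF that] by auto
  then show "output_wf m out" using e out0 by (auto simp: output_wf_def emitted_def)
  show "out_open m out = fst ` set S" using e S by (auto simp: out_open_def emitted_def split: if_splits)
  show "out_sensors m out = S"
    by (rule nth_equalityI) (use e out0 in \<open>auto simp: out_sensors_def emitted_def\<close>)
qed

lemma emitted_cong:
  assumes "emitted m S out" "\<And>v. v < m + 1 + 2 * length S \<Longrightarrow> out' v = out v"
  shows "emitted m S out'"
  using assms by (simp add: emitted_def)

definition ram_prog :: "instr list" where
  "ram_prog = prologue @ ccom (length prologue) main_prog @ epilogue @ [Halt]"

lemma ram_prog_correct:
  assumes n: "1 \<le> n" and m: "1 \<le> m" and r: "0 \<le> r" and c: "\<forall>k<m. 0 \<le> c k"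
  shows "\<exists>t out. t \<le> (length prologue + clen main_prog * 150 + length epilogue + 1) * n ^ 4 * m \<and>
    halts_within ram_prog (input_mem n m r tx bx by c) t out \<and> output_wf m out \<and>
    optimal_solution n m tx bx by c r (out_open m out) (out_sensors m out)"
proof -
  let ?P = ram_prog
  let ?inp = "input_mem n m r tx bx by c"
  let ?Z = "128 * (n + 3 * m)"
  let ?pc = "length prologue"
  have n': "0 < n" and m': "0 < m" and c': "\<And>k. k < m \<Longrightarrow> 0 \<le> c k" using n m c by auto
  have Z: "regs \<le> ?Z" using n m by (simp add: regs_def)
  have i0: "?inp 0 = real n" "?inp 1 = real m" by (simp_all add: input_mem_def)
  obtain m0 where m0: "run_straight prologue ?inp = Some m0" "m0 0 = real ?Z"
    "m0 1 = real m" "m0 2 = real (64 * (n + 3 * m))"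
    "\<And>v. 2 \<le> v \<Longrightarrow> v < regs \<Longrightarrow> m0 (64 * (n + 3 * m) + (v - 2) * m) = ?inp v"
    "\<And>a. 2 < a \<Longrightarrow> a < 64 * (n + 3 * m) \<or> ?Z \<le> a \<Longrightarrow> m0 a = ?inp a"
    using prologue_correct[OF i0 m'] by blast
  define s0 where "s0 = (\<lambda>l. case l of Rg v \<Rightarrow> m0 v | Ar a i k \<Rightarrow> m0 (cell ?Z a i k) | Raw a \<Rightarrow> m0 a)"
  have rel0: "rel ?Z s0 m0" using m0(2) by (simp add: rel_def s0_def)
  have out0: "outs s0 i = 0" for i
  proof -
    have "?Z \<le> cell ?Z aOut 0 i" by (rule cell_ge)
    then have "m0 (cell ?Z aOut 0 i) = ?inp (cell ?Z aOut 0 i)" "cell ?Z aOut 0 i \<ge> 3 + n + 3 * m"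
      using n m by (auto intro: m0(6))
    then show ?thesis by (simp add: s0_def input_mem_def)
  qed
  have "hoare main_prog s0 (150 * (n ^ 4 * m)) (\<lambda>s'. \<exists>S. length S \<le> n \<and> outs s' 0 = real (length S) \<and> emitted m S (outs s') \<and>
      optimal_solution n m tx bx by c r (fst ` set S) S \<and>
      (\<forall>v. regs \<le> v \<longrightarrow> v < m + 1 + 2 * length S \<longrightarrow> s' (Raw v) = outs s' v))"
  proof (rule main_correct[where s = s0 and n = n and m = m and r = r and tx = tx and bx = bx and ?by = "by" and c = c])
    fix v assume "regs \<le> v" "v < 3 + n + 3 * m"
    then show "s0 (Raw v) = ?inp v" using m0(6)[of v] n m by (simp add: s0_def regs_def)
  qed (use m0 out0 n' m' r c' in \<open>auto simp: s0_def\<close>)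
  then obtain T s1 S where T: "bigstep main_prog s0 T s1" "T \<le> 150 * (n ^ 4 * m)"
    and Sn: "length S \<le> n"
    and S: "outs s1 0 = real (length S)" "emitted m S (outs s1)" "optimal_solution n m tx bx by c r (fst ` set S) S"
      "\<forall>v. regs \<le> v \<longrightarrow> v < m + 1 + 2 * length S \<longrightarrow> s1 (Raw v) = outs s1 v"
    by (auto simp: hoare_def)
  have at: "code_at ?P 0 prologue" "code_at ?P ?pc (ccom ?pc main_prog)"
    "code_at ?P (?pc + clen main_prog) epilogue" "code_at ?P (?pc + clen main_prog + length epilogue) [Halt]"
  proof -
    have "code_at ?P 0 (prologue @ ccom ?pc main_prog @ epilogue @ [Halt])"
      unfolding code_at_def ram_prog_def by (intro exI[of _ "[]"]) simp
    then show "code_at ?P 0 prologue" "code_at ?P ?pc (ccom ?pc main_prog)"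
      "code_at ?P (?pc + clen main_prog) epilogue" "code_at ?P (?pc + clen main_prog + length epilogue) [Halt]"
      unfolding code_at_append length_ccom by (simp_all add: add.assoc)
  qed
  obtain u m1 where m1: "steps_to ?P ?pc m0 u (?pc + clen main_prog) m1" "rel ?Z s1 m1" "u \<le> clen main_prog * T"
    using ccom_correct[OF T(1) rel0 Z wfc_main_prog at(2) order_refl] by blast
  obtain m2 where m2: "run_straight epilogue m1 = Some m2" "\<And>v. v < regs \<Longrightarrow> m2 v = m1 (cell ?Z aOut 0 v)"
    "\<And>v. regs \<le> v \<Longrightarrow> m2 v = m1 v"
    by (rule epilogue_correct[of m1 ?Z]) (use m1(2) Z in \<open>auto simp: rel_def\<close>)
  have "steps_to ?P 0 ?inp ?pc ?pc m0"
    using steps_to_exs[OF nojump_prologue m0(1) at(1)] by simp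
  moreover have "steps_to ?P (?pc + clen main_prog) m1 (length epilogue) (?pc + clen main_prog + length epilogue) m2"
    using steps_to_exs[OF nojump_epilogue m2(1) at(3)] by simp
  ultimately have "steps_to ?P 0 ?inp (?pc + u + length epilogue) (?pc + clen main_prog + length epilogue) m2"
    using m1(1) steps_to_trans by blast
  then have halt: "halts_within ?P ?inp (Suc (?pc + u + length epilogue)) m2"
    using code_at_nth[OF at(4)] by (simp add: steps_to_def halts_within_def)
  \<comment> \<open>This absorbs the fixed cost of prologue, epilogue and \<open>Halt\<close> into
    the constant.\<close>
  have "1 \<le> n ^ 4 * m" using n' m' by (simp add: Suc_le_eq)
  then have one: "L \<le> L * (n ^ 4 * m)" for L by simp
  have "u \<le> clen main_prog * (150 * (n ^ 4 * m))"
    using m1(3) mult_le_mono2[OF T(2), of "clen main_prog"] by linarith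
  then have "Suc (?pc + u + length epilogue)
      \<le> (?pc + length epilogue + 1) * (n ^ 4 * m) + clen main_prog * (150 * (n ^ 4 * m))"
    using one[of "?pc + length epilogue + 1"] by linarith
  also have "\<dots> = (?pc + clen main_prog * 150 + length epilogue + 1) * n ^ 4 * m"
    by (simp add: algebra_simps)
  finally have time: "Suc (?pc + u + length epilogue)
      \<le> (?pc + clen main_prog * 150 + length epilogue + 1) * n ^ 4 * m" .
  \<comment> \<open>Cells below \<open>regs\<close> come from the epilogue, the others from the
    export loop; \<open>length S <= n\<close> keeps the output below \<open>Z\<close>.\<close>
  have out: "m2 v = outs s1 v" if v: "v < m + 1 + 2 * length S" for v
  proof (cases "v < regs")
    case True
    then show ?thesis using m2(2) m1(2) by (simp add: rel_def)
  next
    case False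
    moreover have "v < ?Z" using v Sn n' by simp
    ultimately show ?thesis using m2(3)[of v] m1(2) S(4) v by (simp add: rel_def)
  qed
  have "fst ` set S \<subseteq> {..<m}" using S(3) by (simp add: optimal_solution_def is_solution_def)
  moreover have "emitted m S m2" by (rule emitted_cong[OF S(2) out])
  moreover have "m2 0 = real (length S)" using out[of 0] S(1) by simp
  ultimately show ?thesis
    using halt time S(3) emitted_output[of m S m2]
    by (intro exI[of _ "Suc (?pc + u + length epilogue)"] exI[of _ m2]) simp
qed

theorem theorem1:
  "\<exists>(P :: instr list) (C :: nat). \<forall>n m r tx bx by c.
     n \<ge> 1 \<longrightarrow> m \<ge> 1 \<longrightarrow> r \<ge> 0 \<longrightarrow> (\<forall>k<m. c k \<ge> 0) \<longrightarrow>
     (\<exists>t out. t \<le> C * n ^ 4 * m \<and>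
        halts_within P (input_mem n m r tx bx by c) t out \<and>
        output_wf m out \<and>
        optimal_solution n m tx bx by c r (out_open m out) (out_sensors m out))"
proof (rule exI[of _ ram_prog], rule exI[of _ "length prologue + clen main_prog * 150 + length epilogue + 1"],
    intro allI impI)
  fix n m :: nat and r :: real and tx bx "by" c :: "nat \<Rightarrow> real"
  assume "1 \<le> n" "1 \<le> m" "0 \<le> r" "\<forall>k<m. 0 \<le> c k"
  then show "\<exists>t out. t \<le> (length prologue + clen main_prog * 150 + length epilogue + 1) * n ^ 4 * m \<and>
        halts_within ram_prog (input_mem n m r tx bx by c) t out \<and>
        output_wf m out \<and>
        optimal_solution n m tx bx by c r (out_open m out) (out_sensors m out)"
    by (rule ram_prog_correct)
qed

end
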